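(* Let $u$ be a minimizer in $\Omega$ for the functional $J$, let $0\in\Omega\cap\Gamma$, and let $u_0$ be a blow-up limit of $u$ at $0$. Assume that $Q$ is continuous at $0$, that $\Phi_0'(r)\ge 0$ for any $r\in(0,\lambda_2\lambda_\Omega)$ and that $\mathcal L^n(\Omega^+(u))\ge\varpi>0$. Then, for any fixed $r>0$, $u_0$ is a minimizer of the functional $$J_0[w]:=\int_{B_r}|\nabla w|^2+\lambda_0\,\mathcal L^n\big(B_r\cap\{w>0\}\big),$$ (among all $w$ with $w-u_0\in W^{1,2}_0(B_r)$), where $$\lambda_0:=\lambda_2\,Q(0)\,\Phi_0'\left(\lambda_2\int_\Omega Q(x)\,\chi_{\{u>0\}}(x)\,dx\right).$$
   Context: Setting. $\Omega\subset\mathbb R^n$ is open and bounded; $\lambda_1\ge0$, $\lambda_2>0$ are constants; $Q:\Omega\to\mathbb R$ is measurable with $0<Q_1\le Q(x)\le Q_2<\infty$ for constants $Q_1,Q_2$; $\lambda_\Omega:=\int_\Omega Q\,dx$. Set $\mathcal M_1(u):=\lambda_1\int_\Omega Q\,\chi_{\{u\le0\}}\,dx$ and $\mathcal M_2(u):=\lambda_2\int_\Omega Q\,\chi_{\{u>0\}}\,dx$. $\Phi:[0,\infty)\times[0,\infty)\to[0,\infty)$ is continuous, is $C^1$ with values in $(0,\infty)$ on $(0,\infty)\times(0,\infty)$, and $\Phi(0,0)=0$. Put $\Phi_0(r):=\Phi\big(\lambda_1(\lambda_\Omega-\lambda_2^{-1}r),\,r\big)$, so that $\Phi(\mathcal M_1(u),\mathcal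 M_2(u))=\Phi_0(\mathcal M_2(u))$. The functional is $J[u]:=\int_\Omega|\nabla u|^2\,dx+\Phi_0(\mathcal M_2(u))$. Given $\bar u\in W^{1,2}(\Omega)$, the admissible class is $\mathcal A:=\{u\in W^{1,2}(\Omega): u-\bar u\in W^{1,2}_0(\Omega)\}$; a minimizer in $\Omega$ for $J$ is $u\in\mathcal A$ with $J[u]\le J[v]$ for all $v\in\mathcal A$. Notation: $\Omega^+(u):=\{x\in\Omega:u(x)>0\}$; $\Gamma:=\partial\Omega^+(u)$; $\mathcal L^n$ is Lebesgue measure; $B_r:=B_r(0)$ is the open ball. Blow-up limit at $0\in\Gamma$: for a sequence $\rho_k\to0^+$ let $u_k(x):=u(\rho_kx)/\rho_k$. A blow-up limit is a continuous function $u_0:\mathbb R^n\to\mathbb R$ with linear growth such that, along a subsequence, $u_k\to u_0$ in $C^\alpha_{\rm loc}(\mathbb R^n)$ for any $\alpha\in(0,1)$, $\nabla u_k\to\nabla u_0$ weakly in $L^q_{\rm loc}(\mathbb R^n)$ for any $q>1$, $\partial\{u_k>0\}\to\partial\{u_0>0\}$ locally in Hausdorff distance, and $\chi_{\{u_k>0\}}\to\chi_{\{u_0>0\}}$ in $L^1_{\rm loc}(\mathbb R^n)$ (such limits exist for minimizers). *)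

theory Defs
  imports "HOL-Analysis.Analysis"
begin

section \<open>Test functions and Sobolev spaces\<close>

text \<open>Functions of class \<open>C\<^sup>k\<close> on an open subset of a finite-dimensional space: all directional
  derivatives of order at most \<open>k\<close> exist and are continuous.\<close>

primrec Ck_on :: "nat \<Rightarrow> 'a::euclidean_space set \<Rightarrow> ('a \<Rightarrow> real) \<Rightarrow> bool" where
  "Ck_on 0 S f \<longleftrightarrow> continuous_on S f"
| "Ck_on (Suc k) S f \<longleftrightarrow>
     (\<forall>x\<in>S. f differentiable (at x)) \<and> (\<forall>v. Ck_on k S (\<lambda>x. frechet_derivative f (at x) v))"

definition test_function :: "(real^'n) set \<Rightarrow> (real^'n \<Rightarrow> real) \<Rightarrow> bool" where
  "test_function S \<phi> \<longleftrightarrow>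
     (\<forall>k. Ck_on k UNIV \<phi>) \<and> compact (closure {x. \<phi> x \<noteq> 0}) \<and> closure {x. \<phi> x \<noteq> 0} \<subseteq> S"

definition has_weak_gradient ::
    "(real^'n) set \<Rightarrow> (real^'n \<Rightarrow> real) \<Rightarrow> (real^'n \<Rightarrow> real^'n) \<Rightarrow> bool" where
  "has_weak_gradient S f G \<longleftrightarrow>
     (\<forall>K. compact K \<and> K \<subseteq> S \<longrightarrow> f absolutely_integrable_on K \<and> G absolutely_integrable_on K) \<and>
     (\<forall>\<phi> i. test_function S \<phi> \<longrightarrow>
        (LINT x:S|lebesgue. f x * frechet_derivative \<phi> (at x) (axis i 1))
          = - (LINT x:S|lebesgue. G x $ i * \<phi> x))"

text \<open>A weak gradient is determined only up to a null subset of \<open>S\<close>; we select one.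
  Its values outside \<open>S\<close> are arbitrary.\<close>

definition weak_gradient :: "(real^'n) set \<Rightarrow> (real^'n \<Rightarrow> real) \<Rightarrow> real^'n \<Rightarrow> real^'n" where
  "weak_gradient S f = (SOME G. has_weak_gradient S f G)"

definition in_Lq :: "real \<Rightarrow> (real^'n) set \<Rightarrow> (real^'n \<Rightarrow> 'b::euclidean_space) \<Rightarrow> bool" where
  "in_Lq q S f \<longleftrightarrow>
     set_borel_measurable lebesgue S f \<and> set_integrable lebesgue S (\<lambda>x. norm (f x) powr q)"

definition W12 :: "(real^'n) set \<Rightarrow> (real^'n \<Rightarrow> real) set" where
  "W12 S = {f. in_Lq 2 S f \<and> (\<exists>G. has_weak_gradient S f G \<and> in_Lq 2 S G)}"

definition norm_W12 :: "(real^'n) set \<Rightarrow> (real^'n \<Rightarrow> real) \<Rightarrow> real" where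
  "norm_W12 S f =
     sqrt ((LINT x:S|lebesgue. (f x)\<^sup>2) + (LINT x:S|lebesgue. (norm (weak_gradient S f x))\<^sup>2))"

text \<open>The closure of the test functions in \<open>W\<^sup>1\<^sup>,\<^sup>2(S)\<close>.\<close>

definition W12_0 :: "(real^'n) set \<Rightarrow> (real^'n \<Rightarrow> real) set" where
  "W12_0 S = {f \<in> W12 S. \<exists>\<phi>. (\<forall>k::nat. test_function S (\<phi> k)) \<and>
                (\<lambda>k. norm_W12 S (\<lambda>x. f x - \<phi> k x)) \<longlonglongrightarrow> 0}"

section \<open>Functionals and minimizers\<close>

definition admissible ::
    "(real^'n) set \<Rightarrow> (real^'n \<Rightarrow> real) \<Rightarrow> (real^'n \<Rightarrow> real) set" where
  "admissible S g = {v \<in> W12 S. (\<lambda>x. v x - g x) \<in> W12_0 S}"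

definition is_minimizer ::
    "(real^'n) set \<Rightarrow> (real^'n \<Rightarrow> real) \<Rightarrow> ((real^'n \<Rightarrow> real) \<Rightarrow> real) \<Rightarrow> (real^'n \<Rightarrow> real) \<Rightarrow> bool" where
  "is_minimizer S g F u \<longleftrightarrow> u \<in> admissible S g \<and> (\<forall>v \<in> admissible S g. F u \<le> F v)"

definition pos_set :: "(real^'n) set \<Rightarrow> (real^'n \<Rightarrow> real) \<Rightarrow> (real^'n) set" where
  "pos_set S u = {x \<in> S. u x > 0}"

definition dirichlet :: "(real^'n) set \<Rightarrow> (real^'n \<Rightarrow> real) \<Rightarrow> real" where
  "dirichlet S u = (LINT x:S|lebesgue. (norm (weak_gradient S u x))\<^sup>2)"

definition total_Q :: "(real^'n) set \<Rightarrow> (real^'n \<Rightarrow> real) \<Rightarrow> real" where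
  "total_Q \<Omega> Q = (LINT x:\<Omega>|lebesgue. Q x)"

definition M2 :: "real \<Rightarrow> (real^'n \<Rightarrow> real) \<Rightarrow> (real^'n) set \<Rightarrow> (real^'n \<Rightarrow> real) \<Rightarrow> real" where
  "M2 lam2 Q \<Omega> u = lam2 * (LINT x:\<Omega>|lebesgue. Q x * indicat_real (pos_set \<Omega> u) x)"

definition Phi0 :: "(real \<times> real \<Rightarrow> real) \<Rightarrow> real \<Rightarrow> real \<Rightarrow> (real^'n \<Rightarrow> real) \<Rightarrow> (real^'n) set
    \<Rightarrow> real \<Rightarrow> real" where
  "Phi0 \<Phi> lam1 lam2 Q \<Omega> r = \<Phi> (lam1 * (total_Q \<Omega> Q - inverse lam2 * r), r)"

definition J :: "(real \<times> real \<Rightarrow> real) \<Rightarrow> real \<Rightarrow> real \<Rightarrow> (real^'n \<Rightarrow> real) \<Rightarrow> (real^'n) set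
    \<Rightarrow> (real^'n \<Rightarrow> real) \<Rightarrow> real" where
  "J \<Phi> lam1 lam2 Q \<Omega> u = dirichlet \<Omega> u + Phi0 \<Phi> lam1 lam2 Q \<Omega> (M2 lam2 Q \<Omega> u)"

definition J0 :: "real \<Rightarrow> real \<Rightarrow> (real^'n \<Rightarrow> real) \<Rightarrow> real" where
  "J0 lam0 r w = dirichlet (ball 0 r) w + lam0 * measure lebesgue (pos_set (ball 0 r) w)"

section \<open>Blow-up limits\<close>

text \<open>The rescalings \<open>u\<^sub>k\<close> have domain \<open>\<Omega> / \<rho>\<^sub>k\<close>, which contains any given ball once \<open>\<rho>\<^sub>k\<close>
  is small.\<close>

definition scaled_domain :: "real \<Rightarrow> (real^'n) set \<Rightarrow> (real^'n) set" where
  "scaled_domain \<rho> \<Omega> = {x. \<rho> *\<^sub>R x \<in> \<Omega>}"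

definition rescale :: "real \<Rightarrow> (real^'n \<Rightarrow> real) \<Rightarrow> real^'n \<Rightarrow> real" where
  "rescale \<rho> u x = u (\<rho> *\<^sub>R x) / \<rho>"

definition holder_bound :: "real \<Rightarrow> (real^'n) set \<Rightarrow> real \<Rightarrow> (real^'n \<Rightarrow> real) \<Rightarrow> bool" where
  "holder_bound \<alpha> S C f \<longleftrightarrow>
     (\<forall>x\<in>S. \<bar>f x\<bar> \<le> C) \<and> (\<forall>x\<in>S. \<forall>y\<in>S. \<bar>f x - f y\<bar> \<le> C * dist x y powr \<alpha>)"

text \<open>Local convergence in \<open>C\<^sup>\<alpha>\<close>, \<open>0 < \<alpha> < 1\<close>: on each ball the limit has finite Hoelder norm and
  the Hoelder norm of the difference tends to \<open>0\<close>.\<close>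

definition conv_Calpha_loc ::
    "real \<Rightarrow> (nat \<Rightarrow> real^'n \<Rightarrow> real) \<Rightarrow> (real^'n \<Rightarrow> real) \<Rightarrow> bool" where
  "conv_Calpha_loc \<alpha> f g \<longleftrightarrow>
     (\<forall>R>0. (\<exists>C. holder_bound \<alpha> (cball 0 R) C g) \<and>
        (\<forall>\<epsilon>>0. \<forall>\<^sub>F k in sequentially. holder_bound \<alpha> (cball 0 R) \<epsilon> (\<lambda>x. f k x - g x)))"

definition weak_conv_Lq_loc ::
    "real \<Rightarrow> (nat \<Rightarrow> real^'n \<Rightarrow> real^'n) \<Rightarrow> (real^'n \<Rightarrow> real^'n) \<Rightarrow> bool" where
  "weak_conv_Lq_loc q F G \<longleftrightarrow>
     (\<forall>R>0. in_Lq q (ball 0 R) G \<and>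
        (\<forall>\<^sub>F k in sequentially. in_Lq q (ball 0 R) (F k)) \<and>
        (\<forall>h. in_Lq (q / (q - 1)) (ball 0 R) h \<longrightarrow>
           (\<lambda>k. LINT x:ball 0 R|lebesgue. F k x \<bullet> h x)
             \<longlonglongrightarrow> (LINT x:ball 0 R|lebesgue. G x \<bullet> h x)))"

text \<open>Nearness is expressed with witnesses rather than \<open>infdist\<close>, as the latter vanishes for an
  empty set.\<close>

definition hausdorff_conv_loc :: "(nat \<Rightarrow> (real^'n) set) \<Rightarrow> (real^'n) set \<Rightarrow> bool" where
  "hausdorff_conv_loc A B \<longleftrightarrow>
     (\<forall>R>0. \<forall>\<epsilon>>0. \<forall>\<^sub>F k in sequentially.
        (\<forall>x \<in> A k \<inter> cball 0 R. \<exists>y\<in>B. dist x y < \<epsilon>) \<and>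
        (\<forall>y \<in> B \<inter> cball 0 R. \<exists>x\<in>A k. dist x y < \<epsilon>))"

definition indicator_conv_L1_loc :: "(nat \<Rightarrow> (real^'n) set) \<Rightarrow> (real^'n) set \<Rightarrow> bool" where
  "indicator_conv_L1_loc A B \<longleftrightarrow>
     (\<forall>R>0. (\<lambda>k. LINT x:ball 0 R|lebesgue. \<bar>indicat_real (A k) x - indicat_real B x\<bar>) \<longlonglongrightarrow> 0)"

definition blowup_conv ::
    "(real^'n) set \<Rightarrow> (real^'n \<Rightarrow> real) \<Rightarrow> (nat \<Rightarrow> real) \<Rightarrow> (real^'n \<Rightarrow> real) \<Rightarrow> bool" where
  "blowup_conv \<Omega> u \<rho> u0 \<longleftrightarrow>
     (\<forall>\<alpha>. 0 < \<alpha> \<and> \<alpha> < 1 \<longrightarrow> conv_Calpha_loc \<alpha> (\<lambda>k. rescale (\<rho> k) u) u0) \<and>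
     (\<exists>G. has_weak_gradient UNIV u0 G) \<and>
     (\<forall>q>1. weak_conv_Lq_loc q
        (\<lambda>k. weak_gradient (scaled_domain (\<rho> k) \<Omega>) (rescale (\<rho> k) u)) (weak_gradient UNIV u0)) \<and>
     hausdorff_conv_loc
        (\<lambda>k. frontier (pos_set (scaled_domain (\<rho> k) \<Omega>) (rescale (\<rho> k) u)))
        (frontier (pos_set UNIV u0)) \<and>
     indicator_conv_L1_loc
        (\<lambda>k. pos_set (scaled_domain (\<rho> k) \<Omega>) (rescale (\<rho> k) u)) (pos_set UNIV u0)"

definition blowup_limit ::
    "(real^'n) set \<Rightarrow> (real^'n \<Rightarrow> real) \<Rightarrow> (real^'n \<Rightarrow> real) \<Rightarrow> bool" where
  "blowup_limit \<Omega> u u0 \<longleftrightarrow>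
     continuous_on UNIV u0 \<and> (\<exists>C. \<forall>x. \<bar>u0 x\<bar> \<le> C * (1 + norm x)) \<and>
     (\<exists>\<rho> s. (\<forall>k. \<rho> k > 0) \<and> \<rho> \<longlonglongrightarrow> 0 \<and> strict_mono (s :: nat \<Rightarrow> nat) \<and>
        blowup_conv \<Omega> u (\<rho> \<circ> s) u0)"

end

(* Only competitors u + psi with a test function psi are needed. For psi(x) = rho phi(x / rho), minimality of
   u, divided by rho^n, reads
     0 <= -2 int u_k laplacian(phi) + int |grad phi|^2 + rho^(-n) (Phi0(M2(u + psi)) - Phi0(M2(u))),
   because the mixed term int grad u . grad psi is moved onto u. Hence locally uniform convergence of u_k
   handles the energy, and differentiability of Phi0 at M2(u) together with continuity of Q at 0 turns the last
   term into lambda_0 times a difference of measures of positivity sets. This gives an inequality for u_0 and all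
   phi; an arbitrary competitor w is then reached by letting phi tend to w - u_0, shifted down slightly so that
   the positivity set does not grow.

   M2(u) has to lie in the open interval (0, lam2 total_Q). If M2(u) were maximal, u would be positive almost
   everywhere and, Phi0 being nondecreasing, weakly harmonic; the mean value property would make u(0) positive,
   contradicting that 0 is in the free boundary. *)
theory Submission
  imports Defs
begin

text \<open>The obstacle is the positivity set. Uniform convergence only gives that u_k + \<phi> > 0
  forces u0 + \<phi> > - \<delta>, and letting \<delta> tend to 0 would produce the set where u0 +
  \<phi> is nonnegative, whose zero level may have positive measure. So the limit inequality is kept
  one-sided with a fixed \<delta>, and the loss is repaired in the choice of \<phi>: a small
  multiple of a bump, bounded below on a slightly smaller ball, is subtracted and makes up for
  \<delta>. The positivity set of u_k itself enters with the opposite sign and needs its exact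
  limit, which the L^1 convergence of the indicators provides. A one-sided bound may be multiplied
  by the limiting slope of \<open>\<Phi>0\<close> because that slope is nonnegative. Perturbing by
  test functions keeps boundary values exactly, so no competitor has to be glued to u_k near the
  boundary of the ball. The mean value property comes from smooth radial kernels on shrinking balls
  rather than from integrals over spheres.\<close>

section \<open>Smooth functions\<close>

lemma Ck_on_lower: "Ck_on (Suc k) S f \<Longrightarrow> Ck_on k S f"
proof (induction k arbitrary: f)
  case 0
  then show ?case
    by (auto intro!: continuous_at_imp_continuous_on dest: differentiable_imp_continuous_within)
next
  case (Suc k)
  have "Ck_on k S (\<lambda>x. frechet_derivative f (at x) v)" for v
    using Suc.prems unfolding Ck_on.simps(2)[of "Suc k"] by (intro Suc.IH) blast
  moreover have "\<forall>x\<in>S. f differentiable (at x)"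
    using Suc.prems unfolding Ck_on.simps(2)[of "Suc k"] by blast
  ultimately show ?case unfolding Ck_on.simps(2) by blast
qed

lemma Ck_on_const: "Ck_on k UNIV (\<lambda>x. c)"
  by (induction k arbitrary: c) (auto simp: frechet_derivative_const)

lemma Ck_on_add:
  assumes "Ck_on k UNIV f" "Ck_on k UNIV g"
  shows "Ck_on k UNIV (\<lambda>x. f x + g x)"
  using assms
proof (induction k arbitrary: f g)
  case 0
  then show ?case by (auto intro: continuous_on_add)
next
  case (Suc k)
  have "frechet_derivative (\<lambda>x. f x + g x) (at x) v
      = frechet_derivative f (at x) v + frechet_derivative g (at x) v" for x v
  proof -
    have "((\<lambda>x. f x + g x) has_derivative (\<lambda>v. frechet_derivative f (at x) v
        + frechet_derivative g (at x) v)) (at x)"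
      by (intro has_derivative_add) (use Suc.prems in \<open>auto simp: frechet_derivative_works\<close>)
    from frechet_derivative_at[OF this] show ?thesis by metis
  qed
  then show ?case using Suc by simp
qed

lemma frechet_derivative_mult_apply:
  fixes f g :: "'a::real_normed_vector \<Rightarrow> real"
  assumes "f differentiable (at x)" "g differentiable (at x)"
  shows "frechet_derivative (\<lambda>x. f x * g x) (at x) v
      = f x * frechet_derivative g (at x) v + frechet_derivative f (at x) v * g x"
proof -
  have "((\<lambda>x. f x * g x) has_derivative (\<lambda>v. f x * frechet_derivative g (at x) v
      + frechet_derivative f (at x) v * g x)) (at x)"
    by (intro has_derivative_mult) (use assms in \<open>auto simp: frechet_derivative_works\<close>)
  from frechet_derivative_at[OF this] show ?thesis by metis
qed

lemma frechet_derivative_cmult: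
  fixes f :: "'a::real_normed_vector \<Rightarrow> real"
  assumes "f differentiable (at x)"
  shows "frechet_derivative (\<lambda>x. c * f x) (at x) v = c * frechet_derivative f (at x) v"
  using frechet_derivative_mult_apply[of "\<lambda>x. c" x f v] assms by simp

lemma Ck_on_mult:
  assumes "Ck_on k UNIV f" "Ck_on k UNIV g"
  shows "Ck_on k UNIV (\<lambda>x. f x * g x)"
  using assms
proof (induction k arbitrary: f g)
  case 0
  then show ?case by (auto intro: continuous_on_mult)
next
  case (Suc k)
  have "Ck_on k UNIV f" "Ck_on k UNIV g"
    using Suc.prems Ck_on_lower by blast+
  then have "Ck_on k UNIV (\<lambda>x. f x * frechet_derivative g (at x) v + frechet_derivative f (at x) v * g x)" for v
    using Suc.prems by (intro Ck_on_add Suc.IH) auto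
  moreover have "frechet_derivative (\<lambda>x. f x * g x) (at x) v
      = f x * frechet_derivative g (at x) v + frechet_derivative f (at x) v * g x" for x v
    using Suc.prems by (intro frechet_derivative_mult_apply) auto
  ultimately show ?case using Suc.prems by auto
qed

lemma Ck_on_cmult: "Ck_on k UNIV f \<Longrightarrow> Ck_on k UNIV (\<lambda>x. c * f x)"
  by (intro Ck_on_mult Ck_on_const)

lemma Ck_on_diff:
  assumes "Ck_on k UNIV f" "Ck_on k UNIV g"
  shows "Ck_on k UNIV (\<lambda>x. f x - g x)"
  using Ck_on_add[OF assms(1) Ck_on_cmult[OF assms(2), of "-1"]] by simp

lemma Ck_on_sum: "(\<And>i. i \<in> I \<Longrightarrow> Ck_on k UNIV (f i)) \<Longrightarrow> Ck_on k UNIV (\<lambda>x. \<Sum>i\<in>I. f i x)"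
  by (induction I rule: infinite_finite_induct) (simp_all add: Ck_on_const Ck_on_add)

lemma Ck_on_prod:
  assumes "finite I" "\<And>i. i \<in> I \<Longrightarrow> Ck_on k UNIV (f i)"
  shows "Ck_on k UNIV (\<lambda>x. \<Prod>i\<in>I. f i x)"
  using assms by (induction I rule: finite_induct) (auto intro: Ck_on_const Ck_on_mult)

lemma Ck_on_bounded_linear:
  assumes "bounded_linear f"
  shows "Ck_on k UNIV f"
proof (cases k)
  case 0
  then show ?thesis using assms by (simp add: linear_continuous_on)
next
  case (Suc m)
  have "frechet_derivative f (at x) = f" for x
    using frechet_derivative_at[OF bounded_linear_imp_has_derivative[OF assms]] by metis
  then show ?thesis
    using Suc by (auto simp: Ck_on_const intro: bounded_linear_imp_differentiable assms)
qed

lemma frechet_derivative_compose_real: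
  fixes h :: "real \<Rightarrow> real"
  assumes "f differentiable (at x)" "h differentiable (at (f x))"
  shows "frechet_derivative (\<lambda>x. h (f x)) (at x) v
      = frechet_derivative h (at (f x)) 1 * frechet_derivative f (at x) v"
proof -
  have "frechet_derivative (h \<circ> f) (at x) v = frechet_derivative h (at (f x)) (frechet_derivative f (at x) v)"
    using assms by (simp add: frechet_derivative_compose)
  also have "\<dots> = frechet_derivative f (at x) v * frechet_derivative h (at (f x)) 1"
    using linear_frechet_derivative[OF assms(2)]
    by (metis linear_scale mult.right_neutral real_scaleR_def)
  finally show ?thesis by (simp add: o_def mult.commute)
qed

text \<open>The chain rule turns h into its derivative composed with the same f, so the induction
  varies h and keeps f fixed.\<close>

lemma Ck_on_compose:
  fixes h :: "real \<Rightarrow> real"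
  assumes "Ck_on k UNIV f" "Ck_on k UNIV h"
  shows "Ck_on k UNIV (\<lambda>x. h (f x))"
  using assms
proof (induction k arbitrary: h)
  case 0
  then show ?case by (auto intro: continuous_on_compose2)
next
  case (Suc k)
  have f: "Ck_on k UNIV f"
    using Suc.prems Ck_on_lower by blast
  have "Ck_on k UNIV (\<lambda>x. frechet_derivative h (at (f x)) 1 * frechet_derivative f (at x) v)" for v
    using Suc.prems by (intro Ck_on_mult Suc.IH[OF f, of "\<lambda>t. frechet_derivative h (at t) 1"]) auto
  moreover have "frechet_derivative (\<lambda>x. h (f x)) (at x) v
      = frechet_derivative h (at (f x)) 1 * frechet_derivative f (at x) v" for x v
    using Suc.prems by (intro frechet_derivative_compose_real) auto
  moreover have "(\<lambda>x. h (f x)) differentiable (at x)" for x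
    using Suc.prems differentiable_chain_at[of f x h] by (auto simp: o_def)
  ultimately show ?case by auto
qed

lemma frechet_derivative_scale:
  fixes f :: "'a::real_normed_vector \<Rightarrow> real"
  assumes "f differentiable (at (a *\<^sub>R x))"
  shows "(\<lambda>x. f (a *\<^sub>R x)) differentiable (at x)"
    and "frechet_derivative (\<lambda>x. f (a *\<^sub>R x)) (at x) v = a * frechet_derivative f (at (a *\<^sub>R x)) v"
proof -
  have d: "(f has_derivative frechet_derivative f (at (a *\<^sub>R x))) (at (a *\<^sub>R x))"
    using assms frechet_derivative_works by blast
  have "((\<lambda>x. f (a *\<^sub>R x)) has_derivative (\<lambda>v. frechet_derivative f (at (a *\<^sub>R x)) (a *\<^sub>R v))) (at x)"
    by (rule has_derivative_compose[of "\<lambda>x. a *\<^sub>R x" "\<lambda>v. a *\<^sub>R v" x UNIV f, OF _ d]) (auto intro!: derivative_eq_intros)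
  then have *: "((\<lambda>x. f (a *\<^sub>R x)) has_derivative (\<lambda>v. a * frechet_derivative f (at (a *\<^sub>R x)) v)) (at x)"
    using linear_frechet_derivative[OF assms] by (simp add: linear_scale)
  then show "(\<lambda>x. f (a *\<^sub>R x)) differentiable (at x)"
    by (auto simp: differentiable_def)
  show "frechet_derivative (\<lambda>x. f (a *\<^sub>R x)) (at x) v = a * frechet_derivative f (at (a *\<^sub>R x)) v"
    using frechet_derivative_at[OF *] by metis
qed

lemma Ck_on_scale:
  assumes "Ck_on k UNIV f"
  shows "Ck_on k UNIV (\<lambda>x. f (a *\<^sub>R x))"
  using assms
proof (induction k arbitrary: f)
  case 0
  then show ?case by (auto intro!: continuous_on_compose2[of UNIV f] continuous_intros)
next
  case (Suc k)
  have "frechet_derivative (\<lambda>x. f (a *\<^sub>R x)) (at x) v = a * frechet_derivative f (at (a *\<^sub>R x)) v" for x v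
    using Suc.prems by (intro frechet_derivative_scale) auto
  moreover have "Ck_on k UNIV (\<lambda>x. a * frechet_derivative f (at (a *\<^sub>R x)) v)" for v
    using Suc.IH[of "\<lambda>x. frechet_derivative f (at x) v"] Suc.prems by (intro Ck_on_cmult) auto
  ultimately show ?case using Suc.prems by (auto intro: frechet_derivative_scale(1))
qed

text \<open>The functions p(1/s) exp(-1/s), extended by 0 to s \<le> 0, form a class closed under
  differentiation; with the polynomial as a parameter, smoothness is a plain induction. The case p =
  1 is the classical flat function.\<close>

definition exp_bump :: "real poly \<Rightarrow> real \<Rightarrow> real" where
  "exp_bump p s = (if s > 0 then poly p (1 / s) * exp (- 1 / s) else 0)"

lemma poly_mult_exp_tendsto_0:
  fixes p :: "real poly"
  shows "((\<lambda>t. poly p t * exp (- t)) \<longlongrightarrow> 0) at_top"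
proof -
  have "((\<lambda>t. (\<Sum>i\<le>degree p. coeff p i * (t ^ i / exp t))) \<longlongrightarrow> (\<Sum>i\<le>degree p. coeff p i * 0)) at_top"
    by (intro tendsto_intros tendsto_power_div_exp_0)
  moreover have "(\<lambda>t. (\<Sum>i\<le>degree p. coeff p i * (t ^ i / exp t))) = (\<lambda>t. poly p t * exp (- t))"
    by (simp add: poly_altdef sum_distrib_right exp_minus divide_inverse mult.assoc)
  ultimately show ?thesis by simp
qed

lemma exp_bump_tendsto_0: "(exp_bump p \<longlongrightarrow> 0) (at 0)"
proof -
  have "((\<lambda>s. poly p (inverse s) * exp (- (inverse s))) \<longlongrightarrow> 0) (at_right (0::real))"
    by (rule filterlim_compose[OF poly_mult_exp_tendsto_0 filterlim_inverse_at_top_right])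
  then have "(exp_bump p \<longlongrightarrow> 0) (at_right 0)"
    by (rule Lim_transform_eventually)
      (auto simp: eventually_at_filter exp_bump_def divide_inverse)
  moreover have "(exp_bump p \<longlongrightarrow> 0) (at_left 0)"
    by (rule Lim_transform_eventually[OF tendsto_const])
      (auto simp: eventually_at_filter exp_bump_def)
  ultimately show ?thesis by (simp add: filterlim_split_at)
qed

text \<open>In the variable t = 1/s one has d/ds = - t^2 d/dt, and p(t) exp(-t) has t-derivative (p'
  - p)(t) exp(-t); the factor \<open>[:0, 0, 1:]\<close> is t^2.\<close>

definition exp_bump_deriv :: "real poly \<Rightarrow> real poly" where
  "exp_bump_deriv p = [:0, 0, 1:] * (p - pderiv p)"

lemma has_field_derivative_exp_bump:
  "(exp_bump p has_field_derivative exp_bump (exp_bump_deriv p) s) (at s)"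
proof -
  consider "s > 0" | "s < 0" | "s = 0" by linarith
  then show ?thesis
  proof cases
    case 1
    have "((\<lambda>s. poly p (1 / s) * exp (- 1 / s)) has_field_derivative exp_bump (exp_bump_deriv p) s) (at s)"
      using 1 by (auto intro!: derivative_eq_intros simp: exp_bump_def exp_bump_deriv_def field_simps power2_eq_square)
    then show ?thesis
      by (rule has_field_derivative_transform_within_open[where S = "{0<..}"]) (use 1 in \<open>auto simp: exp_bump_def\<close>)
  next
    case 2
    have "((\<lambda>s. 0) has_field_derivative exp_bump (exp_bump_deriv p) s) (at s)"
      using 2 by (simp add: exp_bump_def)
    then show ?thesis
      by (rule has_field_derivative_transform_within_open[where S = "{..<0}"]) (use 2 in \<open>auto simp: exp_bump_def\<close>)
  next
    case 3
    \<comment> \<open>The difference quotient at 0 stays in the class: dividing by h multiplies the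
      polynomial by t. At h = 0 both sides are 0, the left one by the convention x / 0 = 0.\<close>
    have "(\<lambda>h. (exp_bump p (0 + h) - exp_bump p 0) / h) = exp_bump (pCons 0 p)"
      by (auto simp: exp_bump_def fun_eq_iff)
    then show ?thesis
      using exp_bump_tendsto_0[of "pCons 0 p"] 3 by (simp add: DERIV_def exp_bump_def[of _ 0])
  qed
qed

lemma frechet_derivative_exp_bump:
  "frechet_derivative (exp_bump p) (at s) v = v * exp_bump (exp_bump_deriv p) s"
  using frechet_derivative_at[OF has_field_derivative_imp_has_derivative[OF has_field_derivative_exp_bump]]
  by (metis mult.commute)

lemma Ck_on_exp_bump: "Ck_on k UNIV (exp_bump p)"
proof (induction k arbitrary: p)
  case 0
  then show ?case
    using has_field_derivative_exp_bump by (auto intro!: DERIV_continuous_on)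
next
  case (Suc k)
  have "exp_bump p differentiable (at x)" for x
    using has_field_derivative_exp_bump real_differentiable_def by blast
  then show ?case
    using Suc by (auto simp: frechet_derivative_exp_bump intro: Ck_on_cmult)
qed

lemma continuous_on_exp_bump: "continuous_on UNIV (exp_bump p)"
  using Ck_on_exp_bump[of 0 p] by simp

lemma exp_bump_1: "exp_bump 1 s = (if s > 0 then exp (- 1 / s) else 0)"
  by (simp add: exp_bump_def)

lemma exp_bump_1_bounds: "0 \<le> exp_bump 1 s" "exp_bump 1 s \<le> 1"
  by (auto simp: exp_bump_1)

section \<open>Compactly supported smooth functions: closure properties, integration by parts,
  dilation of integrals\<close>

section \<open>Test functions\<close>

lemma frechet_derivative_eq_0_outside_support:
  assumes "x \<notin> closure {x. \<phi> x \<noteq> (0::real)}"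
  shows "frechet_derivative \<phi> (at x) v = 0"
proof -
  have "((\<lambda>x. 0::real) has_derivative (\<lambda>v. 0)) (at x)" by simp
  then have "(\<phi> has_derivative (\<lambda>v. 0)) (at x)"
    by (rule has_derivative_transform_within_open[OF _ open_Compl[OF closed_closure, of "{x. \<phi> x \<noteq> 0}"]])
      (use assms closure_subset[of "{x. \<phi> x \<noteq> 0}"] in auto)
  then show ?thesis using frechet_derivative_at by metis
qed

lemma test_functionI:
  assumes "\<And>k. Ck_on k UNIV \<phi>" "compact K" "K \<subseteq> S" "\<And>x. x \<notin> K \<Longrightarrow> \<phi> x = 0"
  shows "test_function S \<phi>"
proof -
  have "closure {x. \<phi> x \<noteq> 0} \<subseteq> K"
    using assms by (intro closure_minimal) (auto simp: compact_imp_closed)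
  moreover from this have "compact (closure {x. \<phi> x \<noteq> 0})"
    using compact_Int_closed[OF assms(2) closed_closure, of "{x. \<phi> x \<noteq> 0}"] by (simp add: Int_absorb1)
  ultimately show ?thesis
    using assms by (auto simp: test_function_def)
qed

lemma test_functionE:
  assumes "test_function S \<phi>"
  obtains K where "compact K" "K \<subseteq> S" "\<And>x. x \<notin> K \<Longrightarrow> \<phi> x = 0"
    "\<And>x v. x \<notin> K \<Longrightarrow> frechet_derivative \<phi> (at x) v = 0"
proof
  let ?K = "closure {x. \<phi> x \<noteq> 0}"
  show "compact ?K" "?K \<subseteq> S" using assms by (auto simp: test_function_def)
  show "\<phi> x = 0" if "x \<notin> ?K" for x using that closure_subset[of "{x. \<phi> x \<noteq> 0}"] by auto
  show "frechet_derivative \<phi> (at x) v = 0" if "x \<notin> ?K" for x v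
    by (rule frechet_derivative_eq_0_outside_support[OF that])
qed

lemma test_function_Ck: "test_function S \<phi> \<Longrightarrow> Ck_on k UNIV \<phi>"
  by (auto simp: test_function_def)

lemma test_function_differentiable: "test_function S \<phi> \<Longrightarrow> \<phi> differentiable (at x)"
  using test_function_Ck[of S \<phi> 1] by auto

lemma test_function_continuous: "test_function S \<phi> \<Longrightarrow> continuous_on UNIV \<phi>"
  using test_function_Ck[of S \<phi> 0] by auto

lemma test_function_deriv:
  assumes "test_function S \<phi>"
  shows "test_function S (\<lambda>x. frechet_derivative \<phi> (at x) v)"
proof -
  obtain K where "compact K" "K \<subseteq> S" "\<And>x v. x \<notin> K \<Longrightarrow> frechet_derivative \<phi> (at x) v = 0"
    by (rule test_functionE[OF assms]) (rule that)
  moreover have "Ck_on k UNIV (\<lambda>x. frechet_derivative \<phi> (at x) v)" for k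
    using test_function_Ck[OF assms, of "Suc k"] by simp
  ultimately show ?thesis by (intro test_functionI) auto
qed

lemma test_function_mono: "test_function S \<phi> \<Longrightarrow> S \<subseteq> T \<Longrightarrow> test_function T \<phi>"
  by (auto simp: test_function_def)

lemma test_function_zero: "test_function S (\<lambda>x. 0)"
  by (rule test_functionI[of _ "{}"]) (auto intro: Ck_on_const)

lemma test_function_add:
  assumes "test_function S \<phi>" "test_function S \<psi>"
  shows "test_function S (\<lambda>x. \<phi> x + \<psi> x)"
proof -
  obtain K where "compact K" "K \<subseteq> S" "\<And>x. x \<notin> K \<Longrightarrow> \<phi> x = 0" by (rule test_functionE[OF assms(1)]) (rule that)
  moreover obtain L where "compact L" "L \<subseteq> S" "\<And>x. x \<notin> L \<Longrightarrow> \<psi> x = 0" by (rule test_functionE[OF assms(2)]) (rule that)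
  ultimately show ?thesis
    using assms by (intro test_functionI[of _ "K \<union> L"]) (auto intro: Ck_on_add test_function_Ck)
qed

lemma test_function_smooth_mult:
  assumes "test_function S \<phi>" "\<And>k. Ck_on k UNIV f"
  shows "test_function S (\<lambda>x. f x * \<phi> x)"
proof -
  obtain K where "compact K" "K \<subseteq> S" "\<And>x. x \<notin> K \<Longrightarrow> \<phi> x = 0" by (rule test_functionE[OF assms(1)]) (rule that)
  then show ?thesis
    using assms by (intro test_functionI[of _ K]) (auto intro: Ck_on_mult test_function_Ck)
qed

lemma test_function_cmult: "test_function S \<phi> \<Longrightarrow> test_function S (\<lambda>x. c * \<phi> x)"
  by (rule test_function_smooth_mult[OF _ Ck_on_const])

lemma test_function_mult:
  assumes "test_function S \<phi>" "test_function T \<psi>"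
  shows "test_function S (\<lambda>x. \<phi> x * \<psi> x)"
proof -
  have "test_function S (\<lambda>x. \<psi> x * \<phi> x)"
    using assms by (intro test_function_smooth_mult test_function_Ck)
  then show ?thesis by (simp add: mult.commute)
qed

lemma test_function_sum:
  "(\<And>i. i \<in> I \<Longrightarrow> test_function S (\<phi> i)) \<Longrightarrow> test_function S (\<lambda>x. \<Sum>i\<in>I. \<phi> i x)"
  by (induction I rule: infinite_finite_induct) (simp_all add: test_function_add test_function_zero)

lemma test_function_bounded:
  assumes "test_function S \<phi>"
  obtains B where "\<And>x. \<bar>\<phi> x\<bar> \<le> B"
proof -
  obtain K where K: "compact K" "\<And>x. x \<notin> K \<Longrightarrow> \<phi> x = 0" by (rule test_functionE[OF assms]) (rule that)
  have "compact (\<phi> ` K)"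
    using K test_function_continuous[OF assms] by (intro compact_continuous_image) (auto intro: continuous_on_subset)
  then obtain B where B: "\<And>x. x \<in> K \<Longrightarrow> \<bar>\<phi> x\<bar> \<le> B"
    by (meson bounded_real compact_imp_bounded imageI)
  then have "\<bar>\<phi> x\<bar> \<le> max B 0" for x
    using K(2)[of x] by (cases "x \<in> K") (auto simp: le_max_iff_disj)
  then show ?thesis using that by blast
qed

lemma test_function_measurable:
  assumes "test_function S \<phi>"
  shows "\<phi> \<in> borel_measurable borel" "\<phi> \<in> borel_measurable lebesgue"
proof -
  show "\<phi> \<in> borel_measurable borel"
    using test_function_continuous[OF assms] by (rule borel_measurable_continuous_onI)
  then show "\<phi> \<in> borel_measurable lebesgue"
    by (intro measurable_completion) simp
qed

lemma integrable_mult_test: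
  fixes f :: "real^'n \<Rightarrow> real"
  assumes "\<And>K. compact K \<Longrightarrow> K \<subseteq> S \<Longrightarrow> f absolutely_integrable_on K" "test_function S \<phi>"
  shows "integrable lebesgue (\<lambda>x. f x * \<phi> x)"
proof -
  obtain K where K: "compact K" "K \<subseteq> S" "\<And>x. x \<notin> K \<Longrightarrow> \<phi> x = 0" by (rule test_functionE[OF assms(2)]) (rule that)
  obtain B where B: "\<And>x. \<bar>\<phi> x\<bar> \<le> B" using test_function_bounded[OF assms(2)] by blast
  have i: "integrable lebesgue (\<lambda>x. indicator K x *\<^sub>R f x)"
    using assms(1)[OF K(1,2)] by (simp add: set_integrable_def)
  have eq: "(\<lambda>x. f x * \<phi> x) = (\<lambda>x. (indicator K x *\<^sub>R f x) * \<phi> x)"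
    using K by (auto simp: fun_eq_iff indicator_def)
  show ?thesis unfolding eq
  proof (rule Bochner_Integration.integrable_bound)
    show "integrable lebesgue (\<lambda>x. B * (indicator K x *\<^sub>R f x))" using i by simp
    show "(\<lambda>x. indicator K x *\<^sub>R f x * \<phi> x) \<in> borel_measurable lebesgue"
      using i test_function_measurable[OF assms(2)] by (intro borel_measurable_times) auto
    show "AE x in lebesgue. norm (indicator K x *\<^sub>R f x * \<phi> x) \<le> norm (B * (indicator K x *\<^sub>R f x))"
    proof (intro AE_I2)
      fix x
      have "\<bar>\<phi> x\<bar> \<le> \<bar>B\<bar>" using B[of x] by linarith
      from mult_right_mono[OF this, of "\<bar>indicator K x *\<^sub>R f x\<bar>"]
      show "norm (indicator K x *\<^sub>R f x * \<phi> x) \<le> norm (B * (indicator K x *\<^sub>R f x))"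
        by (simp add: abs_mult mult.commute mult.left_commute)
    qed
  qed
qed

lemma set_integral_mult_test:
  assumes "test_function S \<phi>"
  shows "(LINT x:S|lebesgue. f x * \<phi> x) = (LINT x|lebesgue. f x * \<phi> x)"
proof -
  obtain K where "K \<subseteq> S" "\<And>x. x \<notin> K \<Longrightarrow> \<phi> x = 0" by (rule test_functionE[OF assms]) (rule that)
  then have "indicator S x *\<^sub>R (f x * \<phi> x) = f x * \<phi> x" for x
    by (auto simp: indicator_def)
  then show ?thesis unfolding set_lebesgue_integral_def by (intro Bochner_Integration.integral_cong refl)
qed

lemma integrable_test:
  assumes "test_function S \<phi>"
  shows "integrable lebesgue \<phi>"
proof -
  have "(\<lambda>x. 1::real) absolutely_integrable_on K" if "compact K" for K :: "(real^'n) set"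
    using that by (intro absolutely_integrable_on_const lmeasurable_compact)
  from integrable_mult_test[OF this assms] show ?thesis by simp
qed

text \<open>Translation invariance gives every difference quotient of \<phi> integral 0. By the mean
  value theorem the quotients with steps at most 1 are bounded by a bound of the derivative and
  vanish outside a fixed ball, so dominated convergence carries this over to the derivative.\<close>

lemma integral_deriv_test_eq_0:
  assumes \<phi>: "test_function S \<phi>"
  shows "(LINT x|lebesgue. frechet_derivative \<phi> (at x) v) = 0"
proof -
  let ?d = "\<lambda>x. frechet_derivative \<phi> (at x) v"
  define h where "h n = inverse (real (Suc n))" for n
  have h: "0 < h n" "h n \<le> 1" for n by (auto simp: h_def field_simps)
  have D: "((\<lambda>t. \<phi> (x + t *\<^sub>R v)) has_real_derivative ?d (x + t *\<^sub>R v)) (at t)" for x t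
  proof -
    have d: "(\<phi> has_derivative frechet_derivative \<phi> (at (x + t *\<^sub>R v))) (at (x + t *\<^sub>R v))"
      using test_function_differentiable[OF \<phi>] frechet_derivative_works by blast
    have "((\<lambda>t. \<phi> (x + t *\<^sub>R v)) has_derivative (\<lambda>s. frechet_derivative \<phi> (at (x + t *\<^sub>R v)) (s *\<^sub>R v))) (at t)"
      by (rule has_derivative_compose[of "\<lambda>t. x + t *\<^sub>R v" "\<lambda>s. s *\<^sub>R v" t UNIV \<phi>, OF _ d])
        (auto intro!: derivative_eq_intros)
    then show ?thesis
      using linear_frechet_derivative[OF test_function_differentiable[OF \<phi>]]
      by (auto simp: has_field_derivative_def linear_scale mult.commute[of _ "frechet_derivative \<phi> (at _) v"])
  qed
  obtain B where B: "\<And>x. \<bar>?d x\<bar> \<le> B" using test_function_bounded[OF test_function_deriv[OF \<phi>]] by blast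
  obtain K where K: "compact K" "\<And>x. x \<notin> K \<Longrightarrow> ?d x = 0"
    by (rule test_functionE[OF \<phi>]) (rule that)
  obtain R where R: "\<And>x. x \<in> K \<Longrightarrow> norm x \<le> R"
    using compact_imp_bounded[OF K(1)] bounded_iff by blast
  define s where "s n x = (\<phi> (x + h n *\<^sub>R v) - \<phi> x) / h n" for n x
  have phib[measurable]: "\<phi> \<in> borel_measurable borel" using test_function_measurable[OF \<phi>] by blast
  have smeas[measurable]: "s n \<in> borel_measurable borel" for n
    unfolding s_def by measurable
  have dmeas: "?d \<in> borel_measurable borel"
    using test_function_measurable[OF test_function_deriv[OF \<phi>]] by blast
  have bound: "\<bar>s n x\<bar> \<le> B * indicator (cball 0 (R + norm v)) x" for n x
  proof -
    obtain t where t: "0 < t" "t < h n" "\<phi> (x + h n *\<^sub>R v) - \<phi> (x + 0 *\<^sub>R v) = (h n - 0) * ?d (x + t *\<^sub>R v)"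
      using MVT2[OF h(1)[of n], of "\<lambda>t. \<phi> (x + t *\<^sub>R v)" "\<lambda>t. ?d (x + t *\<^sub>R v)"] D by blast
    then have s: "s n x = ?d (x + t *\<^sub>R v)" using h(1)[of n] by (simp add: s_def)
    show ?thesis
    proof (cases "x \<in> cball 0 (R + norm v)")
      case True
      then show ?thesis using B s by simp
    next
      case False
      have "x + t *\<^sub>R v \<notin> K"
      proof
        assume "x + t *\<^sub>R v \<in> K"
        then have "norm (x + t *\<^sub>R v) \<le> R" by (rule R)
        moreover have "norm x \<le> norm (x + t *\<^sub>R v) + norm (t *\<^sub>R v)"
          by (metis add_diff_cancel_right' norm_triangle_ineq4)
        moreover have "norm (t *\<^sub>R v) \<le> norm v"
          using t h(2)[of n] by (simp add: mult_left_le_one_le)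
        ultimately show False using False by simp
      qed
      then show ?thesis using K s False by simp
    qed
  qed
  have lim: "(\<lambda>n. s n x) \<longlonglongrightarrow> ?d x" for x
  proof -
    have "((\<lambda>t. (\<phi> (x + t *\<^sub>R v) - \<phi> x) / t) \<longlongrightarrow> ?d x) (at 0)"
      using D[of x 0] by (simp add: DERIV_def)
    moreover have "filterlim h (at 0) sequentially"
      unfolding filterlim_at using h(1) LIMSEQ_inverse_real_of_nat
      by (auto simp: h_def[abs_def])
    ultimately show ?thesis
      unfolding s_def by (rule filterlim_compose)
  qed
  have "(\<lambda>n. integral\<^sup>L lborel (s n)) \<longlonglongrightarrow> integral\<^sup>L lborel ?d"
  proof (rule integral_dominated_convergence[where w = "\<lambda>x. B * indicator (cball (0::real^'n) (R + norm v)) x"])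
    show "integrable lborel (\<lambda>x. B * indicator (cball (0::real^'n) (R + norm v)) x :: real)"
      using emeasure_compact_finite[OF compact_cball[of "0::real^'n" "R + norm v"]]
      by (intro integrable_mult_right integrable_real_indicator) auto
  qed (use bound lim dmeas smeas in auto)
  moreover have "integral\<^sup>L lborel (s n) = 0" for n
  proof -
    have phi_int: "integrable lborel \<phi>"
      using integrable_test[OF \<phi>] integrable_completion[of \<phi> lborel] by simp
    have "integral\<^sup>L lborel (\<lambda>x. \<phi> (h n *\<^sub>R v + x)) = integral\<^sup>L (distr lborel borel ((+) (h n *\<^sub>R v))) \<phi>"
      by (subst integral_distr) auto
    also have "\<dots> = integral\<^sup>L lborel \<phi>" by (simp add: lborel_distr_plus)
    finally have e: "integral\<^sup>L lborel (\<lambda>x. \<phi> (x + h n *\<^sub>R v)) = integral\<^sup>L lborel \<phi>" by (simp add: add.commute)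
    have "integrable (distr lborel borel ((+) (h n *\<^sub>R v))) \<phi>"
      using phi_int by (simp add: lborel_distr_plus)
    then have "integrable lborel (\<lambda>x. \<phi> (x + h n *\<^sub>R v))"
      by (subst (asm) integrable_distr_eq) (auto simp: add.commute)
    then show ?thesis using e phi_int by (simp add: s_def[abs_def])
  qed
  ultimately have "integral\<^sup>L lborel ?d = 0" by (simp add: LIMSEQ_const_iff)
  then show ?thesis using integral_completion[of ?d lborel] dmeas by simp
qed

lemma integral_by_parts_test:
  assumes "test_function S \<phi>" "test_function T \<psi>"
  shows "(LINT x|lebesgue. \<phi> x * frechet_derivative \<psi> (at x) v)
       = - (LINT x|lebesgue. frechet_derivative \<phi> (at x) v * \<psi> x)"
proof -
  have "integrable lebesgue (\<lambda>x. \<phi> x * frechet_derivative \<psi> (at x) v)"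
    using assms by (intro integrable_test test_function_mult test_function_deriv)
  moreover have "integrable lebesgue (\<lambda>x. frechet_derivative \<phi> (at x) v * \<psi> x)"
    using assms by (intro integrable_test test_function_mult test_function_deriv)
  moreover have "(LINT x|lebesgue. frechet_derivative (\<lambda>x. \<phi> x * \<psi> x) (at x) v) = 0"
    using assms by (intro integral_deriv_test_eq_0 test_function_mult)
  moreover have "frechet_derivative (\<lambda>x. \<phi> x * \<psi> x) (at x) v
      = \<phi> x * frechet_derivative \<psi> (at x) v + frechet_derivative \<phi> (at x) v * \<psi> x" for x
    using assms by (intro frechet_derivative_mult_apply test_function_differentiable)
  ultimately show ?thesis by simp
qed

text \<open>The Jacobian of the dilation is \<rho>^n. Measurability is enough: if f is not
  integrable, neither is its dilate, and both integrals are 0 by convention.\<close>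

lemma integral_scale_lebesgue:
  fixes f :: "real^'n \<Rightarrow> real"
  assumes "f \<in> borel_measurable lebesgue" "\<rho> > 0"
  shows "(LINT x|lebesgue. f (\<rho> *\<^sub>R x)) = (LINT x|lebesgue. f x) / \<rho> ^ CARD('n)"
proof -
  have T: "(\<lambda>x. (0::real^'n) + (\<Sum>j\<in>Basis. (\<rho> * (x \<bullet> j)) *\<^sub>R j)) = (*\<^sub>R) \<rho>"
    unfolding scaleR_scaleR[symmetric] scaleR_sum_right[symmetric] euclidean_representation by auto
  have "(lebesgue :: (real^'n) measure) = density (distr lebesgue lebesgue ((*\<^sub>R) \<rho>)) (\<lambda>_. ennreal (\<rho> ^ CARD('n)))"
    using lebesgue_affine_euclidean[of "\<lambda>_. \<rho>" "0::real^'n"] assms(2) unfolding T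
    by (simp add: ennreal_power)
  then have "(LINT x|lebesgue. f x) = (LINT x|density (distr lebesgue lebesgue ((*\<^sub>R) \<rho>)) (\<lambda>_. ennreal (\<rho> ^ CARD('n))). f x)"
    by (rule arg_cong)
  also have "\<dots> = (LINT x|distr lebesgue lebesgue ((*\<^sub>R) \<rho>). \<rho> ^ CARD('n) *\<^sub>R f x)"
    using assms by (intro integral_density) auto
  also have "\<dots> = (LINT x|lebesgue. \<rho> ^ CARD('n) *\<^sub>R f (\<rho> *\<^sub>R x))"
    using assms by (intro integral_distr) auto
  finally show ?thesis using assms(2) by simp
qed

section \<open>The fundamental lemma of the calculus of variations\<close>

section \<open>Uniqueness of weak gradients\<close>

text \<open>Completeness of Lebesgue measure. It allows a function to be replaced by another
  representative, in particular a weak gradient by the one chosen in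
  \<open>weak_gradient\<close>.\<close>

lemma borel_measurable_lebesgue_AE:
  fixes f g :: "'a::euclidean_space \<Rightarrow> 'b::topological_space"
  assumes f: "f \<in> borel_measurable lebesgue" and ae: "AE x in lebesgue. f x = g x"
  shows "g \<in> borel_measurable lebesgue"
proof (rule measurableI)
  fix A :: "'b set" assume A: "A \<in> sets borel"
  show "g -` A \<inter> space lebesgue \<in> sets lebesgue"
  proof (rule completion.in_sets_AE)
    show "AE x in lebesgue. (x \<in> f -` A \<inter> space lebesgue) \<longleftrightarrow> (x \<in> g -` A \<inter> space lebesgue)"
      using ae by (auto elim!: eventually_mono)
  qed (use measurable_sets[OF f A] in auto)
qed simp

text \<open>Dynkin's argument: open boxes are stable under intersection and generate the Borel sets,
  and the sets over which h has integral 0 are closed under disjoint countable unions and, thanks to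
  the vanishing total integral, under complements. So h and 0 have the same integral over every
  Borel set.\<close>

lemma AE_eq_0_if_box_integrals_0:
  fixes h :: "'a::euclidean_space \<Rightarrow> real"
  assumes h: "integrable lborel h" and total: "(LINT x|lborel. h x) = 0"
    and box: "\<And>a b. (LINT x:box a b|lborel. h x) = 0"
  shows "AE x in lborel. h x = 0"
proof -
  have si: "set_integrable lborel A h" if "A \<in> sets borel" for A
    using h that unfolding set_integrable_def by (intro integrable_mult_indicator) auto
  have sets: "sets (borel :: 'a measure) = sigma_sets UNIV (range (\<lambda>(a, b). box a b))"
    by (simp add: borel_eq_box)
  have zero: "(LINT x:A|lborel. h x) = 0" if "A \<in> sigma_sets UNIV (range (\<lambda>(a, b). box a b :: 'a set))" for A
  proof (rule sigma_sets_induct_disjoint[OF _ _ that])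
    show "Int_stable (range (\<lambda>(a, b). box a b :: 'a set))"
      by (auto simp: Int_stable_def box_Int_box)
    show "(LINT x:A|lborel. h x) = 0" if "A \<in> range (\<lambda>(a, b). box a b)" for A
      using that box by auto
    show "(LINT x:{}|lborel. h x) = 0" by (simp add: set_lebesgue_integral_def)
    show "(LINT x:UNIV - A|lborel. h x) = 0"
      if "A \<in> sigma_sets UNIV (range (\<lambda>(a, b). box a b))" "(LINT x:A|lborel. h x) = 0" for A
    proof -
      have A: "A \<in> sets borel" using that sets by simp
      have "(LINT x:A \<union> (UNIV - A)|lborel. h x) = (LINT x:A|lborel. h x) + (LINT x:UNIV - A|lborel. h x)"
        using A by (intro set_integral_Un si) auto
      moreover have "(LINT x:A \<union> (UNIV - A)|lborel. h x) = 0"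
        using total by (simp add: set_lebesgue_integral_def)
      ultimately show ?thesis using that by simp
    qed
    show "(LINT x:(\<Union>i. A i)|lborel. h x) = 0"
      if "disjoint_family A" "range A \<subseteq> sigma_sets UNIV (range (\<lambda>(a, b). box a b))"
        "\<And>i. (LINT x:A i|lborel. h x) = 0" for A :: "nat \<Rightarrow> 'a set"
    proof -
      have A: "A i \<in> sets borel" for i using that(2) sets by auto
      have "(LINT x:(\<Union>i. A i)|lborel. h x) = (\<Sum>i. (LINT x:(A i)|lborel. h x))"
        using that(1) A by (intro lebesgue_integral_countable_add si) (auto simp: disjoint_family_on_def)
      then show ?thesis using that(3) by simp
    qed
  qed auto
  show ?thesis
  proof (rule density_unique_real[OF h, of "\<lambda>x. 0"])
    show "(LINT x:A|lborel. h x) = (LINT x:A|lborel. 0)" if "A \<in> sets lborel" for A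
      using zero[of A] that sets by (simp add: set_lebesgue_integral_def)
  qed simp
qed

text \<open>A smooth approximation of the indicator of the open box: a factor is exp(-1/(m t)), with
  t the signed distance to a face, and tends to 1 as m grows when t > 0, while it is 0 when t \<le>
  0.\<close>

definition box_bump :: "real^'n \<Rightarrow> real^'n \<Rightarrow> nat \<Rightarrow> real^'n \<Rightarrow> real" where
  "box_bump a b m x = (\<Prod>i\<in>UNIV. exp_bump 1 (real m * (x $ i - a $ i)) * exp_bump 1 (real m * (b $ i - x $ i)))"

lemma box_bump_bounds: "0 \<le> box_bump a b m x" "box_bump a b m x \<le> 1"
  by (auto simp: box_bump_def exp_bump_1_bounds intro!: prod_nonneg prod_le_1 mult_le_one)

lemma box_bump_eq_0:
  assumes "x \<notin> box a b"
  shows "box_bump a b m x = 0"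
proof -
  obtain i where i: "x $ i \<le> a $ i \<or> b $ i \<le> x $ i"
    using assms by (auto simp: mem_box_cart not_less)
  then have "exp_bump 1 (real m * (x $ i - a $ i)) * exp_bump 1 (real m * (b $ i - x $ i)) = 0"
    by (auto simp: exp_bump_1 zero_less_mult_iff)
  then show ?thesis unfolding box_bump_def by (intro prod_zero) auto
qed

lemma test_function_box_bump:
  assumes "cbox a b \<subseteq> S"
  shows "test_function S (box_bump a b m)"
proof (rule test_functionI[OF _ compact_cbox assms])
  show "Ck_on k UNIV (box_bump a b m)" for k
  proof -
    have "Ck_on k UNIV (\<lambda>x::real^'n. real m * (x $ i - c))" "Ck_on k UNIV (\<lambda>x::real^'n. real m * (c - x $ i))" for i c
      by (intro Ck_on_cmult Ck_on_diff Ck_on_const Ck_on_bounded_linear bounded_linear_vec_nth)+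
    from this[THEN Ck_on_compose, OF Ck_on_exp_bump[of k 1]]
    have "Ck_on k UNIV (\<lambda>x. exp_bump 1 (real m * (x $ i - a $ i)) * exp_bump 1 (real m * (b $ i - x $ i)))" for i
      by (intro Ck_on_mult) auto
    then show ?thesis unfolding box_bump_def[abs_def]
      by (intro Ck_on_prod) auto
  qed
  show "box_bump a b m x = 0" if "x \<notin> cbox a b" for x
    using that box_subset_cbox[of a b] by (intro box_bump_eq_0) auto
qed

lemma box_bump_tendsto:
  fixes x :: "real^'n"
  shows "(\<lambda>m. box_bump a b m x) \<longlonglongrightarrow> indicat_real (box a b) x"
proof (cases "x \<in> box a b")
  case True
  have *: "(\<lambda>m. exp_bump 1 (real m * t)) \<longlonglongrightarrow> 1" if "t > 0" for t :: real
  proof -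
    have "(\<lambda>m. exp (- inverse (real m) / t)) \<longlonglongrightarrow> exp (- 0 / t)"
      by (intro tendsto_intros lim_inverse_n) (use that in auto)
    then have "(\<lambda>m. exp (- inverse (real m) / t)) \<longlonglongrightarrow> 1" by simp
    moreover have "eventually (\<lambda>m. exp (- inverse (real m) / t) = exp_bump 1 (real m * t)) sequentially"
      by (rule eventually_mono[OF eventually_gt_at_top[of 0]])
        (use that in \<open>auto simp: exp_bump_1 field_simps\<close>)
    ultimately show ?thesis by (rule Lim_transform_eventually)
  qed
  have "(\<lambda>m. box_bump a b m x) \<longlonglongrightarrow> (\<Prod>i\<in>(UNIV :: 'n set). 1 * 1)"
    unfolding box_bump_def by (intro tendsto_prod tendsto_mult *) (use True in \<open>auto simp: mem_box_cart\<close>)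
  then show ?thesis using True by simp
next
  case False
  then show ?thesis by (simp add: box_bump_eq_0)
qed

lemma box_integral_eq_0:
  fixes g :: "real^'n \<Rightarrow> real"
  assumes int: "g absolutely_integrable_on cbox a b" and sub: "cbox a b \<subseteq> S"
    and test: "\<And>\<phi>. test_function S \<phi> \<Longrightarrow> (LINT x|lebesgue. g x * \<phi> x) = 0"
  shows "(LINT x|lebesgue. indicator (box a b) x * g x) = 0"
proof -
  let ?g = "\<lambda>x. indicator (cbox a b) x *\<^sub>R g x"
  have i: "integrable lebesgue ?g" using int by (simp add: set_integrable_def)
  have eq: "g x * box_bump a b m x = ?g x * box_bump a b m x" for m x
    using box_bump_eq_0[of x a b m] box_subset_cbox[of a b] by (auto simp: indicator_def)
  have "(\<lambda>m. LINT x|lebesgue. ?g x * box_bump a b m x) \<longlonglongrightarrow> (LINT x|lebesgue. ?g x * indicator (box a b) x)"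
  proof (rule integral_dominated_convergence[where w = "\<lambda>x. norm (?g x)"])
    show "AE x in lebesgue. (\<lambda>m. ?g x * box_bump a b m x) \<longlonglongrightarrow> ?g x * indicator (box a b) x"
      by (intro AE_I2 tendsto_intros box_bump_tendsto)
    show "(\<lambda>x. ?g x * box_bump a b m x) \<in> borel_measurable lebesgue" for m
      using i test_function_measurable[OF test_function_box_bump[OF sub]] by (intro borel_measurable_times) auto
    show "(\<lambda>x. ?g x * indicator (box a b) x) \<in> borel_measurable lebesgue"
      using i by (intro borel_measurable_times borel_measurable_indicator) auto
    show "integrable lebesgue (\<lambda>x. norm (?g x))" using i by (rule integrable_norm)
    show "AE x in lebesgue. norm (?g x * box_bump a b m x) \<le> norm (?g x)" for m
      using box_bump_bounds[of a b m] by (intro AE_I2) (simp add: abs_mult mult_left_le)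
  qed
  moreover have "(LINT x|lebesgue. ?g x * box_bump a b m x) = 0" for m
    using test[OF test_function_box_bump[OF sub], of m] eq by simp
  ultimately have "(LINT x|lebesgue. ?g x * indicator (box a b) x) = 0"
    by (simp add: LIMSEQ_const_iff)
  moreover have "(\<lambda>x. ?g x * indicator (box a b) x) = (\<lambda>x. indicator (box a b) x * g x)"
    using box_subset_cbox[of a b] by (auto simp: indicator_def fun_eq_iff)
  ultimately show ?thesis by (simp only:)
qed

text \<open>Testing with \<open>box_bump\<close> shows that g has integral 0 over every subbox of
  \<open>box a b\<close>, and the integrals over boxes determine an integrable function up to a null
  set.\<close>

lemma AE_eq_0_on_box:
  fixes g :: "real^'n \<Rightarrow> real"
  assumes int: "g absolutely_integrable_on cbox a b" and sub: "cbox a b \<subseteq> S"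
    and test: "\<And>\<phi>. test_function S \<phi> \<Longrightarrow> (LINT x|lebesgue. g x * \<phi> x) = 0"
  shows "AE x in lebesgue. x \<in> box a b \<longrightarrow> g x = 0"
proof -
  let ?g = "\<lambda>x. indicator (box a b) x * g x"
  have i: "integrable lebesgue ?g"
    using int absolutely_integrable_on_open_interval[of a b g] by (simp add: set_integrable_def)
  \<comment> \<open>Boxes generate only the Borel sets, so the Lebesgue measurable truncation of g
    is first replaced by a Borel function that agrees with it almost everywhere.\<close>
  obtain h where h[measurable]: "h \<in> borel_measurable lborel" and gh: "AE x in lborel. ?g x = h x"
    using completion_ex_borel_measurable_real[of ?g lborel] i by auto
  have gh': "AE x in lebesgue. ?g x = h x" using gh by (rule AE_completion)
  have "integrable lebesgue h"
    using i gh' by (subst integrable_cong_AE[of _ _ ?g]) (auto intro: measurable_completion)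
  then have hint: "integrable lborel h" by (simp add: integrable_completion)
  have box: "(LINT x:A|lborel. h x) = 0" if Acd: "A = box c d \<or> A = UNIV" for A c d
  proof -
    have A: "A \<in> sets borel" using Acd by auto
    have "(LINT x:A|lborel. h x) = (LINT x|lebesgue. indicator A x * h x)"
      using A by (simp add: set_lebesgue_integral_def integral_completion)
    also have "\<dots> = (LINT x|lebesgue. indicator A x * ?g x)"
    proof (rule integral_cong_AE)
      have "indicat_real A \<in> borel_measurable lebesgue"
        using A by (intro borel_measurable_indicator) auto
      moreover have "h \<in> borel_measurable lebesgue" by (rule measurable_completion) (rule h)
      ultimately show "(\<lambda>x. indicat_real A x * h x) \<in> borel_measurable lebesgue"
        "(\<lambda>x. indicat_real A x * ?g x) \<in> borel_measurable lebesgue"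
        by (intro borel_measurable_times[OF _ borel_measurable_integrable[OF i]] borel_measurable_times; simp)+
      show "AE x in lebesgue. indicat_real A x * h x = indicat_real A x * ?g x"
        using gh' by eventually_elim simp
    qed
    also have "\<dots> = 0"
    proof -
      \<comment> \<open>An empty intersection does not determine a box inside
        \<open>cbox a b\<close>; it is written as the degenerate box at a point e, or as
        \<open>box a b\<close> if \<open>cbox a b\<close> is empty. Otherwise the closed box is the
        closure of the open one.\<close>
      obtain c' d' where cd: "A \<inter> box a b = box c' d'" "cbox c' d' \<subseteq> cbox a b"
      proof (cases "A \<inter> box a b = {}")
        case True
        show ?thesis
        proof (cases "cbox a b = {}")
          case True
          then show ?thesis using that[of a b] \<open>A \<inter> box a b = {}\<close> box_subset_cbox[of a b] by auto
        next
          case False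
          then obtain e where "e \<in> cbox a b" by auto
          then show ?thesis using that[of e e] True by simp
        qed
      next
        case False
        obtain c' d' where cd: "A \<inter> box a b = box c' d'"
          using Acd by (auto simp: box_Int_box)
        then have "closure (box c' d') \<subseteq> closure (box a b)" by (intro closure_mono) auto
        then show ?thesis using that[OF cd] False cd by (metis closure_box inf_bot_right)
      qed
      have "(\<lambda>x. indicator A x * ?g x) = (\<lambda>x. indicator (box c' d') x * g x)"
        using cd(1) by (auto simp: indicator_def fun_eq_iff)
      moreover have "(LINT x|lebesgue. indicator (box c' d') x * g x) = 0"
        using cd(2) sub int test
        by (intro box_integral_eq_0[of _ _ g S]) (auto intro: absolutely_integrable_on_subcbox)
      ultimately show ?thesis by (simp only:)
    qed
    finally show ?thesis .
  qed
  have "AE x in lborel. h x = 0"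
    using hint box[of UNIV] box by (intro AE_eq_0_if_box_integrals_0) (auto simp: set_lebesgue_integral_def)
  then have "AE x in lebesgue. h x = 0" by (rule AE_completion)
  with gh' show ?thesis by eventually_elim (auto simp: indicator_def)
qed

text \<open>An open set is a countable union of closed boxes contained in it, and the faces of a box
  are null.\<close>

lemma AE_eq_0_on_open:
  fixes g :: "real^'n \<Rightarrow> real"
  assumes S: "open S" and int: "\<And>K. compact K \<Longrightarrow> K \<subseteq> S \<Longrightarrow> g absolutely_integrable_on K"
    and test: "\<And>\<phi>. test_function S \<phi> \<Longrightarrow> (LINT x|lebesgue. g x * \<phi> x) = 0"
  shows "AE x in lebesgue. x \<in> S \<longrightarrow> g x = 0"
proof -
  obtain D where D: "countable D" "D \<subseteq> Pow S" "\<And>X. X \<in> D \<Longrightarrow> \<exists>a b. X = cbox a b" "\<Union>D = S"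
    using open_countable_Union_open_cbox[OF S] by metis
  have "AE x in lebesgue. x \<in> X \<longrightarrow> g x = 0" if XD: "X \<in> D" for X
  proof -
    obtain a b where X: "X = cbox a b" using D(3)[OF XD] by blast
    have "AE x in lebesgue. x \<in> box a b \<longrightarrow> g x = 0"
      using D(2) XD X int test by (intro AE_eq_0_on_box[of a b g S]) auto
    moreover have "AE x in lebesgue. x \<notin> cbox a b - box a b"
      by (rule AE_completion[OF AE_not_in[OF null_sets_cbox_Diff_box]])
    ultimately show ?thesis unfolding X by eventually_elim auto
  qed
  then have "AE x in lebesgue. \<forall>X\<in>D. x \<in> X \<longrightarrow> g x = 0"
    using D(1) by (subst AE_ball_countable) auto
  then show ?thesis using D(4) by (auto elim!: eventually_mono)
qed

section \<open>Weak gradients as a linear calculus, independent of the chosen representative\<close>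

section \<open>Calculus of weak gradients\<close>

definition gradient :: "(real^'n \<Rightarrow> real) \<Rightarrow> real^'n \<Rightarrow> real^'n" where
  "gradient \<phi> x = (\<chi> i. frechet_derivative \<phi> (at x) (axis i 1))"

lemma gradient_nth [simp]: "gradient \<phi> x $ i = frechet_derivative \<phi> (at x) (axis i 1)"
  by (simp add: gradient_def)

lemma gradient_cmult: "test_function S \<phi> \<Longrightarrow> gradient (\<lambda>x. c * \<phi> x) x = c *\<^sub>R gradient \<phi> x"
  by (simp add: vec_eq_iff frechet_derivative_cmult test_function_differentiable)

lemma gradient_add:
  assumes "test_function S \<phi>" "test_function T \<psi>"
  shows "gradient (\<lambda>x. \<phi> x + \<psi> x) x = gradient \<phi> x + gradient \<psi> x"
proof -
  have "((\<lambda>x. \<phi> x + \<psi> x) has_derivative (\<lambda>v. frechet_derivative \<phi> (at x) v + frechet_derivative \<psi> (at x) v)) (at x)"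
    using test_function_differentiable[OF assms(1)] test_function_differentiable[OF assms(2)]
    by (intro has_derivative_add) (auto simp: frechet_derivative_works)
  from frechet_derivative_at[OF this, symmetric] show ?thesis by (simp add: vec_eq_iff)
qed

definition loc_integrable :: "(real^'n) set \<Rightarrow> (real^'n \<Rightarrow> 'b::euclidean_space) \<Rightarrow> bool" where
  "loc_integrable S f \<longleftrightarrow> (\<forall>K. compact K \<and> K \<subseteq> S \<longrightarrow> f absolutely_integrable_on K)"

text \<open>Test functions and their derivatives vanish off S, so the integrals over S are integrals
  over the whole space. In this form restriction to a smaller set only means that there are fewer
  test functions.\<close>

lemma has_weak_gradient_iff:
  "has_weak_gradient S f G \<longleftrightarrow> loc_integrable S f \<and> loc_integrable S G \<and>
     (\<forall>\<phi> i. test_function S \<phi> \<longrightarrow>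
        (LINT x|lebesgue. f x * frechet_derivative \<phi> (at x) (axis i 1)) = - (LINT x|lebesgue. G x $ i * \<phi> x))"
  unfolding has_weak_gradient_def loc_integrable_def
  by (auto simp: set_integral_mult_test test_function_deriv)

lemma loc_integrable_component:
  "loc_integrable S G \<Longrightarrow> loc_integrable S (\<lambda>x. G x $ i)"
  using absolutely_integrable_linear[OF _ bounded_linear_vec_nth]
  by (fastforce simp: loc_integrable_def o_def)

lemma loc_integrable_add:
  "loc_integrable S f \<Longrightarrow> loc_integrable S g \<Longrightarrow> loc_integrable S (\<lambda>x. f x + g x)"
  by (auto simp: loc_integrable_def)

lemma loc_integrable_scaleR:
  "loc_integrable S f \<Longrightarrow> loc_integrable S (\<lambda>x. c *\<^sub>R f x)"
  by (auto simp: loc_integrable_def)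

lemma loc_integrable_mono: "loc_integrable S f \<Longrightarrow> T \<subseteq> S \<Longrightarrow> loc_integrable T f"
  by (auto simp: loc_integrable_def)

lemma integrable_loc_mult_test:
  fixes f :: "real^'n \<Rightarrow> real"
  shows "loc_integrable S f \<Longrightarrow> test_function S \<phi> \<Longrightarrow> integrable lebesgue (\<lambda>x. f x * \<phi> x)"
  by (rule integrable_mult_test) (auto simp: loc_integrable_def)

text \<open>Each component of G - H is annihilated by all test functions, so the fundamental lemma
  applies. Hence the choice made by \<open>weak_gradient\<close> does not influence integrals over
  S.\<close>

lemma has_weak_gradient_unique:
  assumes "open S" "has_weak_gradient S f G" "has_weak_gradient S f H"
  shows "AE x in lebesgue. x \<in> S \<longrightarrow> G x = H x"
proof -
  have "AE x in lebesgue. x \<in> S \<longrightarrow> G x $ i - H x $ i = 0" for i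
  proof (rule AE_eq_0_on_open[OF assms(1)])
    have G: "loc_integrable S (\<lambda>x. G x $ i)" "loc_integrable S (\<lambda>x. H x $ i)"
      using assms by (auto simp: has_weak_gradient_iff loc_integrable_component)
    then show "(\<lambda>x. G x $ i - H x $ i) absolutely_integrable_on K" if "compact K" "K \<subseteq> S" for K
      using that by (auto simp: loc_integrable_def)
    show "(LINT x|lebesgue. (G x $ i - H x $ i) * \<phi> x) = 0" if \<phi>: "test_function S \<phi>" for \<phi>
    proof -
      have "(LINT x|lebesgue. (G x $ i - H x $ i) * \<phi> x) = (LINT x|lebesgue. G x $ i * \<phi> x) - (LINT x|lebesgue. H x $ i * \<phi> x)"
        using integrable_loc_mult_test[OF G(1) \<phi>] integrable_loc_mult_test[OF G(2) \<phi>]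
        by (simp add: left_diff_distrib)
      then show ?thesis using assms(2,3) \<phi> by (auto simp: has_weak_gradient_iff)
    qed
  qed
  then have "AE x in lebesgue. \<forall>i\<in>UNIV. x \<in> S \<longrightarrow> G x $ i - H x $ i = 0"
    by (subst AE_ball_countable) (auto simp: uncountable_infinite)
  then show ?thesis by eventually_elim (auto simp: vec_eq_iff)
qed

lemma has_weak_gradient_add:
  assumes "has_weak_gradient S f F" "has_weak_gradient S g G"
  shows "has_weak_gradient S (\<lambda>x. f x + g x) (\<lambda>x. F x + G x)"
  unfolding has_weak_gradient_iff
proof (intro conjI allI impI)
  fix \<phi> i assume \<phi>: "test_function S \<phi>"
  have F: "loc_integrable S (\<lambda>x. F x $ i)" "loc_integrable S (\<lambda>x. G x $ i)"
    and f: "loc_integrable S f" "loc_integrable S g"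
    using assms by (auto simp: has_weak_gradient_iff loc_integrable_component)
  show "(LINT x|lebesgue. (f x + g x) * frechet_derivative \<phi> (at x) (axis i 1))
      = - (LINT x|lebesgue. (F x + G x) $ i * \<phi> x)"
    using assms \<phi> integrable_loc_mult_test[OF F(1) \<phi>] integrable_loc_mult_test[OF F(2) \<phi>]
      integrable_loc_mult_test[OF f(1) test_function_deriv[OF \<phi>, of "axis i 1"]]
      integrable_loc_mult_test[OF f(2) test_function_deriv[OF \<phi>, of "axis i 1"]]
    by (simp add: has_weak_gradient_iff distrib_right)
qed (use assms in \<open>auto simp: has_weak_gradient_iff loc_integrable_add\<close>)

lemma has_weak_gradient_cmult:
  assumes "has_weak_gradient S f F"
  shows "has_weak_gradient S (\<lambda>x. c * f x) (\<lambda>x. c *\<^sub>R F x)"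
  using assms loc_integrable_scaleR[of S f c] loc_integrable_scaleR[of S F c]
  by (auto simp: has_weak_gradient_iff mult.assoc)

lemma has_weak_gradient_diff:
  assumes "has_weak_gradient S f F" "has_weak_gradient S g G"
  shows "has_weak_gradient S (\<lambda>x. f x - g x) (\<lambda>x. F x - G x)"
  using has_weak_gradient_add[OF assms(1) has_weak_gradient_cmult[OF assms(2), of "-1"]] by simp

lemma has_weak_gradient_mono:
  assumes "has_weak_gradient S f F" "T \<subseteq> S"
  shows "has_weak_gradient T f F"
  using assms test_function_mono[of T _ S] unfolding has_weak_gradient_iff loc_integrable_def by blast

lemma integrable_imp_loc_integrable: "integrable lebesgue f \<Longrightarrow> loc_integrable S f"
  unfolding loc_integrable_def set_integrable_def
  by (auto intro!: integrable_mult_indicator simp: compact_imp_closed)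

lemma integrable_gradient:
  fixes \<phi> :: "real^'n \<Rightarrow> real"
  assumes "test_function T \<phi>"
  shows "integrable lebesgue (gradient \<phi>)"
proof -
  have "integrable lebesgue (\<lambda>x. \<Sum>i\<in>UNIV. frechet_derivative \<phi> (at x) (axis i 1) *\<^sub>R axis i (1::real) :: real^'n)"
    using integrable_test[OF test_function_deriv[OF assms]]
    by (intro Bochner_Integration.integrable_sum integrable_scaleR_left) auto
  moreover have "(\<lambda>x. \<Sum>i\<in>UNIV. frechet_derivative \<phi> (at x) (axis i 1) *\<^sub>R axis i (1::real) :: real^'n) = gradient \<phi>"
    by (auto simp: fun_eq_iff vec_eq_iff axis_def if_distrib cong: if_cong)
  ultimately show ?thesis by simp
qed

lemma has_weak_gradient_test:
  assumes "test_function T \<phi>"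
  shows "has_weak_gradient S \<phi> (gradient \<phi>)"
  unfolding has_weak_gradient_iff
  using assms integral_by_parts_test[OF assms] integrable_test[OF assms] integrable_gradient[OF assms]
  by (auto intro: integrable_imp_loc_integrable)

section \<open>Square integrability on a set, and the Sobolev classes built on it\<close>

section \<open>Square integrable functions and Sobolev spaces\<close>

lemma borel_measurable_norm_sq:
  fixes f :: "'a \<Rightarrow> 'b::{real_normed_vector, second_countable_topology}"
  assumes [measurable]: "f \<in> borel_measurable M"
  shows "(\<lambda>x. (norm (f x))\<^sup>2) \<in> borel_measurable M"
  by measurable

lemma in_L2_iff:
  "in_Lq 2 S f \<longleftrightarrow> set_borel_measurable lebesgue S f \<and> set_integrable lebesgue S (\<lambda>x. (norm (f x))\<^sup>2)"
proof -
  have "norm (f x) powr 2 = (norm (f x))\<^sup>2" for x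
    by (cases "norm (f x) = 0") (auto simp: powr_numeral)
  then show ?thesis by (simp add: in_Lq_def)
qed

lemma in_L2D:
  assumes "in_Lq 2 S f"
  shows "(\<lambda>x. indicator S x *\<^sub>R f x) \<in> borel_measurable lebesgue"
    "integrable lebesgue (\<lambda>x. indicator S x * (norm (f x))\<^sup>2)"
  using assms by (auto simp: in_L2_iff set_borel_measurable_def set_integrable_def)

lemma in_L2_add:
  assumes "in_Lq 2 S f" "in_Lq 2 S g"
  shows "in_Lq 2 S (\<lambda>x. f x + g x)"
  unfolding in_L2_iff set_borel_measurable_def set_integrable_def
proof
  have m: "(\<lambda>x. indicator S x *\<^sub>R f x + indicator S x *\<^sub>R g x) \<in> borel_measurable lebesgue"
    using in_L2D[OF assms(1)] in_L2D[OF assms(2)] by (intro borel_measurable_add)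
  then show "(\<lambda>x. indicator S x *\<^sub>R (f x + g x)) \<in> borel_measurable lebesgue"
    by (simp add: scaleR_add_right)
  have eq: "(norm (indicator S x *\<^sub>R f x + indicator S x *\<^sub>R g x))\<^sup>2 = indicator S x *\<^sub>R (norm (f x + g x))\<^sup>2" for x
    by (auto simp: indicator_def)
  show "integrable lebesgue (\<lambda>x. indicator S x *\<^sub>R (norm (f x + g x))\<^sup>2)"
  proof (rule Bochner_Integration.integrable_bound)
    show "integrable lebesgue (\<lambda>x. 2 * (indicator S x * (norm (f x))\<^sup>2) + 2 * (indicator S x * (norm (g x))\<^sup>2))"
      using in_L2D[OF assms(1)] in_L2D[OF assms(2)] by simp
    show "(\<lambda>x. indicator S x *\<^sub>R (norm (f x + g x))\<^sup>2) \<in> borel_measurable lebesgue"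
      unfolding eq[symmetric] using m by (intro borel_measurable_norm_sq)
    show "AE x in lebesgue. norm (indicator S x *\<^sub>R (norm (f x + g x))\<^sup>2)
        \<le> norm (2 * (indicator S x * (norm (f x))\<^sup>2) + 2 * (indicator S x * (norm (g x))\<^sup>2))"
    proof (intro AE_I2)
      fix x
      have "(norm (f x + g x))\<^sup>2 \<le> (norm (f x) + norm (g x))\<^sup>2"
        by (intro power_mono norm_triangle_ineq) auto
      also have "\<dots> \<le> 2 * (norm (f x))\<^sup>2 + 2 * (norm (g x))\<^sup>2"
        using sum_squares_bound[of "norm (f x)" "norm (g x)"] by (simp add: power2_sum)
      finally show "norm (indicator S x *\<^sub>R (norm (f x + g x))\<^sup>2)
          \<le> norm (2 * (indicator S x * (norm (f x))\<^sup>2) + 2 * (indicator S x * (norm (g x))\<^sup>2))"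
        by (auto simp: indicator_def)
    qed
  qed
qed

lemma in_L2_scaleR:
  assumes "in_Lq 2 S f"
  shows "in_Lq 2 S (\<lambda>x. c *\<^sub>R f x)"
  unfolding in_L2_iff set_borel_measurable_def set_integrable_def
proof
  show "(\<lambda>x. indicator S x *\<^sub>R c *\<^sub>R f x) \<in> borel_measurable lebesgue"
    using borel_measurable_scaleR[OF _ in_L2D(1)[OF assms], of "\<lambda>x. c"] by (simp add: mult.commute)
  show "integrable lebesgue (\<lambda>x. indicator S x *\<^sub>R (norm (c *\<^sub>R f x))\<^sup>2)"
    using integrable_mult_right[OF _ , of "c\<^sup>2", of lebesgue "\<lambda>x. indicator S x * (norm (f x))\<^sup>2"] in_L2D(2)[OF assms]
    by (simp add: power_mult_distrib mult.left_commute)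
qed

lemma in_L2_diff: "in_Lq 2 S f \<Longrightarrow> in_Lq 2 S g \<Longrightarrow> in_Lq 2 S (\<lambda>x. f x - g x)"
  using in_L2_add[of S f "\<lambda>x. (-1) *\<^sub>R g x"] in_L2_scaleR[of S g "-1"] by simp

lemma in_L2_inner:
  assumes "in_Lq 2 S f" "in_Lq 2 S g"
  shows "integrable lebesgue (\<lambda>x. indicator S x * (f x \<bullet> g x))"
proof (rule Bochner_Integration.integrable_bound)
  have eq: "indicator S x * (f x \<bullet> g x) = (indicator S x *\<^sub>R f x) \<bullet> (indicator S x *\<^sub>R g x)" for x
    by (auto simp: indicator_def)
  show "(\<lambda>x. indicator S x * (f x \<bullet> g x)) \<in> borel_measurable lebesgue"
    unfolding eq using in_L2D(1)[OF assms(1)] in_L2D(1)[OF assms(2)] by (rule borel_measurable_inner)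
  show "integrable lebesgue (\<lambda>x. indicator S x * (norm (f x))\<^sup>2 + indicator S x * (norm (g x))\<^sup>2)"
    using in_L2D(2)[OF assms(1)] in_L2D(2)[OF assms(2)] by (rule Bochner_Integration.integrable_add)
  show "AE x in lebesgue. norm (indicator S x * (f x \<bullet> g x))
      \<le> norm (indicator S x * (norm (f x))\<^sup>2 + indicator S x * (norm (g x))\<^sup>2)"
  proof (intro AE_I2)
    fix x
    have "2 * (norm (f x) * norm (g x)) \<le> (norm (f x))\<^sup>2 + (norm (g x))\<^sup>2"
      using sum_squares_bound[of "norm (f x)" "norm (g x)"] by simp
    moreover have "0 \<le> norm (f x) * norm (g x)" by simp
    ultimately have "\<bar>f x \<bullet> g x\<bar> \<le> (norm (f x))\<^sup>2 + (norm (g x))\<^sup>2"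
      using Cauchy_Schwarz_ineq2[of "f x" "g x"] by linarith
    then show "norm (indicator S x * (f x \<bullet> g x))
        \<le> norm (indicator S x * (norm (f x))\<^sup>2 + indicator S x * (norm (g x))\<^sup>2)"
      by (auto simp: indicator_def)
  qed
qed

lemma pos_set_lebesgue:
  assumes "in_Lq 2 S f"
  shows "pos_set S f \<in> sets lebesgue"
proof -
  have "pos_set S f = {x \<in> space lebesgue. 0 < indicator S x *\<^sub>R f x}"
    by (auto simp: pos_set_def indicator_def split: if_splits)
  also have "\<dots> \<in> sets lebesgue"
    using in_L2D(1)[OF assms] by (intro borel_measurable_less) auto
  finally show ?thesis .
qed

lemma integral_norm_add_sq:
  assumes "in_Lq 2 S f" "in_Lq 2 S g"
  shows "(LINT x:S|lebesgue. (norm (f x + g x))\<^sup>2)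
    = (LINT x:S|lebesgue. (norm (f x))\<^sup>2) + 2 * (LINT x:S|lebesgue. f x \<bullet> g x) + (LINT x:S|lebesgue. (norm (g x))\<^sup>2)"
proof -
  have "(\<lambda>x. indicator S x *\<^sub>R (norm (f x + g x))\<^sup>2) = (\<lambda>x. indicator S x * (norm (f x))\<^sup>2
      + 2 * (indicator S x * (f x \<bullet> g x)) + indicator S x * (norm (g x))\<^sup>2)"
    by (auto simp: fun_eq_iff indicator_def power2_norm_eq_inner inner_add_left inner_add_right inner_commute)
  then show ?thesis
    using in_L2D(2)[OF assms(1)] in_L2D(2)[OF assms(2)] in_L2_inner[OF assms]
    by (simp add: set_lebesgue_integral_def)
qed

text \<open>Measurability passes from one function to the other, and if neither is measurable both
  integrals are 0 by convention. So integrands built from \<open>weak_gradient\<close> can be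
  exchanged without further checks.\<close>

lemma integral_cong_AE_lebesgue:
  fixes f g :: "'a::euclidean_space \<Rightarrow> real"
  assumes "AE x in lebesgue. f x = g x"
  shows "integral\<^sup>L lebesgue f = integral\<^sup>L lebesgue g"
proof (cases "f \<in> borel_measurable lebesgue")
  case True
  then show ?thesis using borel_measurable_lebesgue_AE[OF True assms] assms by (intro integral_cong_AE)
next
  case False
  have "AE x in lebesgue. g x = f x" using assms by eventually_elim simp
  then have "g \<notin> borel_measurable lebesgue" using False borel_measurable_lebesgue_AE by blast
  then show ?thesis using False borel_measurable_integrable not_integrable_integral_eq by metis
qed

lemma in_L2_AE:
  fixes f g :: "real^'n \<Rightarrow> 'b::euclidean_space"
  assumes "in_Lq 2 S f" "AE x in lebesgue. x \<in> S \<longrightarrow> f x = g x"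
  shows "in_Lq 2 S g"
  unfolding in_L2_iff set_borel_measurable_def set_integrable_def
proof
  have ae: "AE x in lebesgue. indicator S x *\<^sub>R f x = indicator S x *\<^sub>R g x"
    using assms(2) by eventually_elim (auto simp: indicator_def)
  show m: "(\<lambda>x. indicator S x *\<^sub>R g x) \<in> borel_measurable lebesgue"
    by (rule borel_measurable_lebesgue_AE[OF in_L2D(1)[OF assms(1)] ae])
  have eq: "indicator S x *\<^sub>R (norm (g x))\<^sup>2 = (norm (indicator S x *\<^sub>R g x))\<^sup>2" for x
    by (auto simp: indicator_def)
  show "integrable lebesgue (\<lambda>x. indicator S x *\<^sub>R (norm (g x))\<^sup>2)"
  proof (rule integrable_cong_AE_imp[OF in_L2D(2)[OF assms(1)]])
    show "(\<lambda>x. indicator S x *\<^sub>R (norm (g x))\<^sup>2) \<in> borel_measurable lebesgue"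
      unfolding eq using m by (intro borel_measurable_norm_sq)
    show "AE x in lebesgue. indicator S x * (norm (f x))\<^sup>2 = indicator S x *\<^sub>R (norm (g x))\<^sup>2"
      using assms(2) by eventually_elim (auto simp: indicator_def)
  qed
qed

lemma weak_gradient_works: "has_weak_gradient S f G \<Longrightarrow> has_weak_gradient S f (weak_gradient S f)"
  unfolding weak_gradient_def by (rule someI[of "has_weak_gradient S f"])

lemma dirichlet_eq:
  assumes "open S" "has_weak_gradient S f G"
  shows "dirichlet S f = (LINT x:S|lebesgue. (norm (G x))\<^sup>2)"
  unfolding dirichlet_def set_lebesgue_integral_def
proof (rule integral_cong_AE_lebesgue)
  show "AE x in lebesgue. indicator S x *\<^sub>R (norm (weak_gradient S f x))\<^sup>2 = indicator S x *\<^sub>R (norm (G x))\<^sup>2"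
    using has_weak_gradient_unique[OF assms(1) weak_gradient_works[OF assms(2)] assms(2)]
    by eventually_elim (auto simp: indicator_def)
qed

lemma norm_W12_eq:
  assumes "open S" "has_weak_gradient S f G"
  shows "norm_W12 S f = sqrt ((LINT x:S|lebesgue. (f x)\<^sup>2) + (LINT x:S|lebesgue. (norm (G x))\<^sup>2))"
  using dirichlet_eq[OF assms] by (simp add: norm_W12_def dirichlet_def)

lemma W12D:
  assumes "open S" "f \<in> W12 S"
  shows "in_Lq 2 S f" "has_weak_gradient S f (weak_gradient S f)" "in_Lq 2 S (weak_gradient S f)"
proof -
  obtain G where G: "has_weak_gradient S f G" "in_Lq 2 S G" and f: "in_Lq 2 S f"
    using assms(2) by (auto simp: W12_def)
  show "in_Lq 2 S f" by fact
  show w: "has_weak_gradient S f (weak_gradient S f)" using G(1) by (rule weak_gradient_works)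
  show "in_Lq 2 S (weak_gradient S f)"
    by (rule in_L2_AE[OF G(2) has_weak_gradient_unique[OF assms(1) G(1) w]])
qed

lemma in_L2_bounded_support:
  fixes f :: "real^'n \<Rightarrow> 'b::euclidean_space"
  assumes "S \<in> sets lebesgue" "f \<in> borel_measurable lebesgue" "integrable lebesgue f" "\<And>x. norm (f x) \<le> B"
  shows "in_Lq 2 S f"
  unfolding in_L2_iff set_borel_measurable_def set_integrable_def
proof
  show "(\<lambda>x. indicator S x *\<^sub>R f x) \<in> borel_measurable lebesgue"
    using assms by (intro borel_measurable_scaleR borel_measurable_indicator)
  show "integrable lebesgue (\<lambda>x. indicator S x *\<^sub>R (norm (f x))\<^sup>2)"
  proof (rule Bochner_Integration.integrable_bound)
    show "integrable lebesgue (\<lambda>x. B * norm (f x))" using assms(3) by simp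
    show "(\<lambda>x. indicator S x *\<^sub>R (norm (f x))\<^sup>2) \<in> borel_measurable lebesgue"
      using assms by (intro borel_measurable_scaleR borel_measurable_indicator borel_measurable_norm_sq)
    show "AE x in lebesgue. norm (indicator S x *\<^sub>R (norm (f x))\<^sup>2) \<le> norm (B * norm (f x))"
    proof (intro AE_I2)
      fix x
      have "norm (f x) * norm (f x) \<le> \<bar>B\<bar> * norm (f x)"
        using assms(4)[of x] by (intro mult_right_mono) auto
      then show "norm (indicator S x *\<^sub>R (norm (f x))\<^sup>2) \<le> norm (B * norm (f x))"
        by (auto simp: indicator_def power2_eq_square abs_mult)
    qed
  qed
qed

lemma in_L2_test:
  assumes "open S" "test_function T \<phi>"
  shows "in_Lq 2 S \<phi>"
proof -
  obtain B where "\<And>x. \<bar>\<phi> x\<bar> \<le> B" by (rule test_function_bounded[OF assms(2)]) (rule that)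
  then show ?thesis
    using assms integrable_test[OF assms(2)] test_function_measurable[OF assms(2)]
    by (intro in_L2_bounded_support[where B = B]) auto
qed

lemma gradient_bounded:
  fixes \<phi> :: "real^'n \<Rightarrow> real"
  assumes "test_function T \<phi>"
  obtains B where "\<And>x. norm (gradient \<phi> x) \<le> B"
proof -
  have "\<exists>B. \<forall>x. \<bar>gradient \<phi> x $ i\<bar> \<le> B" for i
    using test_function_bounded[OF test_function_deriv[OF assms]] unfolding gradient_nth by metis
  then obtain B where B: "\<And>i x. \<bar>gradient \<phi> x $ i\<bar> \<le> B i" by metis
  have "norm (gradient \<phi> x) \<le> (\<Sum>i\<in>UNIV. B i)" for x
    by (rule order_trans[OF norm_le_l1_cart]) (auto intro!: sum_mono B[unfolded gradient_nth])
  then show ?thesis using that by blast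
qed

lemma in_L2_gradient:
  assumes "open S" "test_function T \<phi>"
  shows "in_Lq 2 S (gradient \<phi>)"
proof -
  obtain B where "\<And>x. norm (gradient \<phi> x) \<le> B" by (rule gradient_bounded[OF assms(2)]) (rule that)
  then show ?thesis
    using assms integrable_gradient[OF assms(2)]
    by (intro in_L2_bounded_support[where B = B]) auto
qed

lemma W12_add:
  assumes "f \<in> W12 S" "g \<in> W12 S"
  shows "(\<lambda>x. f x + g x) \<in> W12 S"
proof -
  obtain F G where "has_weak_gradient S f F" "in_Lq 2 S F" "has_weak_gradient S g G" "in_Lq 2 S G"
    using assms by (auto simp: W12_def)
  then have "has_weak_gradient S (\<lambda>x. f x + g x) (\<lambda>x. F x + G x) \<and> in_Lq 2 S (\<lambda>x. F x + G x)"
    using has_weak_gradient_add in_L2_add by blast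
  moreover have "in_Lq 2 S (\<lambda>x. f x + g x)"
    using assms by (intro in_L2_add) (auto simp: W12_def)
  ultimately show ?thesis unfolding W12_def by (intro CollectI conjI exI[of _ "\<lambda>x. F x + G x"]) auto
qed

lemma test_function_W12:
  assumes "open S" "test_function T \<phi>"
  shows "\<phi> \<in> W12 S"
  using in_L2_test[OF assms] in_L2_gradient[OF assms] has_weak_gradient_test[OF assms(2), of S]
  by (auto simp: W12_def)

lemma W12_0_zero:
  assumes "open S"
  shows "(\<lambda>x. 0) \<in> W12_0 S"
proof -
  have g: "gradient (\<lambda>x. 0) = (\<lambda>x. 0)" by (auto simp: fun_eq_iff vec_eq_iff frechet_derivative_const)
  have "norm_W12 S (\<lambda>x. 0 - 0) = 0"
    using norm_W12_eq[OF assms has_weak_gradient_test[OF test_function_zero]] by (simp add: g set_lebesgue_integral_def)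
  moreover have "(\<lambda>x. 0) \<in> W12 S" using test_function_W12[OF assms test_function_zero] .
  ultimately show ?thesis
    unfolding W12_0_def by (intro CollectI conjI exI[of _ "\<lambda>k x. 0"]) (simp_all add: test_function_zero)
qed

text \<open>Adding \<psi> to the approximating test functions leaves the differences
  unchanged.\<close>

lemma W12_0_add_test:
  assumes "open S" "f \<in> W12_0 S" "test_function S \<psi>"
  shows "(\<lambda>x. f x + \<psi> x) \<in> W12_0 S"
proof -
  obtain \<phi> where f: "f \<in> W12 S" and \<phi>: "\<And>k::nat. test_function S (\<phi> k)" "(\<lambda>k. norm_W12 S (\<lambda>x. f x - \<phi> k x)) \<longlonglongrightarrow> 0"
    using assms(2) by (auto simp: W12_0_def)
  have "(\<lambda>x. f x + \<psi> x) \<in> W12 S" using W12_add[OF f test_function_W12[OF assms(1,3)]] .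
  moreover have "test_function S (\<lambda>x. \<phi> k x + \<psi> x)" for k using \<phi>(1) assms(3) by (rule test_function_add)
  moreover have "(\<lambda>x. f x + \<psi> x - (\<phi> k x + \<psi> x)) = (\<lambda>x. f x - \<phi> k x)" for k by auto
  ultimately show ?thesis
    unfolding W12_0_def using \<phi>(2) by (intro CollectI conjI exI[of _ "\<lambda>k x. \<phi> k x + \<psi> x"]) auto
qed

lemma admissible_add_test:
  assumes "open S" "u \<in> admissible S g" "test_function S \<psi>"
  shows "(\<lambda>x. u x + \<psi> x) \<in> admissible S g"
proof -
  have "(\<lambda>x. u x - g x + \<psi> x) \<in> W12_0 S"
    using assms by (intro W12_0_add_test) (auto simp: admissible_def)
  moreover have "(\<lambda>x. u x - g x + \<psi> x) = (\<lambda>x. u x + \<psi> x - g x)" by auto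
  ultimately show ?thesis
    using assms W12_add[OF _ test_function_W12[OF assms(1,3)]] by (auto simp: admissible_def)
qed

section \<open>Dirichlet energy of a perturbation by a test function, and its behaviour under
  dilation\<close>

section \<open>Variations of the Dirichlet integral\<close>

definition laplacian :: "(real^'n \<Rightarrow> real) \<Rightarrow> real^'n \<Rightarrow> real" where
  "laplacian \<phi> x =
     (\<Sum>i\<in>UNIV. frechet_derivative (\<lambda>y. frechet_derivative \<phi> (at y) (axis i 1)) (at x) (axis i 1))"

lemma test_function_laplacian: "test_function S \<phi> \<Longrightarrow> test_function S (laplacian \<phi>)"
  unfolding laplacian_def[abs_def] by (intro test_function_sum test_function_deriv)

lemma laplacian_cmult: "test_function S \<phi> \<Longrightarrow> laplacian (\<lambda>x. c * \<phi> x) x = c * laplacian \<phi> x"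
  by (simp add: laplacian_def sum_distrib_left frechet_derivative_cmult
      test_function_differentiable test_function_differentiable[OF test_function_deriv])

text \<open>Every partial derivative of \<phi> is again a test function, so the definition of the
  weak gradient can be applied to it component by component.\<close>

lemma integral_inner_gradient:
  assumes G: "has_weak_gradient S f G" and \<phi>: "test_function S \<phi>"
  shows "(LINT x:S|lebesgue. G x \<bullet> gradient \<phi> x) = - (LINT x|lebesgue. f x * laplacian \<phi> x)"
proof -
  let ?d = "\<lambda>i y. frechet_derivative \<phi> (at y) (axis i 1)"
  have d: "test_function S (?d i)" for i using test_function_deriv[OF \<phi>] .
  have Gi: "loc_integrable S (\<lambda>x. G x $ i)" "loc_integrable S f" for i
    using G by (auto simp: has_weak_gradient_iff loc_integrable_component)
  obtain K where K: "K \<subseteq> S" "\<And>x v. x \<notin> K \<Longrightarrow> frechet_derivative \<phi> (at x) v = 0"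
    by (rule test_functionE[OF \<phi>]) (rule that)
  have "(\<lambda>x. indicator S x *\<^sub>R (G x \<bullet> gradient \<phi> x)) = (\<lambda>x. \<Sum>i\<in>UNIV. G x $ i * ?d i x)"
  proof
    fix x
    show "indicator S x *\<^sub>R (G x \<bullet> gradient \<phi> x) = (\<Sum>i\<in>UNIV. G x $ i * ?d i x)"
    proof (cases "x \<in> S")
      case False
      then have "x \<notin> K" using K(1) by auto
      then show ?thesis using K(2) False by simp
    qed (simp add: inner_vec_def)
  qed
  then have "(LINT x:S|lebesgue. G x \<bullet> gradient \<phi> x) = (LINT x|lebesgue. (\<Sum>i\<in>UNIV. G x $ i * ?d i x))"
    by (simp add: set_lebesgue_integral_def)
  also have "\<dots> = (\<Sum>i\<in>UNIV. (LINT x|lebesgue. G x $ i * ?d i x))"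
    using integrable_loc_mult_test[OF Gi(1) d] by (intro Bochner_Integration.integral_sum) auto
  also have "\<dots> = (\<Sum>i\<in>UNIV. - (LINT x|lebesgue. f x * frechet_derivative (?d i) (at x) (axis i 1)))"
    using G d by (intro sum.cong) (auto simp: has_weak_gradient_iff)
  also have "\<dots> = - (LINT x|lebesgue. (\<Sum>i\<in>UNIV. f x * frechet_derivative (?d i) (at x) (axis i 1)))"
    using integrable_loc_mult_test[OF Gi(2) test_function_deriv[OF d]]
    by (subst Bochner_Integration.integral_sum) (auto simp: sum_negf)
  finally show ?thesis by (simp add: laplacian_def sum_distrib_left)
qed

lemma integral_gradient_sq_set:
  assumes "test_function S \<phi>"
  shows "(LINT x:S|lebesgue. (norm (gradient \<phi> x))\<^sup>2) = (LINT x|lebesgue. (norm (gradient \<phi> x))\<^sup>2)"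
proof -
  obtain K where K: "K \<subseteq> S" "\<And>x v. x \<notin> K \<Longrightarrow> frechet_derivative \<phi> (at x) v = 0"
    by (rule test_functionE[OF assms]) (rule that)
  have "gradient \<phi> x = 0" if "x \<notin> S" for x
    using K that by (auto simp: vec_eq_iff)
  then have "(\<lambda>x. indicator S x *\<^sub>R (norm (gradient \<phi> x))\<^sup>2) = (\<lambda>x. (norm (gradient \<phi> x))\<^sup>2)"
    by (auto simp: fun_eq_iff indicator_def)
  then show ?thesis by (simp add: set_lebesgue_integral_def)
qed

lemma dirichlet_add_test:
  assumes "open S" "u \<in> W12 S" "test_function S \<psi>"
  shows "dirichlet S (\<lambda>x. u x + \<psi> x)
    = dirichlet S u - 2 * (LINT x|lebesgue. u x * laplacian \<psi> x) + (LINT x|lebesgue. (norm (gradient \<psi> x))\<^sup>2)"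
proof -
  note u = W12D[OF assms(1,2)]
  have "dirichlet S (\<lambda>x. u x + \<psi> x) = (LINT x:S|lebesgue. (norm (weak_gradient S u x + gradient \<psi> x))\<^sup>2)"
    by (rule dirichlet_eq[OF assms(1) has_weak_gradient_add[OF u(2) has_weak_gradient_test[OF assms(3)]]])
  also have "\<dots> = dirichlet S u + 2 * (LINT x:S|lebesgue. weak_gradient S u x \<bullet> gradient \<psi> x)
      + (LINT x:S|lebesgue. (norm (gradient \<psi> x))\<^sup>2)"
    unfolding dirichlet_def by (rule integral_norm_add_sq[OF u(3) in_L2_gradient[OF assms(1,3)]])
  finally show ?thesis
    using integral_inner_gradient[OF u(2) assms(3)] integral_gradient_sq_set[OF assms(3)] by simp
qed

text \<open>The factor \<rho> is the one for which the rescaling of u +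
  \<open>scale_test \<rho> \<phi>\<close> is \<open>rescale \<rho> u\<close> + \<phi>. The gradient
  is then merely transported, and the Laplacian acquires a factor 1/\<rho>.\<close>

definition scale_test :: "real \<Rightarrow> (real^'n \<Rightarrow> real) \<Rightarrow> real^'n \<Rightarrow> real" where
  "scale_test \<rho> \<phi> x = \<rho> * \<phi> (x /\<^sub>R \<rho>)"

context
  fixes \<rho> :: real and \<phi> :: "real^'n \<Rightarrow> real" and S :: "(real^'n) set"
  assumes \<rho>: "\<rho> > 0" and \<phi>: "test_function S \<phi>"
begin

lemma deriv_scale_test:
  "frechet_derivative (scale_test \<rho> \<phi>) (at x) v = frechet_derivative \<phi> (at (x /\<^sub>R \<rho>)) v"
proof -
  have "frechet_derivative (\<lambda>x. \<rho> * \<phi> (inverse \<rho> *\<^sub>R x)) (at x) v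
      = \<rho> * frechet_derivative (\<lambda>x. \<phi> (inverse \<rho> *\<^sub>R x)) (at x) v"
    using frechet_derivative_mult_apply[of "\<lambda>x. \<rho>" x "\<lambda>x. \<phi> (inverse \<rho> *\<^sub>R x)" v]
      frechet_derivative_scale(1)[OF test_function_differentiable[OF \<phi>]] by simp
  also have "\<dots> = frechet_derivative \<phi> (at (x /\<^sub>R \<rho>)) v"
    using frechet_derivative_scale(2)[OF test_function_differentiable[OF \<phi>]] \<rho> by simp
  finally show ?thesis by (simp add: scale_test_def[abs_def])
qed

lemma gradient_scale_test: "gradient (scale_test \<rho> \<phi>) x = gradient \<phi> (x /\<^sub>R \<rho>)"
  by (simp add: vec_eq_iff deriv_scale_test)

lemma laplacian_scale_test: "laplacian (scale_test \<rho> \<phi>) x = laplacian \<phi> (x /\<^sub>R \<rho>) / \<rho>"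
proof -
  have "frechet_derivative (\<lambda>y. frechet_derivative \<phi> (at (y /\<^sub>R \<rho>)) v) (at x) v
      = frechet_derivative (\<lambda>y. frechet_derivative \<phi> (at y) v) (at (x /\<^sub>R \<rho>)) v / \<rho>" for v
    using frechet_derivative_scale(2)[OF test_function_differentiable[OF test_function_deriv[OF \<phi>, of v]], of "inverse \<rho>" x v]
    by (simp add: divide_inverse mult.commute)
  then show ?thesis
    by (simp add: laplacian_def deriv_scale_test sum_divide_distrib)
qed

lemma test_function_scale_test: "test_function ((*\<^sub>R) \<rho> ` S) (scale_test \<rho> \<phi>)"
proof -
  obtain K where K: "compact K" "K \<subseteq> S" "\<And>x. x \<notin> K \<Longrightarrow> \<phi> x = 0"
    by (rule test_functionE[OF \<phi>]) (rule that)
  show ?thesis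
  proof (rule test_functionI[of _ "(*\<^sub>R) \<rho> ` K"])
    show "Ck_on k UNIV (scale_test \<rho> \<phi>)" for k
      unfolding scale_test_def[abs_def] by (intro Ck_on_cmult Ck_on_scale test_function_Ck[OF \<phi>])
    show "compact ((*\<^sub>R) \<rho> ` K)" using K(1) by (rule compact_scaling)
    show "scale_test \<rho> \<phi> x = 0" if "x \<notin> (*\<^sub>R) \<rho> ` K" for x
    proof -
      have "x /\<^sub>R \<rho> \<notin> K"
        using that \<rho> by (auto simp: image_iff dest!: bspec[of _ _ "x /\<^sub>R \<rho>"])
      then show ?thesis using K(3) by (simp add: scale_test_def)
    qed
  qed (use K in auto)
qed

lemma integral_gradient_scale_test:
  "(LINT x|lebesgue. (norm (gradient (scale_test \<rho> \<phi>) x))\<^sup>2)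
    = \<rho> ^ CARD('n) * (LINT x|lebesgue. (norm (gradient \<phi> x))\<^sup>2)"
proof -
  have "(\<lambda>x. (norm (gradient (scale_test \<rho> \<phi>) x))\<^sup>2) \<in> borel_measurable lebesgue"
    using integrable_gradient[OF test_function_scale_test] by (intro borel_measurable_norm_sq) auto
  from integral_scale_lebesgue[OF this \<rho>] show ?thesis
    using \<rho> by (simp add: gradient_scale_test field_simps)
qed

text \<open>The factor 1/\<rho> of the Laplacian turns u(\<rho> x) into the rescaling of u, so that
  only the Jacobian \<rho>^n remains; the gradient term scales with the same power.\<close>

lemma integral_laplacian_scale_test:
  assumes "loc_integrable ((*\<^sub>R) \<rho> ` S) u"
  shows "(LINT x|lebesgue. u x * laplacian (scale_test \<rho> \<phi>) x)
    = \<rho> ^ CARD('n) * (LINT x|lebesgue. rescale \<rho> u x * laplacian \<phi> x)"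
proof -
  have "integrable lebesgue (\<lambda>x. u x * laplacian (scale_test \<rho> \<phi>) x)"
    by (rule integrable_loc_mult_test[OF assms test_function_laplacian[OF test_function_scale_test]])
  then have "(\<lambda>x. u x * laplacian (scale_test \<rho> \<phi>) x) \<in> borel_measurable lebesgue" by auto
  from integral_scale_lebesgue[OF this \<rho>] show ?thesis
    using \<rho> by (simp add: laplacian_scale_test rescale_def field_simps)
qed

end

section \<open>Mean value property of weakly harmonic functions through smooth radial
  kernels\<close>

section \<open>Strong maximum principle\<close>

lemma Ck_on_inner_self: "Ck_on k UNIV (\<lambda>x::real^'n. x \<bullet> x)"
  unfolding inner_vec_def inner_real_def
  by (intro Ck_on_sum Ck_on_mult Ck_on_bounded_linear bounded_linear_vec_nth)

lemma Ck_on_radial: "Ck_on k UNIV (\<lambda>x::real^'n. exp_bump p (1 - c * (x \<bullet> x)))"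
proof -
  have "Ck_on k UNIV (\<lambda>x::real^'n. 1 - c * (x \<bullet> x))"
    by (intro Ck_on_diff Ck_on_const Ck_on_cmult Ck_on_inner_self)
  from Ck_on_compose[OF this Ck_on_exp_bump] show ?thesis .
qed

text \<open>\<tau> is the reciprocal of the radius of the supporting ball, which makes the argument
  of \<open>exp_bump\<close> polynomial in \<tau> and x together.\<close>

definition radial_bump :: "real poly \<Rightarrow> real \<Rightarrow> real^'n \<Rightarrow> real" where
  "radial_bump p \<tau> x = exp_bump p (1 - \<tau>\<^sup>2 * (x \<bullet> x))"

lemma radial_bump_eq_0:
  assumes "\<tau> > 0" "x \<notin> ball 0 (1 / \<tau>)"
  shows "radial_bump p \<tau> x = 0"
proof -
  have "1 \<le> \<tau> * norm x" using assms by (simp add: field_simps)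
  then have "1 \<le> (\<tau> * norm x)\<^sup>2" by simp
  then show ?thesis
    by (simp add: radial_bump_def exp_bump_def power_mult_distrib power2_norm_eq_inner)
qed

lemma radial_bump_pos_arg:
  fixes x :: "real^'n"
  assumes "\<tau> > 0" "x \<in> ball 0 (1 / \<tau>)"
  shows "1 - \<tau>\<^sup>2 * (x \<bullet> x) > 0"
proof -
  have "\<tau> * norm x < 1" using assms by (simp add: field_simps)
  then have "(\<tau> * norm x)\<^sup>2 < 1" using assms(1) by (simp add: power_less_one_iff abs_square_less_1)
  then show ?thesis by (simp add: power_mult_distrib power2_norm_eq_inner)
qed

lemma test_function_radial_bump:
  fixes S :: "(real^'n) set"
  assumes "\<tau> > 0" "cball 0 (1 / \<tau>) \<subseteq> S"
  shows "test_function S (radial_bump p \<tau>)"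
  unfolding radial_bump_def[abs_def]
proof (rule test_functionI[OF Ck_on_radial compact_cball assms(2)])
  show "exp_bump p (1 - \<tau>\<^sup>2 * (x \<bullet> x)) = 0" if "x \<notin> cball 0 (1 / \<tau>)" for x :: "real^'n"
    using radial_bump_eq_0[OF assms(1), of x p] that by (simp add: radial_bump_def)
qed

lemma has_derivative_radial_bump:
  fixes x :: "real^'n"
  shows "(radial_bump p \<tau> has_derivative
    (\<lambda>v. - 2 * \<tau>\<^sup>2 * (x \<bullet> v) * radial_bump (exp_bump_deriv p) \<tau> x)) (at x)"
proof -
  have d: "((\<lambda>x::real^'n. 1 - \<tau>\<^sup>2 * (x \<bullet> x)) has_derivative (\<lambda>v. - 2 * \<tau>\<^sup>2 * (x \<bullet> v))) (at x)"
    by (auto intro!: derivative_eq_intros simp: inner_commute)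
  have "((\<lambda>x. exp_bump p (1 - \<tau>\<^sup>2 * (x \<bullet> x))) has_derivative
      (\<lambda>v. (- 2 * \<tau>\<^sup>2 * (x \<bullet> v)) * exp_bump (exp_bump_deriv p) (1 - \<tau>\<^sup>2 * (x \<bullet> x)))) (at x)"
    using has_derivative_compose[OF d has_field_derivative_exp_bump[THEN has_field_derivative_imp_has_derivative]]
    by (simp add: mult.commute mult.left_commute)
  then show ?thesis by (simp add: radial_bump_def[abs_def])
qed

lemma deriv_radial_bump:
  "frechet_derivative (radial_bump p \<tau>) (at x) v = - 2 * \<tau>\<^sup>2 * (x \<bullet> v) * radial_bump (exp_bump_deriv p) \<tau> x"
  using frechet_derivative_at[OF has_derivative_radial_bump] by metis

text \<open>With s = 1 - \<tau>^2 |x|^2, the Laplacian of F(s) is F'(s) times the Laplacian of s,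
  which is - 2 n \<tau>^2, plus F''(s) times |grad s|^2 = 4 \<tau>^4 |x|^2.\<close>

lemma laplacian_radial_bump:
  fixes x :: "real^'n"
  shows "laplacian (radial_bump p \<tau>) x = - 2 * real CARD('n) * \<tau>\<^sup>2 * radial_bump (exp_bump_deriv p) \<tau> x
    + 4 * \<tau>^4 * (x \<bullet> x) * radial_bump (exp_bump_deriv (exp_bump_deriv p)) \<tau> x"
proof -
  let ?p = "exp_bump_deriv p"
  have "frechet_derivative (\<lambda>y. - 2 * \<tau>\<^sup>2 * (y \<bullet> axis i 1) * radial_bump ?p \<tau> y) (at x) (axis i 1)
      = - 2 * \<tau>\<^sup>2 * radial_bump ?p \<tau> x + 4 * \<tau>^4 * (x $ i)\<^sup>2 * radial_bump (exp_bump_deriv ?p) \<tau> x" for i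
  proof -
    have "((\<lambda>y. - 2 * \<tau>\<^sup>2 * (y \<bullet> axis i 1) * radial_bump ?p \<tau> y) has_derivative
      (\<lambda>v. - 2 * \<tau>\<^sup>2 * (x \<bullet> axis i 1) * (- 2 * \<tau>\<^sup>2 * (x \<bullet> v) * radial_bump (exp_bump_deriv ?p) \<tau> x)
         + - 2 * \<tau>\<^sup>2 * (v \<bullet> axis i 1) * radial_bump ?p \<tau> x)) (at x)"
      by (rule has_derivative_mult[OF _ has_derivative_radial_bump]) (auto intro!: derivative_eq_intros)
    from frechet_derivative_at[OF this, symmetric] show ?thesis
      by (simp add: inner_axis power2_eq_square power4_eq_xxxx algebra_simps)
  qed
  then have "laplacian (radial_bump p \<tau>) x
      = (\<Sum>i\<in>UNIV. - 2 * \<tau>\<^sup>2 * radial_bump ?p \<tau> x + 4 * \<tau>^4 * (x $ i)\<^sup>2 * radial_bump (exp_bump_deriv ?p) \<tau> x)"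
    unfolding laplacian_def deriv_radial_bump by simp
  also have "\<dots> = - 2 * real CARD('n) * \<tau>\<^sup>2 * radial_bump ?p \<tau> x
    + 4 * \<tau>^4 * (\<Sum>i\<in>UNIV. (x $ i)\<^sup>2) * radial_bump (exp_bump_deriv ?p) \<tau> x"
    by (simp add: sum.distrib sum_subtractf sum_distrib_left sum_distrib_right)
  also have "(\<Sum>i\<in>UNIV. (x $ i)\<^sup>2) = x \<bullet> x"
    by (simp add: inner_vec_def power2_eq_square)
  finally show ?thesis .
qed

text \<open>The profile 2 F'(s), with F = \<open>exp_bump 1\<close> and s = 1 - \<tau>^2 |y|^2, is
  nonnegative because F is nondecreasing. It is chosen such that y times the profile equals -
  \<tau>^(-2) times the gradient of \<open>radial_bump 1 \<tau>\<close>; the power of \<tau> makes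
  the total mass independent of \<tau>.\<close>

definition mean_kernel :: "real \<Rightarrow> real^'n \<Rightarrow> real" where
  "mean_kernel \<tau> y = \<tau> ^ CARD('n) * (2 * radial_bump (exp_bump_deriv 1) \<tau> y)"

lemma mean_kernel_nonneg: "\<tau> > 0 \<Longrightarrow> 0 \<le> mean_kernel \<tau> y"
  by (simp add: mean_kernel_def radial_bump_def exp_bump_def exp_bump_deriv_def)

lemma mean_kernel_pos: "\<tau> > 0 \<Longrightarrow> y \<in> ball 0 (1 / \<tau>) \<Longrightarrow> 0 < mean_kernel \<tau> y"
  using radial_bump_pos_arg[of \<tau> y]
  by (simp add: mean_kernel_def radial_bump_def exp_bump_def exp_bump_deriv_def)

lemma mean_kernel_eq_0: "\<tau> > 0 \<Longrightarrow> y \<notin> ball 0 (1 / \<tau>) \<Longrightarrow> mean_kernel \<tau> y = 0"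
  by (simp add: mean_kernel_def radial_bump_eq_0)

lemma test_function_mean_kernel:
  "\<tau> > 0 \<Longrightarrow> cball 0 (1 / \<tau>) \<subseteq> S \<Longrightarrow> test_function S (mean_kernel \<tau>)"
  unfolding mean_kernel_def[abs_def] by (intro test_function_cmult test_function_radial_bump)

text \<open>For smooth k, the \<tau>-derivative of \<tau>^n k(\<tau> y) is \<tau>^(n-1) times the
  divergence of y k(\<tau> y). For this kernel the vector field is a multiple of the gradient of
  \<open>radial_bump 1 \<tau>\<close>, which is where the Laplacian comes from.\<close>

lemma has_derivative_mean_kernel:
  fixes y :: "real^'n"
  assumes "\<tau> > 0"
  shows "((\<lambda>\<tau>. mean_kernel \<tau> y) has_field_derivative
    - (\<tau> ^ CARD('n) / \<tau>^3) * laplacian (radial_bump 1 \<tau>) y) (at \<tau> within U)"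
proof -
  have d: "((\<lambda>\<tau>. radial_bump (exp_bump_deriv 1) \<tau> y) has_field_derivative
      radial_bump (exp_bump_deriv (exp_bump_deriv 1)) \<tau> y * (- 2 * \<tau> * (y \<bullet> y))) (at \<tau> within U)"
    unfolding radial_bump_def
    by (rule DERIV_chain2[OF has_field_derivative_exp_bump]) (auto intro!: derivative_eq_intros)
  \<comment> \<open>Writing the dimension as a successor removes the truncated subtraction from the
    derivative of \<tau>^n.\<close>
  obtain m where m: "CARD('n) = Suc m" by (metis zero_less_card_finite gr0_implies_Suc)
  show ?thesis
    unfolding mean_kernel_def laplacian_radial_bump m
    by (rule derivative_eq_intros d refl)+
      (use assms in \<open>simp add: field_simps power2_eq_square power3_eq_cube power4_eq_xxxx\<close>)
qed

lemma integral_mean_kernel: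
  assumes "\<tau> > 0"
  shows "(LINT y|lebesgue. mean_kernel \<tau> (y::real^'n)) = (LINT y|lebesgue. mean_kernel 1 (y::real^'n))"
proof -
  have "mean_kernel 1 \<in> borel_measurable (lebesgue :: (real^'n) measure)"
    using test_function_measurable(2)[OF test_function_mean_kernel[of 1 UNIV]] by simp
  from integral_scale_lebesgue[OF this assms]
  have "(LINT y|lebesgue. mean_kernel 1 (\<tau> *\<^sub>R y::real^'n)) = (LINT y|lebesgue. mean_kernel 1 (y::real^'n)) / \<tau> ^ CARD('n)" .
  moreover have "(\<lambda>y::real^'n. mean_kernel \<tau> y) = (\<lambda>y. \<tau> ^ CARD('n) * mean_kernel 1 (\<tau> *\<^sub>R y))"
    by (auto simp: mean_kernel_def radial_bump_def power2_eq_square mult.assoc)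
  ultimately show ?thesis using assms by simp
qed

lemma open_superlevel:
  fixes f :: "real^'n \<Rightarrow> real"
  assumes "continuous_on (ball 0 r) f"
  shows "{x \<in> ball 0 r. f x > c} \<in> lmeasurable"
proof -
  have "{x \<in> ball 0 r. f x > c} = ball 0 r \<inter> f -` {c<..}" by auto
  then have "open {x \<in> ball 0 r. f x > c}"
    using continuous_open_preimage[OF assms open_ball, of "{c<..}"] by simp
  then show ?thesis
    by (intro lmeasurable_open bounded_subset[OF bounded_ball[of 0 r]]) auto
qed

lemma continuous_on_loc_integrable:
  fixes f :: "real^'n \<Rightarrow> real"
  assumes "continuous_on S f"
  shows "loc_integrable S f"
  unfolding loc_integrable_def set_integrable_def
proof (intro allI impI)
  fix K assume K: "compact K \<and> K \<subseteq> S"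
  then have "integrable lborel (\<lambda>x. indicator K x *\<^sub>R f x)"
    using assms by (intro borel_integrable_compact) (auto intro: continuous_on_subset)
  then show "integrable lebesgue (\<lambda>x. indicator K x *\<^sub>R f x)"
    by (subst integrable_completion) auto
qed

text \<open>Differentiation under the integral sign is carried out for gauge integrals over a box;
  this translates between them and the Lebesgue integrals used elsewhere.\<close>

lemma integral_cbox_mult_test:
  fixes u :: "real^'n \<Rightarrow> real"
  assumes "continuous_on (cbox a b) u" "test_function (cbox a b) \<phi>"
  shows "(\<lambda>y. u y * \<phi> y) integrable_on cbox a b"
    "integral (cbox a b) (\<lambda>y. u y * \<phi> y) = (LINT y|lebesgue. u y * \<phi> y)"
proof -
  have "integrable lebesgue (\<lambda>y. u y * \<phi> y)"
    using integrable_loc_mult_test[OF continuous_on_loc_integrable[OF assms(1)] assms(2)] .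
  then have "set_integrable lebesgue (cbox a b) (\<lambda>y. u y * \<phi> y)"
    unfolding set_integrable_def by (intro integrable_mult_indicator) auto
  note * = set_lebesgue_integral_eq_integral[OF this]
  show "(\<lambda>y. u y * \<phi> y) integrable_on cbox a b" by (rule *(1))
  show "integral (cbox a b) (\<lambda>y. u y * \<phi> y) = (LINT y|lebesgue. u y * \<phi> y)"
    using *(2) set_integral_mult_test[OF assms(2)] by simp
qed

text \<open>Weighted means of \<open>u\<close> over the balls \<open>B\<^bsub>1/\<tau>\<^esub>\<close> do not depend on \<open>\<tau>\<close>, because the
  \<open>\<tau>\<close>-derivative of the weight is a multiple of the Laplacian of a test function.\<close>

lemma mean_kernel_integral_constant:
  fixes u :: "real^'n \<Rightarrow> real"
  assumes u: "continuous_on (cbox a b) u" and harm: "\<And>\<phi>. test_function (cbox a b) \<phi> \<Longrightarrow> (LINT x|lebesgue. u x * laplacian \<phi> x) = 0"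
    and T: "T > 0" "cball 0 (1 / T) \<subseteq> cbox a b" "T \<le> \<tau>"
  shows "(LINT x|lebesgue. u x * mean_kernel \<tau> x) = (LINT x|lebesgue. u x * mean_kernel T x)"
proof (cases "\<tau> = T")
  case False
  let ?A = "\<lambda>\<tau>. integral (cbox a b) (\<lambda>y. u y * mean_kernel \<tau> y)"
  let ?d = "\<lambda>\<tau> y. u y * (- (\<tau> ^ CARD('n) / \<tau>^3) * laplacian (radial_bump 1 \<tau>) y)"
  \<comment> \<open>A larger parameter means a smaller ball, so the half-line from T upwards keeps
    every support inside the box.\<close>
  have sub: "cball 0 (1 / s) \<subseteq> cbox a b" if "s \<ge> T" for s
    using T that by (intro order_trans[OF subset_cball T(2)]) (simp add: field_simps)
  have pos: "s > 0" if "s \<ge> T" for s using T that by simp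
  note k = integral_cbox_mult_test[OF u test_function_mean_kernel[OF pos sub]]
  have D: "(?A has_field_derivative 0) (at s within {T..})" if s: "s \<in> {T..}" for s
  proof -
    have "(?A has_field_derivative integral (cbox a b) (?d s)) (at s within {T..})"
    proof (rule leibniz_rule_field_derivative[where U = "{T..}"])
      show "((\<lambda>s. u y * mean_kernel s y) has_field_derivative ?d s y) (at s within {T..})"
        if "s \<in> {T..}" for s y
        using has_derivative_mean_kernel[of s y "{T..}"] pos[of s] that by (intro DERIV_cmult) auto
      show "(\<lambda>y. u y * mean_kernel s y) integrable_on cbox a b" if "s \<in> {T..}" for s
        using k(1) that by auto
      have cr: "continuous_on ({T..} \<times> cbox a b) (\<lambda>z. radial_bump p (fst z) (snd z))" for p
        unfolding radial_bump_def
        by (rule continuous_on_compose2[OF continuous_on_exp_bump]) (auto intro!: continuous_intros)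
      have cu: "continuous_on ({T..} \<times> cbox a b) (\<lambda>z. u (snd z))"
        by (rule continuous_on_compose2[OF u]) (auto intro!: continuous_intros)
      have "continuous_on ({T..} \<times> cbox a b) (\<lambda>z. ?d (fst z) (snd z))"
        unfolding laplacian_radial_bump
        by (intro continuous_intros cr cu) (use T in auto)
      then show "continuous_on ({T..} \<times> cbox a b) (\<lambda>(s, y). ?d s y)"
        by (simp add: case_prod_unfold)
    qed (use s in auto)
    moreover have "integral (cbox a b) (?d s) = 0"
    proof -
      have t: "test_function (cbox a b) (radial_bump 1 s :: real^'n \<Rightarrow> real)"
        using s by (intro test_function_radial_bump pos sub) auto
      have "(\<lambda>y. ?d s y) = (\<lambda>y. - (s ^ CARD('n) / s^3) * (u y * laplacian (radial_bump 1 s) y))"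
        by (auto simp: fun_eq_iff)
      then show ?thesis
        using integral_cbox_mult_test(2)[OF u test_function_laplacian[OF t]] harm[OF t]
        by (simp only: integral_mult_right mult_zero_right)
    qed
    ultimately show ?thesis by metis
  qed
  have "?A \<tau> = ?A T"
  proof (rule DERIV_isconst_end[of T \<tau> ?A])
    show "T < \<tau>" using T False by simp
    have "continuous_on {T..} ?A"
      using D by (rule DERIV_continuous_on)
    then show "continuous_on {T..\<tau>} ?A" by (rule continuous_on_subset) auto
    show "DERIV ?A s :> 0" if "T < s" "s < \<tau>" for s
      using D[of s] that at_within_interior[of s "{T..}"] by (simp add: interior_real_atLeast)
  qed
  then show ?thesis using k(2)[of \<tau>] k(2)[of T] T(3) by simp
qed simp

text \<open>The kernels concentrate at 0 as \<tau> grows while the weighted mean stays the same. If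
  u 0 \<le> 0, continuity pushes this mean below every positive number; but a function positive
  almost everywhere has a positive mean.\<close>

lemma weakly_harmonic_pos_at_0:
  fixes u :: "real^'n \<Rightarrow> real"
  assumes u: "continuous_on (cbox a b) u" and zero: "0 \<in> box a b"
    and harm: "\<And>\<phi>. test_function (cbox a b) \<phi> \<Longrightarrow> (LINT x|lebesgue. u x * laplacian \<phi> x) = 0"
    and pos: "AE x in lebesgue. x \<in> cbox a b \<longrightarrow> u x > 0"
  shows "u 0 > 0"
proof (rule ccontr)
  assume "\<not> u 0 > 0"
  then have u0: "u 0 \<le> 0" by simp
  obtain R where R: "R > 0" "cball 0 R \<subseteq> cbox a b"
    using zero open_box[of a b] box_subset_cbox[of a b] open_contains_cball by (metis order_trans)
  define T where "T = 1 / R"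
  have T: "T > 0" "cball 0 (1 / T) \<subseteq> cbox a b" using R by (auto simp: T_def)
  define C where "C = (LINT y|lebesgue. mean_kernel 1 (y::real^'n))"
  define A where "A = (LINT x|lebesgue. u x * mean_kernel T x)"
  have sub: "cball 0 (1 / s) \<subseteq> cbox a b" if "s \<ge> T" for s
    using T that by (intro order_trans[OF subset_cball T(2)]) (simp add: field_simps)
  have int: "integrable lebesgue (\<lambda>y. u y * mean_kernel s y)" if "s \<ge> T" for s
    using T that by (intro integrable_loc_mult_test[OF continuous_on_loc_integrable[OF u]] test_function_mean_kernel sub) auto
  have C: "C \<ge> 0" unfolding C_def by (intro integral_nonneg_AE AE_I2 mean_kernel_nonneg) simp
  have le: "A \<le> e * C" if e: "e > 0" for e
  proof -
    have z: "0 \<in> cbox a b" using zero box_subset_cbox by blast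
    obtain d where d: "d > 0" "\<And>y. y \<in> cbox a b \<Longrightarrow> dist y 0 < d \<Longrightarrow> dist (u y) (u 0) < e"
      using u z e unfolding continuous_on_iff by metis
    \<comment> \<open>The maximum with 1 / d shrinks the support of the kernel into the ball where u
      stays below e.\<close>
    define s where "s = max T (1 / d)"
    have s: "s \<ge> T" "1 / s \<le> d" "s > 0"
    proof -
      show "s \<ge> T" by (simp add: s_def)
      then show "s > 0" using T by simp
      have "1 / d \<le> s" by (simp add: s_def)
      then show "1 / s \<le> d" using d(1) \<open>s > 0\<close> by (simp add: field_simps)
    qed
    have "A = (LINT x|lebesgue. u x * mean_kernel s x)"
      unfolding A_def using mean_kernel_integral_constant[OF u harm T s(1)] by simp
    also have "\<dots> \<le> (LINT x|lebesgue. e * mean_kernel s (x::real^'n))"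
    proof (rule Bochner_Integration.integral_mono)
      show "integrable lebesgue (\<lambda>x. u x * mean_kernel s x)" using s(1) by (rule int)
      show "integrable lebesgue (\<lambda>x::real^'n. e * mean_kernel s x)"
        by (intro integrable_mult_right integrable_test[OF test_function_mean_kernel[of s UNIV]] s(3)) simp
      show "u x * mean_kernel s x \<le> e * mean_kernel s x" for x
      proof (cases "x \<in> ball 0 (1 / s)")
        case True
        then have "x \<in> cbox a b" using sub[OF s(1)] ball_subset_cball by blast
        moreover have "dist x 0 < d" using True s(2) by (simp add: dist_commute)
        ultimately have "u x \<le> e" using d(2)[of x] u0 by (simp add: dist_real_def)
        then show ?thesis using mean_kernel_nonneg[OF s(3)] by (rule mult_right_mono)
      qed (simp add: mean_kernel_eq_0[OF s(3)])
    qed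
    also have "\<dots> = e * C" using integral_mean_kernel[OF s(3), where 'n = 'n] by (simp add: C_def)
    finally show ?thesis .
  qed
  have "A \<le> 0"
  proof (rule field_le_epsilon)
    fix e :: real assume e: "e > 0"
    \<comment> \<open>Dividing by C + 1 avoids having to know that the mass C is not 0.\<close>
    have "A \<le> e / (C + 1) * C" using e C by (intro le) simp
    also have "\<dots> \<le> e" using e C by (simp add: field_simps)
    finally show "A \<le> 0 + e" by simp
  qed
  have nn: "AE x in lebesgue. 0 \<le> u x * mean_kernel T x"
    using pos
  proof eventually_elim
    case (elim x)
    show ?case
    proof (cases "x \<in> ball 0 (1 / T)")
      case True
      then have "x \<in> cbox a b" using T ball_subset_cball by blast
      then show ?thesis using elim mean_kernel_nonneg[OF T(1), of x] by simp
    qed (simp add: mean_kernel_eq_0[OF T(1)])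
  qed
  have "A = 0"
    using \<open>A \<le> 0\<close> integral_nonneg_AE[OF nn] by (simp add: A_def)
  then have "AE x in lebesgue. u x * mean_kernel T x = 0"
    using integral_nonneg_eq_0_iff_AE[OF int[OF order_refl] nn] by (simp add: A_def)
  with pos have "AE x in lebesgue. x \<notin> ball (0::real^'n) (1 / T)"
  proof eventually_elim
    case (elim x)
    show ?case
    proof
      assume x: "x \<in> ball 0 (1 / T)"
      then have "x \<in> cbox a b" using T ball_subset_cball by blast
      then show False using elim mean_kernel_pos[OF T(1) x] by simp
    qed
  qed
  then have "ball (0::real^'n) (1 / T) \<in> null_sets lebesgue"
    by (simp add: completion.null_sets_iff_AE)
  then have "negligible (ball (0::real^'n) (1 / T))"
    by (simp add: negligible_iff_null_sets)
  moreover have "\<not> negligible (ball (0::real^'n) (1 / T))"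
    using T by (intro open_not_negligible) auto
  ultimately show False by blast
qed

section \<open>What minimality says about u: the value of \<open>M\<close> lies strictly below its
  maximum\<close>

section \<open>Minimizers\<close>

text \<open>The existence of the derivative of \<open>Phi0\<close> is part of the sign condition:
  for lam1 = 0 the first argument of \<Phi> is constantly 0, on the edge of the quadrant, where
  smoothness of \<Phi> in the open quadrant says nothing.\<close>

locale bernoulli_minimizer =
  fixes \<Omega> :: "(real^'n) set" and Q u ubar :: "real^'n \<Rightarrow> real"
    and \<Phi> :: "real \<times> real \<Rightarrow> real" and lam1 lam2 Q1 Q2 :: real
  assumes open_dom: "open \<Omega>" and bounded_dom: "bounded \<Omega>"
    and lam1: "lam1 \<ge> 0" and lam2: "lam2 > 0"
    and Q_meas: "set_borel_measurable lebesgue \<Omega> Q"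
    and Q1: "0 < Q1" and Q_bounds: "\<And>x. x \<in> \<Omega> \<Longrightarrow> Q1 \<le> Q x \<and> Q x \<le> Q2"
    and cont_Phi: "continuous_on ({0..} \<times> {0..}) \<Phi>"
    and min: "is_minimizer \<Omega> ubar (J \<Phi> lam1 lam2 Q \<Omega>) u"
    and Phi0_deriv: "\<And>r. 0 < r \<Longrightarrow> r < lam2 * total_Q \<Omega> Q \<Longrightarrow>
           (Phi0 \<Phi> lam1 lam2 Q \<Omega>) differentiable (at r) \<and> deriv (Phi0 \<Phi> lam1 lam2 Q \<Omega>) r \<ge> 0"
begin

abbreviation "\<Phi>0 \<equiv> Phi0 \<Phi> lam1 lam2 Q \<Omega>"
abbreviation "M \<equiv> M2 lam2 Q \<Omega>"

lemma u_W12: "u \<in> W12 \<Omega>"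
  using min by (auto simp: is_minimizer_def admissible_def)

lemma dom_fmeasurable: "\<Omega> \<in> lmeasurable"
  using bounded_dom open_dom by (rule lmeasurable_open)

lemma integrable_Q_indicator:
  assumes "A \<in> sets lebesgue"
  shows "integrable lebesgue (\<lambda>x. indicator \<Omega> x * (Q x * indicator A x))"
proof (rule Bochner_Integration.integrable_bound)
  show "integrable lebesgue (\<lambda>x. Q2 * indicator \<Omega> x :: real)"
    using dom_fmeasurable by (intro integrable_mult_right integrable_real_indicator) (auto simp: fmeasurable_def)
  have "(\<lambda>x. (indicator \<Omega> x *\<^sub>R Q x) * indicat_real A x) \<in> borel_measurable lebesgue"
    using Q_meas assms unfolding set_borel_measurable_def
    by (intro borel_measurable_times borel_measurable_indicator)
  then show "(\<lambda>x. indicator \<Omega> x * (Q x * indicator A x)) \<in> borel_measurable lebesgue"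
    by (simp add: mult.assoc)
  show "AE x in lebesgue. norm (indicator \<Omega> x * (Q x * indicator A x)) \<le> norm (Q2 * indicator \<Omega> x :: real)"
  proof (intro AE_I2)
    fix x
    show "norm (indicator \<Omega> x * (Q x * indicator A x)) \<le> norm (Q2 * indicator \<Omega> x :: real)"
      using Q_bounds[of x] Q1 by (auto simp: indicator_def)
  qed
qed

lemma M_eq: "M v = lam2 * (LINT x|lebesgue. indicator \<Omega> x * (Q x * indicator (pos_set \<Omega> v) x))"
  by (simp add: M2_def set_lebesgue_integral_def)

lemma total_Q_eq: "total_Q \<Omega> Q = (LINT x|lebesgue. indicator \<Omega> x * (Q x * indicator UNIV x))"
  by (simp add: total_Q_def set_lebesgue_integral_def)

lemma M_nonneg: "0 \<le> M v"
proof -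
  have "0 \<le> indicator \<Omega> x * (Q x * indicator (pos_set \<Omega> v) x)" for x
    using Q_bounds[of x] Q1 by (auto simp: indicator_def)
  then have "0 \<le> (LINT x|lebesgue. indicator \<Omega> x * (Q x * indicator (pos_set \<Omega> v) x))"
    by (intro integral_nonneg_AE AE_I2)
  then show ?thesis unfolding M_eq using lam2 by simp
qed

lemma M_le:
  assumes "v \<in> W12 \<Omega>"
  shows "M v \<le> lam2 * total_Q \<Omega> Q"
proof -
  have "(LINT x|lebesgue. indicator \<Omega> x * (Q x * indicator (pos_set \<Omega> v) x))
      \<le> (LINT x|lebesgue. indicator \<Omega> x * (Q x * indicator UNIV x))"
  proof (rule Bochner_Integration.integral_mono[OF integrable_Q_indicator integrable_Q_indicator])
    show "pos_set \<Omega> v \<in> sets lebesgue"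
      using pos_set_lebesgue W12D(1)[OF open_dom assms] by blast
    show "indicator \<Omega> x * (Q x * indicator (pos_set \<Omega> v) x) \<le> indicator \<Omega> x * (Q x * indicator UNIV x)" for x
      using Q_bounds[of x] Q1 by (auto simp: indicator_def)
  qed simp
  then show ?thesis unfolding M_eq total_Q_eq using lam2 by (intro mult_left_mono) auto
qed

lemma M_pos:
  assumes "measure lebesgue (pos_set \<Omega> u) > 0"
  shows "0 < M u"
proof -
  let ?P = "pos_set \<Omega> u"
  have P: "?P \<in> sets lebesgue" by (rule pos_set_lebesgue[OF W12D(1)[OF open_dom u_W12]])
  have "?P \<in> lmeasurable"
    by (rule fmeasurableI2[OF dom_fmeasurable _ P]) (auto simp: pos_set_def)
  then have "Q1 * measure lebesgue ?P = (LINT x|lebesgue. Q1 * indicator ?P x)" by simp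
  also have "\<dots> \<le> (LINT x|lebesgue. indicator \<Omega> x * (Q x * indicator ?P x))"
  proof (rule Bochner_Integration.integral_mono[OF _ integrable_Q_indicator[OF P]])
    show "integrable lebesgue (\<lambda>x. Q1 * indicator ?P x)"
      using \<open>?P \<in> lmeasurable\<close> by (intro integrable_mult_right integrable_real_indicator) (auto simp: fmeasurable_def)
    show "Q1 * indicator ?P x \<le> indicator \<Omega> x * (Q x * indicator ?P x)" for x
      using Q_bounds[of x] by (auto simp: indicator_def pos_set_def)
  qed
  finally show ?thesis
    unfolding M_eq using assms Q1 lam2 by (smt (verit) mult_pos_pos)
qed

text \<open>The difference of the two integrals is the integral of Q over the part of \<Omega> where
  u \<le> 0, and Q is bounded below by a positive constant, so this part is null.\<close>

lemma pos_AE_if_M_full: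
  assumes "M u = lam2 * total_Q \<Omega> Q"
  shows "AE x in lebesgue. x \<in> \<Omega> \<longrightarrow> u x > 0"
proof -
  let ?P = "pos_set \<Omega> u"
  have P: "?P \<in> sets lebesgue" by (rule pos_set_lebesgue[OF W12D(1)[OF open_dom u_W12]])
  note i = integrable_Q_indicator[OF P] integrable_Q_indicator[of UNIV]
  let ?f = "\<lambda>x. indicator \<Omega> x * (Q x * indicator UNIV x) - indicator \<Omega> x * (Q x * indicator ?P x)"
  have "integral\<^sup>L lebesgue ?f = 0"
    using assms lam2 i by (simp add: M_eq total_Q_eq)
  moreover have "AE x in lebesgue. 0 \<le> ?f x"
  proof (intro AE_I2)
    fix x show "0 \<le> ?f x" using Q_bounds[of x] Q1 by (auto simp: indicator_def)
  qed
  moreover have "integrable lebesgue ?f" using i by simp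
  ultimately have "AE x in lebesgue. ?f x = 0"
    using integral_nonneg_eq_0_iff_AE by blast
  then show ?thesis
  proof eventually_elim
    case (elim x)
    then show ?case using Q_bounds[of x] Q1 by (auto simp: indicator_def pos_set_def split: if_splits)
  qed
qed

text \<open>Derivatives are available only in the open interval. Continuity of \<Phi> up to the
  edges of the quadrant extends monotonicity to the endpoints; the right one is the value of
  interest when \<open>M u\<close> is maximal.\<close>

lemma Phi0_mono:
  assumes "0 \<le> a" "a \<le> b" "b \<le> lam2 * total_Q \<Omega> Q"
  shows "\<Phi>0 a \<le> \<Phi>0 b"
proof (cases "a = b")
  case False
  show ?thesis
  proof (rule DERIV_nonneg_imp_increasing_open[OF assms(2)])
    fix r assume "a < r" "r < b"
    then have "\<Phi>0 differentiable (at r) \<and> deriv \<Phi>0 r \<ge> 0"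
      using assms by (intro Phi0_deriv) auto
    then show "\<exists>y. DERIV \<Phi>0 r :> y \<and> 0 \<le> y"
      using DERIV_deriv_iff_real_differentiable by blast
  next
    show "continuous_on {a..b} \<Phi>0"
      unfolding Phi0_def[abs_def]
    proof (rule continuous_on_compose2[OF cont_Phi])
      show "(\<lambda>r. (lam1 * (total_Q \<Omega> Q - inverse lam2 * r), r)) ` {a..b} \<subseteq> {0..} \<times> {0..}"
      proof (rule image_subsetI)
        fix r assume "r \<in> {a..b}"
        then have r: "a \<le> r" "r \<le> b" by auto
        then have "inverse lam2 * r \<le> total_Q \<Omega> Q" using assms lam2 by (simp add: field_simps)
        then have "0 \<le> lam1 * (total_Q \<Omega> Q - inverse lam2 * r)"
          using lam1 by (intro mult_nonneg_nonneg) auto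
        moreover have "0 \<le> r" using r assms by linarith
        ultimately show "(lam1 * (total_Q \<Omega> Q - inverse lam2 * r), r) \<in> {0..} \<times> {0..}"
          by (simp only: mem_Sigma_iff atLeast_iff)
      qed
    qed (auto intro!: continuous_intros)
  qed
qed simp

lemma variation:
  assumes "test_function \<Omega> \<psi>"
  shows "0 \<le> - 2 * (LINT x|lebesgue. u x * laplacian \<psi> x) + (LINT x|lebesgue. (norm (gradient \<psi> x))\<^sup>2)
    + \<Phi>0 (M (\<lambda>x. u x + \<psi> x)) - \<Phi>0 (M u)"
proof -
  have "(\<lambda>x. u x + \<psi> x) \<in> admissible \<Omega> ubar"
    using min by (intro admissible_add_test[OF open_dom _ assms]) (auto simp: is_minimizer_def)
  then have "J \<Phi> lam1 lam2 Q \<Omega> u \<le> J \<Phi> lam1 lam2 Q \<Omega> (\<lambda>x. u x + \<psi> x)"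
    using min by (simp add: is_minimizer_def)
  then show ?thesis
    unfolding J_def dirichlet_add_test[OF open_dom u_W12 assms] by simp
qed

text \<open>From the maximal value of \<open>M\<close> a perturbation can only lower
  \<open>M\<close> and hence \<open>\<Phi>0\<close>, so u already minimizes the Dirichlet integral
  among these perturbations. For the multiples t \<psi> this reads 2 t L \<le> t^2 E with t of
  either sign, which forces L = 0.\<close>

lemma weakly_harmonic_if_M_full:
  assumes full: "M u = lam2 * total_Q \<Omega> Q" and \<psi>: "test_function \<Omega> \<psi>"
  shows "(LINT x|lebesgue. u x * laplacian \<psi> x) = 0"
proof -
  define L where "L = (LINT x|lebesgue. u x * laplacian \<psi> x)"
  define E where "E = (LINT x|lebesgue. (norm (gradient \<psi> x))\<^sup>2)"
  have E: "0 \<le> E" unfolding E_def by (intro integral_nonneg_AE AE_I2) simp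
  have *: "2 * t * L \<le> t\<^sup>2 * E" for t
  proof -
    have t: "test_function \<Omega> (\<lambda>x. t * \<psi> x)" by (rule test_function_cmult[OF \<psi>])
    have "(\<lambda>x. u x + t * \<psi> x) \<in> W12 \<Omega>"
      using W12_add[OF u_W12 test_function_W12[OF open_dom t]] .
    then have "\<Phi>0 (M (\<lambda>x. u x + t * \<psi> x)) \<le> \<Phi>0 (M u)"
      unfolding full by (intro Phi0_mono M_nonneg M_le order_refl)
    moreover have "(LINT x|lebesgue. u x * laplacian (\<lambda>x. t * \<psi> x) x) = t * L"
      using laplacian_cmult[OF \<psi>] by (simp add: L_def mult.left_commute)
    moreover have "(LINT x|lebesgue. (norm (gradient (\<lambda>x. t * \<psi> x) x))\<^sup>2) = t\<^sup>2 * E"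
      using gradient_cmult[OF \<psi>] by (simp add: E_def power_mult_distrib)
    ultimately show ?thesis using variation[OF t] by simp
  qed
  \<comment> \<open>The choice t = L / (E + 1) is close to the minimizer L / E of the quadratic but
    is meaningful also for E = 0. The factor (E + 1)^2 clears the denominators.\<close>
  have "2 * (L / (E + 1)) * L * (E + 1)\<^sup>2 \<le> (L / (E + 1))\<^sup>2 * E * (E + 1)\<^sup>2"
    by (intro mult_right_mono *) auto
  then have "2 * L\<^sup>2 * (E + 1) \<le> L\<^sup>2 * E"
    using E by (simp add: power2_eq_square)
  then have "L\<^sup>2 * (E + 2) \<le> 0" by (simp add: algebra_simps)
  then have "L\<^sup>2 \<le> 0" using E by (simp add: mult_le_0_iff)
  then show ?thesis by (simp add: L_def)
qed

lemma M_less: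
  assumes cont: "continuous_on (ball 0 R) u" and R: "R > 0" and zero: "0 \<in> \<Omega>" "u 0 \<le> 0"
  shows "M u < lam2 * total_Q \<Omega> Q"
proof (rule ccontr)
  assume "\<not> M u < lam2 * total_Q \<Omega> Q"
  then have full: "M u = lam2 * total_Q \<Omega> Q" using M_le[OF u_W12] by simp
  have "open (ball 0 R \<inter> \<Omega>)" "0 \<in> ball 0 R \<inter> \<Omega>" using open_dom R zero by auto
  then obtain a b where ab: "cbox a b \<subseteq> ball 0 R \<inter> \<Omega>" "0 \<in> box a b"
    using open_contains_cbox by metis
  have "u 0 > 0"
  proof (rule weakly_harmonic_pos_at_0[OF _ ab(2)])
    show "continuous_on (cbox a b) u" using cont ab(1) by (auto intro: continuous_on_subset)
    show "(LINT x|lebesgue. u x * laplacian \<phi> x) = 0" if "test_function (cbox a b) \<phi>" for \<phi>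
      using ab(1) by (intro weakly_harmonic_if_M_full[OF full] test_function_mono[OF that]) auto
    show "AE x in lebesgue. x \<in> cbox a b \<longrightarrow> u x > 0"
      using pos_AE_if_M_full[OF full] ab(1) by (auto elim!: eventually_mono)
  qed
  then show False using zero by simp
qed

end

section \<open>Passage to the limit along the rescalings\<close>

section \<open>Variation of the blow-up limit\<close>

context bernoulli_minimizer
begin

text \<open>At the point \<rho> x the perturbed function is \<rho> times
  \<open>rescale \<rho> u\<close> + \<phi>, so the signs agree, and outside \<open>ball 0 r\<close>
  the perturbation vanishes and the two indicators cancel. Substituting \<rho> x therefore brings
  the whole change of \<open>M\<close> to unit scale.\<close>

lemma M_scale_test_diff:
  assumes \<rho>: "\<rho> > 0" and sub: "(*\<^sub>R) \<rho> ` ball 0 r \<subseteq> \<Omega>" and \<phi>: "test_function (ball 0 r) \<phi>"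
  defines "m \<equiv> \<lambda>x. indicat_real (ball 0 r) x * (Q (\<rho> *\<^sub>R x) *
      (indicat_real {x. rescale \<rho> u x + \<phi> x > 0} x - indicat_real {x. rescale \<rho> u x > 0} x))"
  shows "m \<in> borel_measurable lebesgue"
    and "M (\<lambda>x. u x + scale_test \<rho> \<phi> x) - M u = lam2 * (\<rho> ^ CARD('n) * (LINT x|lebesgue. m x))"
proof -
  let ?\<psi> = "scale_test \<rho> \<phi>"
  have \<psi>: "test_function \<Omega> ?\<psi>"
    using test_function_mono[OF test_function_scale_test[OF \<rho> \<phi>] sub] .
  let ?P = "pos_set \<Omega> u" and ?P' = "pos_set \<Omega> (\<lambda>x. u x + ?\<psi> x)"
  have P: "?P \<in> sets lebesgue" by (rule pos_set_lebesgue[OF W12D(1)[OF open_dom u_W12]])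
  have P': "?P' \<in> sets lebesgue"
    by (rule pos_set_lebesgue[OF W12D(1)[OF open_dom W12_add[OF u_W12 test_function_W12[OF open_dom \<psi>]]]])
  let ?f = "\<lambda>x. indicator \<Omega> x * (Q x * indicator ?P' x) - indicator \<Omega> x * (Q x * indicator ?P x)"
  note i = integrable_Q_indicator[OF P] integrable_Q_indicator[OF P']
  have f: "?f \<in> borel_measurable lebesgue" using i by (intro borel_measurable_diff) auto
  obtain K where K: "K \<subseteq> ball 0 r" "\<And>x. x \<notin> K \<Longrightarrow> \<phi> x = 0"
    by (rule test_functionE[OF \<phi>]) (rule that)
  have eq: "m = (\<lambda>x. ?f (\<rho> *\<^sub>R x))"
  proof
    fix x
    have u: "u (\<rho> *\<^sub>R x) > 0 \<longleftrightarrow> rescale \<rho> u x > 0"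
      using \<rho> by (simp add: rescale_def zero_less_divide_iff)
    have s: "?\<psi> (\<rho> *\<^sub>R x) = \<rho> * \<phi> x" using \<rho> by (simp add: scale_test_def)
    have "u (\<rho> *\<^sub>R x) + ?\<psi> (\<rho> *\<^sub>R x) = \<rho> * (rescale \<rho> u x + \<phi> x)"
      using \<rho> by (simp add: s rescale_def field_simps)
    then have up: "u (\<rho> *\<^sub>R x) + ?\<psi> (\<rho> *\<^sub>R x) > 0 \<longleftrightarrow> rescale \<rho> u x + \<phi> x > 0"
      using \<rho> by (simp add: zero_less_mult_iff)
    show "m x = ?f (\<rho> *\<^sub>R x)"
    proof (cases "x \<in> ball 0 r")
      case True
      then have "\<rho> *\<^sub>R x \<in> \<Omega>" using sub by blast
      then show ?thesis
        using True u up by (auto simp: m_def indicator_def pos_set_def)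
    next
      case False
      then have "\<phi> x = 0" using K by blast
      then show ?thesis using False s by (simp add: m_def indicator_def pos_set_def)
    qed
  qed
  show "m \<in> borel_measurable lebesgue"
    unfolding eq by (rule measurable_compose[OF lebesgue_measurable_scaling f])
  have "(LINT x|lebesgue. m x) = (LINT x|lebesgue. ?f x) / \<rho> ^ CARD('n)"
    unfolding eq by (rule integral_scale_lebesgue[OF f \<rho>])
  moreover have "M (\<lambda>x. u x + ?\<psi> x) - M u = lam2 * (LINT x|lebesgue. ?f x)"
    using i by (simp add: M_eq right_diff_distrib)
  ultimately show "M (\<lambda>x. u x + ?\<psi> x) - M u = lam2 * (\<rho> ^ CARD('n) * (LINT x|lebesgue. m x))"
    using \<rho> by simp
qed

text \<open>Freezing Q at 0 costs at most \<epsilon> per unit volume, since the indicators differ by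
  at most 1. In the upper bound only the perturbed positivity set is enlarged, to a superlevel set
  of u0 + \<phi>; the other one carries a minus sign and is kept as it is.\<close>

lemma Q_jump_integral_bounds:
  fixes r :: real
  assumes \<rho>: "\<rho> > 0" and sub: "(*\<^sub>R) \<rho> ` ball 0 r \<subseteq> \<Omega>" and \<phi>: "test_function (ball 0 r) \<phi>"
    and cont: "continuous_on (ball 0 r) (rescale \<rho> u)" and u0: "continuous_on UNIV u0"
    and close: "\<And>x. x \<in> ball 0 r \<Longrightarrow> \<bar>rescale \<rho> u x - u0 x\<bar> \<le> \<delta>"
    and Q0: "Q 0 \<ge> 0" "\<And>x. x \<in> ball 0 r \<Longrightarrow> \<bar>Q (\<rho> *\<^sub>R x) - Q 0\<bar> \<le> \<epsilon>"
  defines "m \<equiv> LINT x|lebesgue. indicat_real (ball 0 r) x * (Q (\<rho> *\<^sub>R x) *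
      (indicat_real {x. rescale \<rho> u x + \<phi> x > 0} x - indicat_real {x. rescale \<rho> u x > 0} x))"
  shows "\<bar>m\<bar> \<le> Q2 * measure lebesgue (ball (0::real^'n) r)"
    and "m \<le> Q 0 * (measure lebesgue {x \<in> ball 0 r. u0 x + \<phi> x > - \<delta>}
        - measure lebesgue {x \<in> ball 0 r. rescale \<rho> u x > 0}) + \<epsilon> * measure lebesgue (ball (0::real^'n) r)"
proof -
  let ?B = "ball (0::real^'n) r"
  let ?m = "\<lambda>x. indicat_real (ball 0 r) x * (Q (\<rho> *\<^sub>R x) *
      (indicat_real {x. rescale \<rho> u x + \<phi> x > 0} x - indicat_real {x. rescale \<rho> u x > 0} x))"
  have iB: "integrable lebesgue (\<lambda>x. c * indicat_real ?B x)" for c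
    using lmeasurable_ball[of 0 r] unfolding lmeasurable_iff_integrable by (rule integrable_mult_right)
  have Q2: "\<bar>Q (\<rho> *\<^sub>R x)\<bar> \<le> Q2" if "x \<in> ?B" for x
    using Q_bounds[of "\<rho> *\<^sub>R x"] Q1 sub that by (force simp: image_subset_iff)
  have ptw: "\<bar>?m x\<bar> \<le> Q2 * indicat_real ?B x" for x
    using Q2[of x] by (auto simp: indicator_def)
  have im: "integrable lebesgue ?m"
    using ptw by (intro Bochner_Integration.integrable_bound[OF iB[of Q2] M_scale_test_diff(1)[OF \<rho> sub \<phi>]] AE_I2)
      (auto intro: order_trans[OF _ abs_ge_self])
  have "\<bar>m\<bar> \<le> (LINT x|lebesgue. \<bar>?m x\<bar>)"
    unfolding m_def by (rule integral_abs_bound)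
  also have "\<dots> \<le> (LINT x|lebesgue. Q2 * indicat_real ?B x)"
    using im iB ptw by (intro Bochner_Integration.integral_mono) auto
  also have "\<dots> = Q2 * measure lebesgue ?B" by simp
  finally show "\<bar>m\<bar> \<le> Q2 * measure lebesgue ?B" .
  let ?A = "{x \<in> ball 0 r. u0 x + \<phi> x > - \<delta>}" and ?P = "{x \<in> ball 0 r. rescale \<rho> u x > 0}"
  have A: "?A \<in> lmeasurable"
    using u0 test_function_continuous[OF \<phi>]
    by (intro open_superlevel continuous_on_add) (auto intro: continuous_on_subset)
  have P: "?P \<in> lmeasurable" by (rule open_superlevel[OF cont])
  have iAP: "integrable lebesgue (indicat_real ?A)" "integrable lebesgue (indicat_real ?P)"
    using A P unfolding lmeasurable_iff_integrable .
  have iA: "integrable lebesgue (\<lambda>x. Q 0 * (indicat_real ?A x - indicat_real ?P x) + \<epsilon> * indicat_real ?B x)"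
    by (rule Bochner_Integration.integrable_add[OF
        integrable_mult_right[OF Bochner_Integration.integrable_diff[OF iAP]] iB])
  have "m \<le> (LINT x|lebesgue. Q 0 * (indicat_real ?A x - indicat_real ?P x) + \<epsilon> * indicat_real ?B x)"
    unfolding m_def
  proof (rule Bochner_Integration.integral_mono[OF im iA])
    fix x
    show "?m x \<le> Q 0 * (indicat_real ?A x - indicat_real ?P x) + \<epsilon> * indicat_real ?B x"
    proof (cases "x \<in> ?B")
      case True
      define a b where "a = indicat_real {x. rescale \<rho> u x + \<phi> x > 0} x" and "b = indicat_real {x. rescale \<rho> u x > 0} x"
      have b: "b = indicat_real ?P x" using True by (simp add: b_def indicator_def)
      have a: "a \<le> indicat_real ?A x" using True close[OF True] by (auto simp: a_def indicator_def)
      have ab: "\<bar>a - b\<bar> \<le> 1" by (auto simp: a_def b_def indicator_def)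
      have "(Q (\<rho> *\<^sub>R x) - Q 0) * (a - b) \<le> \<bar>Q (\<rho> *\<^sub>R x) - Q 0\<bar> * \<bar>a - b\<bar>"
        by (metis abs_ge_self abs_mult)
      also have "\<dots> \<le> \<epsilon> * 1"
        using Q0(2)[OF True] ab by (intro mult_mono) auto
      finally have "Q (\<rho> *\<^sub>R x) * (a - b) \<le> Q 0 * (a - b) + \<epsilon>" by (simp add: algebra_simps)
      moreover have "Q 0 * (a - b) \<le> Q 0 * (indicat_real ?A x - indicat_real ?P x)"
        using Q0(1) a b by (intro mult_left_mono) auto
      ultimately show ?thesis using True by (simp add: a_def b_def)
    qed (auto simp: indicator_def)
  qed
  also have "\<dots> = Q 0 * (measure lebesgue ?A - measure lebesgue ?P) + \<epsilon> * measure lebesgue ?B"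
    using iAP iB[of \<epsilon>] A P by simp
  finally show "m \<le> Q 0 * (measure lebesgue ?A - measure lebesgue ?P) + \<epsilon> * measure lebesgue ?B" .
qed

lemma blowup_variation:
  fixes \<rho> :: "nat \<Rightarrow> real" and u0 \<phi> :: "real^'n \<Rightarrow> real" and D r \<delta> :: real
  assumes rho: "\<And>k. \<rho> k > 0" "\<rho> \<longlonglongrightarrow> 0"
    and unif: "\<And>R \<epsilon>. R > 0 \<Longrightarrow> \<epsilon> > 0 \<Longrightarrow> \<forall>\<^sub>F k in sequentially. \<forall>x\<in>cball 0 R. \<bar>rescale (\<rho> k) u x - u0 x\<bar> \<le> \<epsilon>"
    and contk: "\<And>R. R > 0 \<Longrightarrow> \<forall>\<^sub>F k in sequentially. continuous_on (cball 0 R) (rescale (\<rho> k) u)"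
    and u0: "continuous_on UNIV u0"
    and ind: "indicator_conv_L1_loc (\<lambda>k. pos_set (scaled_domain (\<rho> k) \<Omega>) (rescale (\<rho> k) u)) (pos_set UNIV u0)"
    and zero: "0 \<in> \<Omega>" and Q0: "continuous (at 0 within \<Omega>) Q"
    and D: "(\<Phi>0 has_real_derivative D) (at (M u))" "D \<ge> 0"
    and r: "r > 0" and \<phi>: "test_function (ball 0 r) \<phi>" and \<delta>: "\<delta> > 0"
  shows "0 \<le> - 2 * (LINT x|lebesgue. u0 x * laplacian \<phi> x) + (LINT x|lebesgue. (norm (gradient \<phi> x))\<^sup>2)
    + lam2 * Q 0 * D * (measure lebesgue {x \<in> ball 0 r. u0 x + \<phi> x > - \<delta>} - measure lebesgue (pos_set (ball 0 r) u0))"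
proof -
  let ?n = "CARD('n)" and ?B = "ball (0::real^'n) r"
  define vol where "vol = measure lebesgue ?B"
  define E where "E = (LINT x|lebesgue. (norm (gradient \<phi> x))\<^sup>2)"
  define L where "L = (LINT x|lebesgue. u0 x * laplacian \<phi> x)"
  define Lk where "Lk k = (LINT x|lebesgue. rescale (\<rho> k) u x * laplacian \<phi> x)" for k
  define m where "m k = (LINT x|lebesgue. indicat_real ?B x * (Q (\<rho> k *\<^sub>R x) *
      (indicat_real {x. rescale (\<rho> k) u x + \<phi> x > 0} x - indicat_real {x. rescale (\<rho> k) u x > 0} x)))" for k
  define A where "A = measure lebesgue {x \<in> ?B. u0 x + \<phi> x > - \<delta>}"
  define p where "p = measure lebesgue (pos_set ?B u0)"
  define pk where "pk k = measure lebesgue {x \<in> ?B. rescale (\<rho> k) u x > 0}" for k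
  define z where "z k = M (\<lambda>x. u x + scale_test (\<rho> k) \<phi> x)" for k
  \<comment> \<open>Caratheodory's form of the derivative: the slope g is defined also at
    \<open>M u\<close> itself, so the increment of \<open>\<Phi>0\<close> is a product even if the
    perturbation leaves \<open>M\<close> unchanged.\<close>
  obtain g where g: "\<And>z. \<Phi>0 z - \<Phi>0 (M u) = g z * (z - M u)" "isCont g (M u)" "g (M u) = D"
    using D(1) unfolding CARAT_DERIV by blast
  have Qpos: "Q 0 > 0" using Q_bounds[OF zero] Q1 by simp
  have Q2: "Q2 > 0" using Q_bounds[OF zero] Q1 by simp
  have vol: "vol \<ge> 0" by (simp add: vol_def)
  have lap: "test_function ?B (laplacian \<phi>)" by (rule test_function_laplacian[OF \<phi>])
  have u0B: "continuous_on ?B u0" using u0 continuous_on_subset by blast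
  have sub: "\<forall>\<^sub>F k in sequentially. (*\<^sub>R) (\<rho> k) ` ?B \<subseteq> ball 0 d" if "d > 0" for d
  proof -
    have "\<forall>\<^sub>F k in sequentially. \<rho> k < d / r"
      using rho(2) that r by (intro order_tendstoD(2)[where y = 0]) auto
    then show ?thesis
    proof eventually_elim
      case (elim k)
      have "norm (\<rho> k *\<^sub>R x) < d" if "norm x < r" for x :: "real^'n"
      proof -
        have "\<rho> k * norm x < \<rho> k * r" using rho(1)[of k] that by simp
        also have "\<dots> < d" using elim r by (simp add: field_simps)
        finally show ?thesis using rho(1)[of k] by simp
      qed
      then show ?case by (auto simp: dist_norm)
    qed
  qed
  obtain d where d: "d > 0" "ball 0 d \<subseteq> \<Omega>" using open_dom zero open_contains_ball by blast
  have subO: "\<forall>\<^sub>F k in sequentially. (*\<^sub>R) (\<rho> k) ` ?B \<subseteq> \<Omega>"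
    using sub[OF d(1)] by eventually_elim (use d(2) in blast)
  have Qk: "\<forall>\<^sub>F k in sequentially. \<forall>x\<in>?B. \<bar>Q (\<rho> k *\<^sub>R x) - Q 0\<bar> \<le> \<epsilon>" if \<epsilon>: "\<epsilon> > 0" for \<epsilon>
  proof -
    obtain e where e: "e > 0" "\<And>x. x \<in> \<Omega> \<Longrightarrow> dist x 0 < e \<Longrightarrow> dist (Q x) (Q 0) < \<epsilon>"
      using Q0 \<epsilon> unfolding continuous_within_eps_delta by blast
    show ?thesis using sub[OF e(1)] subO
    proof eventually_elim
      case (elim k)
      show ?case
      proof
        fix x assume "x \<in> ?B"
        then have "\<rho> k *\<^sub>R x \<in> \<Omega>" "\<rho> k *\<^sub>R x \<in> ball 0 e" using elim by blast+
        then have "dist (Q (\<rho> k *\<^sub>R x)) (Q 0) < \<epsilon>" by (intro e(2)) (auto simp: dist_commute)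
        then show "\<bar>Q (\<rho> k *\<^sub>R x) - Q 0\<bar> \<le> \<epsilon>" by (simp add: dist_real_def)
      qed
    qed
  qed
  have contB: "\<forall>\<^sub>F k in sequentially. continuous_on ?B (rescale (\<rho> k) u)"
    using contk[OF r] by eventually_elim (rule continuous_on_subset[OF _ ball_subset_cball])
  have closeB: "\<forall>\<^sub>F k in sequentially. \<forall>x\<in>?B. \<bar>rescale (\<rho> k) u x - u0 x\<bar> \<le> \<epsilon>" if "\<epsilon> > 0" for \<epsilon>
    using unif[OF r that] by eventually_elim auto
  have Llim: "Lk \<longlonglongrightarrow> L"
  proof (rule LIMSEQ_I)
    fix e :: real assume e: "e > 0"
    define C where "C = (LINT x|lebesgue. \<bar>laplacian \<phi> x\<bar>)"
    have C: "C \<ge> 0" unfolding C_def by (intro integral_nonneg_AE AE_I2) simp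
    define \<epsilon> where "\<epsilon> = e / (C + 1)"
    have \<epsilon>: "\<epsilon> > 0" using e C by (simp add: \<epsilon>_def)
    have "\<forall>\<^sub>F k in sequentially. norm (Lk k - L) < e"
      using contB closeB[OF \<epsilon>]
    proof eventually_elim
      case (elim k)
      have i: "integrable lebesgue (\<lambda>x. rescale (\<rho> k) u x * laplacian \<phi> x)" "integrable lebesgue (\<lambda>x. u0 x * laplacian \<phi> x)"
        using integrable_loc_mult_test[OF continuous_on_loc_integrable lap] elim(1) u0B by blast+
      have "\<bar>Lk k - L\<bar> = \<bar>LINT x|lebesgue. (rescale (\<rho> k) u x - u0 x) * laplacian \<phi> x\<bar>"
        using i by (simp add: Lk_def L_def left_diff_distrib)
      also have "\<dots> \<le> (LINT x|lebesgue. \<bar>(rescale (\<rho> k) u x - u0 x) * laplacian \<phi> x\<bar>)"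
        by (rule integral_abs_bound)
      also have "\<dots> \<le> (LINT x|lebesgue. \<epsilon> * \<bar>laplacian \<phi> x\<bar>)"
      proof (rule Bochner_Integration.integral_mono)
        show "integrable lebesgue (\<lambda>x. \<bar>(rescale (\<rho> k) u x - u0 x) * laplacian \<phi> x\<bar>)"
          using Bochner_Integration.integrable_diff[OF i] by (intro integrable_abs) (simp add: left_diff_distrib)
        show "integrable lebesgue (\<lambda>x. \<epsilon> * \<bar>laplacian \<phi> x\<bar>)"
          using integrable_test[OF lap] by simp
        show "\<bar>(rescale (\<rho> k) u x - u0 x) * laplacian \<phi> x\<bar> \<le> \<epsilon> * \<bar>laplacian \<phi> x\<bar>" for x
        proof (cases "x \<in> ?B")
          case True
          then show ?thesis using elim(2) by (simp add: abs_mult mult_right_mono)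
        next
          case False
          obtain K where "K \<subseteq> ?B" "\<And>x. x \<notin> K \<Longrightarrow> laplacian \<phi> x = 0"
            by (rule test_functionE[OF lap]) (rule that)
          then have "laplacian \<phi> x = 0" using False by blast
          then show ?thesis by simp
        qed
      qed
      also have "\<dots> = \<epsilon> * C" by (simp add: C_def)
      also have "\<dots> < e" using e C by (simp add: \<epsilon>_def field_simps)
      finally show ?case by simp
    qed
    then show "\<exists>no. \<forall>k\<ge>no. norm (Lk k - L) < e" by (simp add: eventually_sequentially)
  qed
  have plim: "pk \<longlonglongrightarrow> p"
  proof -
    let ?Ak = "\<lambda>k. pos_set (scaled_domain (\<rho> k) \<Omega>) (rescale (\<rho> k) u)"
    let ?i = "\<lambda>k. LINT x:?B|lebesgue. \<bar>indicat_real (?Ak k) x - indicat_real (pos_set UNIV u0) x\<bar>"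
    have lim: "?i \<longlonglongrightarrow> 0" using ind r unfolding indicator_conv_L1_loc_def by blast
    have "\<forall>\<^sub>F k in sequentially. norm (pk k - p) \<le> ?i k"
      using contB subO
    proof eventually_elim
      case (elim k)
      let ?P = "{x \<in> ?B. rescale (\<rho> k) u x > 0}" and ?Pz = "pos_set ?B u0"
      have P: "?P \<in> lmeasurable" by (rule open_superlevel[OF elim(1)])
      have P0: "?Pz \<in> lmeasurable" using open_superlevel[OF u0B, of 0] unfolding pos_set_def .
      have i: "integrable lebesgue (indicat_real ?P)" "integrable lebesgue (indicat_real ?Pz)"
        using P P0 unfolding lmeasurable_iff_integrable .
      have "norm (pk k - p) = \<bar>LINT x|lebesgue. indicat_real ?P x - indicat_real ?Pz x\<bar>"
        unfolding pk_def p_def Bochner_Integration.integral_diff[OF i] by simp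
      also have "\<dots> \<le> (LINT x|lebesgue. \<bar>indicat_real ?P x - indicat_real ?Pz x\<bar>)"
        by (rule integral_abs_bound)
      also have "\<dots> = ?i k"
        unfolding set_lebesgue_integral_def
      proof (intro Bochner_Integration.integral_cong refl)
        fix x
        show "\<bar>indicat_real ?P x - indicat_real ?Pz x\<bar>
            = indicator ?B x *\<^sub>R \<bar>indicat_real (?Ak k) x - indicat_real (pos_set UNIV u0) x\<bar>"
        proof (cases "x \<in> ?B")
          case True
          then have "\<rho> k *\<^sub>R x \<in> \<Omega>" using elim(2) by blast
          then have "x \<in> ?Ak k \<longleftrightarrow> x \<in> ?P" "x \<in> pos_set UNIV u0 \<longleftrightarrow> x \<in> ?Pz"
            using True by (auto simp: pos_set_def scaled_domain_def)
          then show ?thesis using True by (simp only: indicator_def) simp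
        next
          case False
          then show ?thesis by (simp add: indicator_def pos_set_def)
        qed
      qed
      finally show ?case .
    qed
    then have "(\<lambda>k. pk k - p) \<longlonglongrightarrow> 0" using lim by (rule Lim_null_comparison)
    then show ?thesis by (rule LIM_zero_cancel)
  qed
  \<comment> \<open>The bound on \<open>m k\<close> does not involve the oscillation of Q, so the
    tolerance 1 serves.\<close>
  have mb: "\<forall>\<^sub>F k in sequentially. \<bar>m k\<bar> \<le> Q2 * vol"
    using contB subO closeB[OF \<delta>] Qk[of 1, OF zero_less_one]
  proof eventually_elim
    case (elim k)
    show ?case unfolding m_def vol_def
      by (rule Q_jump_integral_bounds(1)[OF rho(1) elim(2) \<phi> elim(1) u0, of \<delta> 1]) (use elim Qpos in auto)
  qed
  have zlim: "z \<longlonglongrightarrow> M u"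
  proof -
    have "\<forall>\<^sub>F k in sequentially. norm (z k - M u) \<le> lam2 * (\<rho> k ^ ?n * (Q2 * vol))"
      using mb subO
    proof eventually_elim
      case (elim k)
      have "z k - M u = lam2 * (\<rho> k ^ ?n * m k)"
        unfolding z_def m_def by (rule M_scale_test_diff(2)[OF rho(1) elim(2) \<phi>])
      then have "norm (z k - M u) = lam2 * (\<rho> k ^ ?n * \<bar>m k\<bar>)"
        using lam2 rho(1)[of k] by (simp add: abs_mult)
      also have "\<dots> \<le> lam2 * (\<rho> k ^ ?n * (Q2 * vol))"
        using elim lam2 rho(1)[of k] by (intro mult_left_mono) auto
      finally show ?case .
    qed
    moreover have "(\<lambda>k. lam2 * (\<rho> k ^ ?n * (Q2 * vol))) \<longlonglongrightarrow> lam2 * (0 ^ ?n * (Q2 * vol))"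
      by (intro tendsto_intros rho(2))
    \<comment> \<open>The power of 0 vanishes because the dimension is at least 1.\<close>
    then have "(\<lambda>k. lam2 * (\<rho> k ^ ?n * (Q2 * vol))) \<longlonglongrightarrow> 0"
      by (simp add: zero_power)
    ultimately have "(\<lambda>k. z k - M u) \<longlonglongrightarrow> 0"
      by (rule Lim_null_comparison)
    then show ?thesis by (rule LIM_zero_cancel)
  qed
  have glim: "(\<lambda>k. \<bar>g (z k) - D\<bar>) \<longlonglongrightarrow> 0"
  proof -
    have "(\<lambda>k. g (z k)) \<longlonglongrightarrow> D"
      using isCont_tendsto_compose[OF g(2) zlim] g(3) by simp
    then have "(\<lambda>k. \<bar>g (z k) - D\<bar>) \<longlonglongrightarrow> \<bar>D - D\<bar>" by (intro tendsto_intros)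
    then show ?thesis by simp
  qed
  \<comment> \<open>The slope \<open>g (z k)\<close> need not be nonnegative, so the upper bound on
    \<open>m k\<close> cannot be multiplied by it. It is split into D, which is nonnegative, and
    \<open>g (z k) - D\<close>, which tends to 0 and is paired with the two-sided bound on
    \<open>m k\<close>.\<close>
  have main: "0 \<le> - 2 * L + E + lam2 * (D * (Q 0 * (A - p) + \<epsilon> * vol))" if \<epsilon>: "\<epsilon> > 0" for \<epsilon>
  proof (rule tendsto_lowerbound)
    have "(\<lambda>k. - 2 * Lk k + E + lam2 * (D * (Q 0 * (A - pk k) + \<epsilon> * vol) + \<bar>g (z k) - D\<bar> * (Q2 * vol)))
        \<longlonglongrightarrow> - 2 * L + E + lam2 * (D * (Q 0 * (A - p) + \<epsilon> * vol) + 0 * (Q2 * vol))"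
      by (intro tendsto_intros Llim plim glim)
    then show "(\<lambda>k. - 2 * Lk k + E + lam2 * (D * (Q 0 * (A - pk k) + \<epsilon> * vol) + \<bar>g (z k) - D\<bar> * (Q2 * vol)))
        \<longlonglongrightarrow> - 2 * L + E + lam2 * (D * (Q 0 * (A - p) + \<epsilon> * vol))" by simp
    show "\<forall>\<^sub>F k in sequentially. 0 \<le> - 2 * Lk k + E + lam2 * (D * (Q 0 * (A - pk k) + \<epsilon> * vol) + \<bar>g (z k) - D\<bar> * (Q2 * vol))"
      using contB subO closeB[OF \<delta>] Qk[OF \<epsilon>] mb
    proof eventually_elim
      case (elim k)
      let ?\<psi> = "scale_test (\<rho> k) \<phi>"
      have pos: "\<rho> k ^ ?n > 0" using rho(1)[of k] by simp
      have \<psi>: "test_function \<Omega> ?\<psi>"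
        using test_function_mono[OF test_function_scale_test[OF rho(1) \<phi>] elim(2)] .
      have loc: "loc_integrable ((*\<^sub>R) (\<rho> k) ` ?B) u"
        by (rule loc_integrable_mono[OF _ elim(2)])
          (use W12D(2)[OF open_dom u_W12] in \<open>simp add: has_weak_gradient_iff\<close>)
      have zk: "z k - M u = lam2 * (\<rho> k ^ ?n * m k)"
        unfolding z_def m_def by (rule M_scale_test_diff(2)[OF rho(1) elim(2) \<phi>])
      have "0 \<le> - 2 * (\<rho> k ^ ?n * Lk k) + \<rho> k ^ ?n * E + (\<Phi>0 (z k) - \<Phi>0 (M u))"
        using variation[OF \<psi>] integral_gradient_scale_test[OF rho(1) \<phi>] integral_laplacian_scale_test[OF rho(1) \<phi> loc]
        by (simp add: Lk_def E_def z_def)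
      also have "\<dots> = \<rho> k ^ ?n * (- 2 * Lk k + E + lam2 * (g (z k) * m k))"
        unfolding g(1) zk by (simp add: algebra_simps)
      finally have v: "0 \<le> - 2 * Lk k + E + lam2 * (g (z k) * m k)"
        using pos by (simp add: zero_le_mult_iff)
      have "m k \<le> Q 0 * (A - pk k) + \<epsilon> * vol"
        unfolding m_def vol_def A_def pk_def
        by (rule Q_jump_integral_bounds(2)[OF rho(1) elim(2) \<phi> elim(1) u0, of \<delta> \<epsilon>]) (use elim Qpos in auto)
      then have "D * m k \<le> D * (Q 0 * (A - pk k) + \<epsilon> * vol)" using D(2) by (rule mult_left_mono)
      moreover have "(g (z k) - D) * m k \<le> \<bar>g (z k) - D\<bar> * (Q2 * vol)"
      proof -
        have "(g (z k) - D) * m k \<le> \<bar>g (z k) - D\<bar> * \<bar>m k\<bar>" by (metis abs_ge_self abs_mult)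
        also have "\<dots> \<le> \<bar>g (z k) - D\<bar> * (Q2 * vol)" using elim(5) by (intro mult_left_mono) auto
        finally show ?thesis .
      qed
      ultimately have "g (z k) * m k \<le> D * (Q 0 * (A - pk k) + \<epsilon> * vol) + \<bar>g (z k) - D\<bar> * (Q2 * vol)"
        by (simp add: algebra_simps)
      then have "lam2 * (g (z k) * m k) \<le> lam2 * (D * (Q 0 * (A - pk k) + \<epsilon> * vol) + \<bar>g (z k) - D\<bar> * (Q2 * vol))"
        using lam2 by (intro mult_left_mono) auto
      then show ?case using v by linarith
    qed
  qed simp
  have "0 \<le> - 2 * L + E + lam2 * (D * (Q 0 * (A - p)))"
  proof (rule field_le_epsilon)
    fix e :: real assume e: "e > 0"
    define c where "c = lam2 * D * vol"
    have c: "c \<ge> 0" using lam2 D(2) vol by (simp add: c_def)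
    have "0 \<le> - 2 * L + E + lam2 * (D * (Q 0 * (A - p) + e / (c + 1) * vol))"
      using e c by (intro main) simp
    also have "\<dots> = - 2 * L + E + lam2 * (D * (Q 0 * (A - p))) + e / (c + 1) * c"
      by (simp add: c_def algebra_simps)
    also have "\<dots> \<le> - 2 * L + E + lam2 * (D * (Q 0 * (A - p))) + e"
      using e c by (simp add: field_simps)
    finally show "0 \<le> - 2 * L + E + lam2 * (D * (Q 0 * (A - p))) + e" .
  qed
  then show ?thesis by (simp add: L_def E_def A_def p_def mult.assoc mult.left_commute)
qed

end

section \<open>From variations by test functions to arbitrary Sobolev competitors\<close>

section \<open>Minimality of the blow-up limit\<close>

text \<open>Young's inequality with a weight: the factor of |x|^2 can be brought as close to 1 as
  desired, at the cost of a large factor on the error |y|^2.\<close>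

lemma norm_diff_sq_le:
  fixes x y :: "'a::real_inner"
  assumes "t > 0"
  shows "(norm (x - y))\<^sup>2 \<le> (1 + t) * (norm x)\<^sup>2 + (1 + 1 / t) * (norm y)\<^sup>2"
proof -
  have "0 \<le> (t * norm x - norm y)\<^sup>2 / t" using assms by simp
  also have "\<dots> = t * (norm x)\<^sup>2 - 2 * (norm x * norm y) + (norm y)\<^sup>2 / t"
    using assms by (simp add: power2_eq_square field_simps)
  finally have "2 * (norm x * norm y) \<le> t * (norm x)\<^sup>2 + (norm y)\<^sup>2 / t" by simp
  moreover have "(norm (x - y))\<^sup>2 \<le> (norm x + norm y)\<^sup>2"
    by (intro power_mono norm_triangle_ineq4) auto
  ultimately show ?thesis by (simp add: power2_sum algebra_simps)
qed

lemma continuous_in_L2_ball: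
  fixes f :: "real^'n \<Rightarrow> real"
  assumes "continuous_on UNIV f"
  shows "in_Lq 2 (ball 0 r) f"
proof -
  let ?f = "\<lambda>x. indicator (cball 0 r) x *\<^sub>R f x"
  have c: "continuous_on (cball 0 r) f" using assms continuous_on_subset by blast
  have "integrable lborel ?f" using c by (intro borel_integrable_compact) auto
  then have i: "integrable lebesgue ?f" by (subst integrable_completion) auto
  have "compact (f ` cball 0 r)" using c by (intro compact_continuous_image) auto
  then obtain C where C: "\<And>x. x \<in> cball 0 r \<Longrightarrow> \<bar>f x\<bar> \<le> C"
    by (meson bounded_real compact_imp_bounded imageI)
  have "norm (?f x) \<le> \<bar>C\<bar>" for x
    using C[of x] by (auto simp: indicator_def)
  then have "in_Lq 2 (ball 0 r) ?f"
    using i by (intro in_L2_bounded_support[where B = "\<bar>C\<bar>"]) auto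
  then show ?thesis by (rule in_L2_AE) (auto intro!: AE_I2)
qed

text \<open>The competitor for \<open>u0\<close> is \<open>u0 + \<phi> - \<kappa> \<zeta>\<close>, where \<open>\<phi>\<close> approximates \<open>w - u0\<close>. The shift by
  \<open>\<kappa> \<zeta>\<close> makes up for the positivity set not being continuous along \<open>u0 + \<phi> \<longlonglongrightarrow> w\<close>: inside
  \<open>cball 0 s\<close> the competitor can only be close to positive where \<open>w > 0\<close> or where the
  approximation error is at least \<open>\<kappa> c / 2\<close>, which Chebyshev's inequality controls.\<close>

lemma comparison_step:
  fixes u0 w \<phi> \<zeta> :: "real^'n \<Rightarrow> real" and G0 Gw :: "real^'n \<Rightarrow> real^'n"
  defines "B r \<equiv> ball (0::real^'n) r"
  assumes lam: "\<mu> \<ge> 0"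
    and u0: "has_weak_gradient (B r) u0 G0" "in_Lq 2 (B r) G0" "continuous_on UNIV u0"
    and w: "in_Lq 2 (B r) w" "in_Lq 2 (B r) Gw"
    and var: "\<And>\<phi> \<delta>. test_function (B r) \<phi> \<Longrightarrow> \<delta> > 0 \<Longrightarrow>
      0 \<le> - 2 * (LINT x|lebesgue. u0 x * laplacian \<phi> x) + (LINT x|lebesgue. (norm (gradient \<phi> x))\<^sup>2)
        + \<mu> * (measure lebesgue {x \<in> B r. u0 x + \<phi> x > - \<delta>} - measure lebesgue (pos_set (B r) u0))"
    and \<phi>: "test_function (B r) \<phi>" and \<zeta>: "test_function (B r) \<zeta>"
    and c: "c > 0" "\<And>x. x \<in> cball 0 s \<Longrightarrow> \<zeta> x \<ge> c" and \<kappa>: "\<kappa> > 0" and t: "t > 0"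
  shows "(LINT x:B r|lebesgue. (norm (G0 x))\<^sup>2) + \<mu> * measure lebesgue (pos_set (B r) u0)
    \<le> (1 + t) * (LINT x:B r|lebesgue. (norm (Gw x))\<^sup>2)
      + (1 + 1 / t) * (2 * (LINT x:B r|lebesgue. (norm (Gw x - G0 x - gradient \<phi> x))\<^sup>2)
          + 2 * \<kappa>\<^sup>2 * (LINT x:B r|lebesgue. (norm (gradient \<zeta> x))\<^sup>2))
      + \<mu> * (measure lebesgue (pos_set (B r) w) + measure lebesgue (B r - cball 0 s)
          + (2 / (\<kappa> * c))\<^sup>2 * (LINT x:B r|lebesgue. (w x - u0 x - \<phi> x)\<^sup>2))"
proof -
  have oB: "open (B r)" by (simp add: B_def)
  \<comment> \<open>On \<open>cball 0 s\<close> the shift lowers the function by at least \<kappa>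
    c. Half of this is spent on the tolerance \<delta>, and the other half remains as the threshold
    for the approximation error.\<close>
  let ?\<phi> = "\<lambda>x. \<phi> x + - \<kappa> * \<zeta> x" and ?\<delta> = "\<kappa> * c / 2"
  have \<phi>': "test_function (B r) ?\<phi>" using \<phi> \<zeta> by (intro test_function_add test_function_cmult)
  have grad: "gradient ?\<phi> x = gradient \<phi> x - \<kappa> *\<^sub>R gradient \<zeta> x" for x
    unfolding gradient_add[OF \<phi> test_function_cmult[OF \<zeta>, of "- \<kappa>"]] gradient_cmult[OF \<zeta>] by simp
  have \<delta>: "?\<delta> > 0" using c \<kappa> by simp
  note g\<phi> = in_L2_gradient[OF oB \<phi>] and g\<zeta> = in_L2_gradient[OF oB \<zeta>] and g\<phi>' = in_L2_gradient[OF oB \<phi>']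
  define e where "e x = Gw x - G0 x - gradient \<phi> x" for x
  have e: "in_Lq 2 (B r) e"
    unfolding e_def[abs_def] by (intro in_L2_diff w u0 g\<phi>)
  have E1: "(LINT x:B r|lebesgue. (norm (G0 x + gradient ?\<phi> x))\<^sup>2)
      = (LINT x:B r|lebesgue. (norm (G0 x))\<^sup>2) - 2 * (LINT x|lebesgue. u0 x * laplacian ?\<phi> x)
        + (LINT x|lebesgue. (norm (gradient ?\<phi> x))\<^sup>2)"
    using integral_norm_add_sq[OF u0(2) g\<phi>'] integral_inner_gradient[OF u0(1) \<phi>'] integral_gradient_sq_set[OF \<phi>']
    by simp
  have E2: "(LINT x:B r|lebesgue. (norm (G0 x + gradient ?\<phi> x))\<^sup>2)
    \<le> (1 + t) * (LINT x:B r|lebesgue. (norm (Gw x))\<^sup>2)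
      + (1 + 1 / t) * (2 * (LINT x:B r|lebesgue. (norm (e x))\<^sup>2)
          + 2 * \<kappa>\<^sup>2 * (LINT x:B r|lebesgue. (norm (gradient \<zeta> x))\<^sup>2))"
  proof -
    let ?i = "\<lambda>x. indicat_real (B r) x"
    have "(LINT x|lebesgue. ?i x * (norm (G0 x + gradient ?\<phi> x))\<^sup>2)
      \<le> (LINT x|lebesgue. (1 + t) * (?i x * (norm (Gw x))\<^sup>2)
        + (1 + 1 / t) * (2 * (?i x * (norm (e x))\<^sup>2) + 2 * \<kappa>\<^sup>2 * (?i x * (norm (gradient \<zeta> x))\<^sup>2)))"
    proof (rule Bochner_Integration.integral_mono)
      show "integrable lebesgue (\<lambda>x. ?i x * (norm (G0 x + gradient ?\<phi> x))\<^sup>2)"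
        by (rule in_L2D(2)[OF in_L2_add[OF u0(2) g\<phi>']])
      show "integrable lebesgue (\<lambda>x. (1 + t) * (?i x * (norm (Gw x))\<^sup>2)
        + (1 + 1 / t) * (2 * (?i x * (norm (e x))\<^sup>2) + 2 * \<kappa>\<^sup>2 * (?i x * (norm (gradient \<zeta> x))\<^sup>2)))"
        using in_L2D(2)[OF w(2)] in_L2D(2)[OF e] in_L2D(2)[OF g\<zeta>]
        by (intro Bochner_Integration.integrable_add integrable_mult_right)
      show "?i x * (norm (G0 x + gradient ?\<phi> x))\<^sup>2 \<le> (1 + t) * (?i x * (norm (Gw x))\<^sup>2)
        + (1 + 1 / t) * (2 * (?i x * (norm (e x))\<^sup>2) + 2 * \<kappa>\<^sup>2 * (?i x * (norm (gradient \<zeta> x))\<^sup>2))" for x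
      proof (cases "x \<in> B r")
        case True
        \<comment> \<open>h collects the gradient error of the approximation and the gradient of the
          shift. These two are separated with weight 1, while the weight t serves to separate h from
          \<open>Gw x\<close>.\<close>
        define h where "h = e x + \<kappa> *\<^sub>R gradient \<zeta> x"
        have eq: "G0 x + gradient ?\<phi> x = Gw x - h" unfolding grad e_def h_def by simp
        have "(norm h)\<^sup>2 \<le> 2 * (norm (e x))\<^sup>2 + 2 * (norm (\<kappa> *\<^sub>R gradient \<zeta> x))\<^sup>2"
          using norm_diff_sq_le[of 1 "e x" "- (\<kappa> *\<^sub>R gradient \<zeta> x)"] by (simp add: h_def)
        then have h: "(norm h)\<^sup>2 \<le> 2 * (norm (e x))\<^sup>2 + 2 * \<kappa>\<^sup>2 * (norm (gradient \<zeta> x))\<^sup>2"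
          by (simp add: power_mult_distrib)
        have "(norm (Gw x - h))\<^sup>2 \<le> (1 + t) * (norm (Gw x))\<^sup>2 + (1 + 1 / t) * (norm h)\<^sup>2"
          by (rule norm_diff_sq_le[OF t])
        also have "\<dots> \<le> (1 + t) * (norm (Gw x))\<^sup>2 + (1 + 1 / t) * (2 * (norm (e x))\<^sup>2 + 2 * \<kappa>\<^sup>2 * (norm (gradient \<zeta> x))\<^sup>2)"
          using h t by (intro add_left_mono mult_left_mono) auto
        finally show ?thesis using True unfolding eq by simp
      qed (simp add: indicator_def)
    qed
    then show ?thesis
      using in_L2D(2)[OF w(2)] in_L2D(2)[OF e] in_L2D(2)[OF g\<zeta>]
      by (simp add: set_lebesgue_integral_def)
  qed
  let ?A = "{x \<in> B r. u0 x + ?\<phi> x > - ?\<delta>}"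
  have A: "measure lebesgue ?A \<le> measure lebesgue (pos_set (B r) w) + measure lebesgue (B r - cball 0 s)
      + (2 / (\<kappa> * c))\<^sup>2 * (LINT x:B r|lebesgue. (w x - u0 x - \<phi> x)\<^sup>2)"
  proof -
    let ?a = "\<lambda>x. w x - u0 x - \<phi> x"
    have a: "in_Lq 2 (B r) ?a"
      using w(1) continuous_in_L2_ball[OF u0(3)] in_L2_test[OF oB \<phi>] unfolding B_def by (intro in_L2_diff)
    have mA: "?A \<in> lmeasurable"
      unfolding B_def
      by (intro open_superlevel continuous_on_subset[OF continuous_on_add[OF u0(3) test_function_continuous[OF \<phi>']]] subset_UNIV)
    then have iA: "integrable lebesgue (indicat_real ?A)" unfolding lmeasurable_iff_integrable .
    have P: "pos_set (B r) w \<in> sets lebesgue" by (rule pos_set_lebesgue[OF w(1)])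
    have Bm: "B r \<in> lmeasurable" by (simp add: B_def)
    have mP: "pos_set (B r) w \<in> lmeasurable"
      by (rule fmeasurableI2[OF Bm _ P]) (auto simp: pos_set_def)
    have mD: "B r - cball 0 s \<in> lmeasurable"
      by (rule fmeasurableI2[OF Bm]) (auto simp: B_def)
    have iP: "integrable lebesgue (indicat_real (pos_set (B r) w))" using mP unfolding lmeasurable_iff_integrable .
    have iD: "integrable lebesgue (indicat_real (B r - cball 0 s))" using mD unfolding lmeasurable_iff_integrable .
    have ia: "integrable lebesgue (\<lambda>x. indicat_real (B r) x * (?a x)\<^sup>2)" using in_L2D(2)[OF a] by simp
    have "measure lebesgue ?A = (LINT x|lebesgue. indicat_real ?A x)" using mA by simp
    also have "\<dots> \<le> (LINT x|lebesgue. indicat_real (pos_set (B r) w) x + indicat_real (B r - cball 0 s) x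
        + (2 / (\<kappa> * c))\<^sup>2 * (indicat_real (B r) x * (?a x)\<^sup>2))"
    proof (rule Bochner_Integration.integral_mono[OF iA])
      show "integrable lebesgue (\<lambda>x. indicat_real (pos_set (B r) w) x + indicat_real (B r - cball 0 s) x
        + (2 / (\<kappa> * c))\<^sup>2 * (indicat_real (B r) x * (?a x)\<^sup>2))"
        by (rule Bochner_Integration.integrable_add[OF Bochner_Integration.integrable_add[OF iP iD] integrable_mult_right[OF ia]])
      show "indicat_real ?A x \<le> indicat_real (pos_set (B r) w) x + indicat_real (B r - cball 0 s) x
        + (2 / (\<kappa> * c))\<^sup>2 * (indicat_real (B r) x * (?a x)\<^sup>2)" for x
      proof (cases "x \<in> ?A \<and> x \<notin> pos_set (B r) w \<and> x \<in> cball 0 s")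
        case True
        then have x: "x \<in> B r" "u0 x + ?\<phi> x > - ?\<delta>" "w x \<le> 0" "\<zeta> x \<ge> c"
          using c(2)[of x] by (auto simp: pos_set_def)
        \<comment> \<open>Here w x \<le> 0, while u0 x + \<phi> x exceeds \<kappa> \<zeta> x minus
          half of \<kappa> c, so the approximation misses w by at least \<kappa> c / 2.\<close>
        have "\<kappa> * c \<le> \<kappa> * \<zeta> x" using x(4) \<kappa> by simp
        moreover have "- ?\<delta> < u0 x + (\<phi> x - \<kappa> * \<zeta> x)" using x(2) by simp
        ultimately have "?\<delta> \<le> - ?a x" using x(3) by linarith
        then have "?\<delta> \<le> \<bar>?a x\<bar>" by linarith
        then have "1 \<le> 2 / (\<kappa> * c) * \<bar>?a x\<bar>" using c \<kappa> by (simp add: field_simps)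
        then have "1 \<le> (2 / (\<kappa> * c) * \<bar>?a x\<bar>)\<^sup>2" by (rule one_le_power)
        then have "1 \<le> (2 / (\<kappa> * c))\<^sup>2 * (?a x)\<^sup>2" unfolding power_mult_distrib power2_abs .
        then have "1 \<le> (2 / (\<kappa> * c))\<^sup>2 * (indicat_real (B r) x * (?a x)\<^sup>2)" using x(1) by simp
        moreover have "indicat_real ?A x \<le> 1" "0 \<le> indicat_real (pos_set (B r) w) x"
          "0 \<le> indicat_real (B r - cball 0 s) x"
          by (rule indicator_le_1 indicator_pos_le)+
        ultimately show ?thesis by linarith
      next
        case False
        have "0 \<le> (2 / (\<kappa> * c))\<^sup>2 * (indicat_real (B r) x * (?a x)\<^sup>2)" by simp
        moreover have "indicat_real ?A x \<le> indicat_real (pos_set (B r) w) x + indicat_real (B r - cball 0 s) x"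
          using False by (auto simp: indicator_def)
        ultimately show ?thesis by linarith
      qed
    qed
    also have "\<dots> = measure lebesgue (pos_set (B r) w) + measure lebesgue (B r - cball 0 s)
      + (2 / (\<kappa> * c))\<^sup>2 * (LINT x:B r|lebesgue. (?a x)\<^sup>2)"
      using Bochner_Integration.integral_add[OF Bochner_Integration.integrable_add[OF iP iD] integrable_mult_right[OF ia]]
        Bochner_Integration.integral_add[OF iP iD] mP mD
      by (simp add: set_lebesgue_integral_def)
    finally show ?thesis .
  qed
  have "\<mu> * measure lebesgue ?A \<le> \<mu> * (measure lebesgue (pos_set (B r) w) + measure lebesgue (B r - cball 0 s)
      + (2 / (\<kappa> * c))\<^sup>2 * (LINT x:B r|lebesgue. (w x - u0 x - \<phi> x)\<^sup>2))"
    using A lam by (rule mult_left_mono)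
  then show ?thesis
    using var[OF \<phi>' \<delta>] E1 E2 by (simp add: e_def right_diff_distrib)
qed

text \<open>The parameters leave in a forced order. The Chebyshev term contains \<open>a j\<close>
  divided by the square of \<kappa> c, so the approximation goes to its limit in j before \<kappa>
  tends to 0; the lower bound c of the bump depends on s, so s stays fixed meanwhile. At the end s
  tends to r, which removes the annulus, and t to 0, which restores the exact Dirichlet integral of
  w.\<close>

lemma is_minimizer_if_variations_nonneg:
  fixes u0 :: "real^'n \<Rightarrow> real" and G0 :: "real^'n \<Rightarrow> real^'n"
  defines "B r \<equiv> ball (0::real^'n) r"
  assumes r: "r > 0" and lam: "\<mu> \<ge> 0"
    and u0: "has_weak_gradient (B r) u0 G0" "in_Lq 2 (B r) G0" "continuous_on UNIV u0"
    and var: "\<And>\<phi> \<delta>. test_function (B r) \<phi> \<Longrightarrow> \<delta> > 0 \<Longrightarrow>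
      0 \<le> - 2 * (LINT x|lebesgue. u0 x * laplacian \<phi> x) + (LINT x|lebesgue. (norm (gradient \<phi> x))\<^sup>2)
        + \<mu> * (measure lebesgue {x \<in> B r. u0 x + \<phi> x > - \<delta>} - measure lebesgue (pos_set (B r) u0))"
  shows "is_minimizer (ball 0 r) u0 (J0 \<mu> r) u0"
  unfolding is_minimizer_def
proof
  have oB: "open (B r)" by (simp add: B_def)
  have "u0 \<in> W12 (B r)"
    using u0 continuous_in_L2_ball[OF u0(3), of r] by (auto simp: W12_def B_def)
  then show "u0 \<in> admissible (ball 0 r) u0"
    using W12_0_zero[OF oB] by (simp add: admissible_def B_def)
  show "\<forall>w\<in>admissible (ball 0 r) u0. J0 \<mu> r u0 \<le> J0 \<mu> r w"
  proof
    fix w assume "w \<in> admissible (ball 0 r) u0"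
    then have wW: "w \<in> W12 (B r)" and w0: "(\<lambda>x. w x - u0 x) \<in> W12_0 (B r)"
      by (auto simp: admissible_def B_def)
    define Gw where "Gw = weak_gradient (B r) w"
    note w = W12D[OF oB wW, folded Gw_def]
    obtain \<phi> where \<phi>: "\<And>j::nat. test_function (B r) (\<phi> j)"
      "(\<lambda>j. norm_W12 (B r) (\<lambda>x. w x - u0 x - \<phi> j x)) \<longlonglongrightarrow> 0"
      using w0 by (auto simp: W12_0_def)
    define a where "a j = (LINT x:B r|lebesgue. (w x - u0 x - \<phi> j x)\<^sup>2)" for j
    define b where "b j = (LINT x:B r|lebesgue. (norm (Gw x - G0 x - gradient (\<phi> j) x))\<^sup>2)" for j
    have nn: "0 \<le> a j" "0 \<le> b j" for j
      unfolding a_def b_def set_lebesgue_integral_def by (intro integral_nonneg_AE AE_I2; simp)+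
    have "norm_W12 (B r) (\<lambda>x. w x - u0 x - \<phi> j x) = sqrt (a j + b j)" for j
      unfolding a_def b_def
      by (rule norm_W12_eq[OF oB has_weak_gradient_diff[OF has_weak_gradient_diff[OF w(2) u0(1)] has_weak_gradient_test[OF \<phi>(1)]]])
    then have "(\<lambda>j. (sqrt (a j + b j))\<^sup>2) \<longlonglongrightarrow> 0\<^sup>2" using \<phi>(2) by (intro tendsto_power) simp
    then have ab: "(\<lambda>j. a j + b j) \<longlonglongrightarrow> 0" using nn by simp
    have alim: "a \<longlonglongrightarrow> 0"
      by (rule tendsto_sandwich[OF _ _ tendsto_const ab]) (use nn in \<open>auto intro!: always_eventually\<close>)
    have blim: "b \<longlonglongrightarrow> 0"
      by (rule tendsto_sandwich[OF _ _ tendsto_const ab]) (use nn in \<open>auto intro!: always_eventually\<close>)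
    define D0 where "D0 = (LINT x:B r|lebesgue. (norm (G0 x))\<^sup>2) + \<mu> * measure lebesgue (pos_set (B r) u0)"
    define Dw where "Dw = (LINT x:B r|lebesgue. (norm (Gw x))\<^sup>2)"
    define pw where "pw = measure lebesgue (pos_set (B r) w)"
    define V where "V s = measure lebesgue (B r - cball 0 s)" for s
    have main: "D0 \<le> (1 + t) * Dw + \<mu> * (pw + V s)" if s: "0 < s" "s < r" and t: "t > 0" for s t
    proof -
      \<comment> \<open>The supporting radius 1 / \<tau> is the midpoint of s and r: the bump is
        positive on all of \<open>cball 0 s\<close> and still supported inside the ball of radius
        r.\<close>
      define \<tau> where "\<tau> = 2 / (s + r)"
      have \<tau>: "\<tau> > 0" "s < 1 / \<tau>" "1 / \<tau> < r" using s by (auto simp: \<tau>_def field_simps)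
      define \<zeta> :: "real^'n \<Rightarrow> real" where "\<zeta> = radial_bump 1 \<tau>"
      have \<zeta>: "test_function (B r) \<zeta>"
        unfolding \<zeta>_def B_def using \<tau> by (intro test_function_radial_bump) (auto simp: subset_iff)
      \<comment> \<open>The minimum over the compact ball provides the constant c of
        \<open>comparison_step\<close>.\<close>
      have "\<exists>y\<in>cball 0 s. \<forall>x\<in>cball 0 s. \<zeta> y \<le> \<zeta> x"
        using s test_function_continuous[OF \<zeta>]
        by (intro continuous_attains_inf) (auto intro: continuous_on_subset)
      then obtain y where y: "y \<in> cball 0 s" "\<And>x. x \<in> cball 0 s \<Longrightarrow> \<zeta> y \<le> \<zeta> x" by blast
      have "y \<in> ball 0 (1 / \<tau>)" using y(1) \<tau>(2) by simp
      from radial_bump_pos_arg[OF \<tau>(1) this] have c: "\<zeta> y > 0"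
        unfolding \<zeta>_def radial_bump_def exp_bump_1 by simp
      define Z where "Z = (LINT x:B r|lebesgue. (norm (gradient \<zeta> x))\<^sup>2)"
      have step: "D0 \<le> (1 + t) * Dw + (1 + 1 / t) * (2 * b j + 2 * \<kappa>\<^sup>2 * Z) + \<mu> * (pw + V s + (2 / (\<kappa> * \<zeta> y))\<^sup>2 * a j)"
        if "\<kappa> > 0" for \<kappa> j
        unfolding D0_def Dw_def pw_def V_def a_def b_def Z_def B_def
        by (rule comparison_step[OF lam u0[unfolded B_def] w(1,3)[unfolded B_def] var[unfolded B_def] \<phi>(1)[unfolded B_def] \<zeta>[unfolded B_def] c y(2) that t])
      have step2: "D0 \<le> (1 + t) * Dw + (1 + 1 / t) * (2 * \<kappa>\<^sup>2 * Z) + \<mu> * (pw + V s)" if "\<kappa> > 0" for \<kappa>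
      proof (rule tendsto_lowerbound)
        have "(\<lambda>j. (1 + t) * Dw + (1 + 1 / t) * (2 * b j + 2 * \<kappa>\<^sup>2 * Z) + \<mu> * (pw + V s + (2 / (\<kappa> * \<zeta> y))\<^sup>2 * a j))
          \<longlonglongrightarrow> (1 + t) * Dw + (1 + 1 / t) * (2 * 0 + 2 * \<kappa>\<^sup>2 * Z) + \<mu> * (pw + V s + (2 / (\<kappa> * \<zeta> y))\<^sup>2 * 0)"
          by (intro tendsto_add tendsto_mult tendsto_const alim blim)
        then show "(\<lambda>j. (1 + t) * Dw + (1 + 1 / t) * (2 * b j + 2 * \<kappa>\<^sup>2 * Z) + \<mu> * (pw + V s + (2 / (\<kappa> * \<zeta> y))\<^sup>2 * a j))
          \<longlonglongrightarrow> (1 + t) * Dw + (1 + 1 / t) * (2 * \<kappa>\<^sup>2 * Z) + \<mu> * (pw + V s)" by simp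
      qed (use step[OF that] in auto)
      show ?thesis
      proof (rule tendsto_lowerbound)
        have "(\<lambda>k. (1 + t) * Dw + (1 + 1 / t) * (2 * (inverse (real (Suc k)))\<^sup>2 * Z) + \<mu> * (pw + V s))
          \<longlonglongrightarrow> (1 + t) * Dw + (1 + 1 / t) * (2 * 0\<^sup>2 * Z) + \<mu> * (pw + V s)"
          by (intro tendsto_add tendsto_mult tendsto_power tendsto_const LIMSEQ_inverse_real_of_nat)
        then show "(\<lambda>k. (1 + t) * Dw + (1 + 1 / t) * (2 * (inverse (real (Suc k)))\<^sup>2 * Z) + \<mu> * (pw + V s))
          \<longlonglongrightarrow> (1 + t) * Dw + \<mu> * (pw + V s)" by simp
        show "\<forall>\<^sub>F k in sequentially. D0 \<le> (1 + t) * Dw + (1 + 1 / t) * (2 * (inverse (real (Suc k)))\<^sup>2 * Z) + \<mu> * (pw + V s)"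
          by (intro always_eventually allI step2) simp
      qed simp
    qed
    have D0: "D0 \<le> Dw + \<mu> * pw"
    proof (rule tendsto_lowerbound)
      let ?t = "\<lambda>k. inverse (real (Suc k))" and ?n = "CARD('n)"
      \<comment> \<open>Halving \<open>?t k\<close> keeps the radius positive at k = 0, where
        \<open>?t k\<close> is 1.\<close>
      let ?s = "\<lambda>k. r * (1 - ?t k / 2)"
      define c where "c = unit_ball_vol (real ?n)"
      have s: "0 < ?s k" "?s k < r" for k
      proof -
        have "?t k \<le> 1" "?t k > 0" by (auto simp: field_simps)
        then have "?t k / 2 < 1" "?t k / 2 > 0" by linarith+
        then show "0 < ?s k" "?s k < r" using r by simp_all
      qed
      have V: "V (?s k) = c * r ^ ?n - c * (?s k) ^ ?n" for k
      proof -
        have "V (?s k) = measure lebesgue (B r) - measure lebesgue (cball (0::real^'n) (?s k))"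
          unfolding V_def using s[of k] by (intro measurable_measure_Diff) (auto simp: B_def)
        then show ?thesis
          using content_ball[of r "0::real^'n"] content_cball[of "?s k" "0::real^'n"] s[of k] r
          by (simp add: B_def c_def)
      qed
      have tl: "?t \<longlonglongrightarrow> 0" by (rule LIMSEQ_inverse_real_of_nat)
      have "(\<lambda>k. (1 + ?t k) * Dw + \<mu> * (pw + (c * r ^ ?n - c * (?s k) ^ ?n)))
        \<longlonglongrightarrow> (1 + 0) * Dw + \<mu> * (pw + (c * r ^ ?n - c * (r * (1 - 0 / 2)) ^ ?n))"
        by (intro tendsto_intros tl) simp
      then show "(\<lambda>k. (1 + ?t k) * Dw + \<mu> * (pw + V (?s k))) \<longlonglongrightarrow> Dw + \<mu> * pw"
        unfolding V by simp
      show "\<forall>\<^sub>F k in sequentially. D0 \<le> (1 + ?t k) * Dw + \<mu> * (pw + V (?s k))"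
        by (intro always_eventually allI main s) simp
    qed simp
    have "J0 \<mu> r u0 = D0"
      using dirichlet_eq[OF oB u0(1)] by (simp add: J0_def D0_def B_def)
    moreover have "J0 \<mu> r w = Dw + \<mu> * pw"
      by (simp add: J0_def dirichlet_def Dw_def pw_def Gw_def B_def)
    ultimately show "J0 \<mu> r u0 \<le> J0 \<mu> r w" using D0 by simp
  qed
qed

lemma continuous_on_if_holder_bound:
  assumes "holder_bound (1 / 2) S C f"
  shows "continuous_on S f"
  unfolding continuous_on_iff
proof (intro ballI allI impI)
  fix x e assume x: "x \<in> S" and e: "(e::real) > 0"
  \<comment> \<open>The solution of (|C| + 1) d^(1/2) = e, where the 1 covers C = 0.\<close>
  define d where "d = (e / (\<bar>C\<bar> + 1)) powr 2"
  have d: "d > 0" using e by (simp add: d_def)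
  have "dist (f y) (f x) < e" if y: "y \<in> S" "dist y x < d" for y
  proof -
    have "\<bar>f y - f x\<bar> \<le> C * dist y x powr (1 / 2)"
      using assms x y(1) by (auto simp: holder_bound_def)
    also have "\<dots> \<le> \<bar>C\<bar> * dist y x powr (1 / 2)" by (intro mult_right_mono) auto
    also have "\<dots> \<le> \<bar>C\<bar> * d powr (1 / 2)"
      using y(2) by (intro mult_left_mono powr_mono2) auto
    also have "d powr (1 / 2) = e / (\<bar>C\<bar> + 1)" using e by (simp add: d_def powr_powr)
    also have "\<bar>C\<bar> * (e / (\<bar>C\<bar> + 1)) < e" using e by (simp add: field_simps)
    finally show ?thesis by (simp add: dist_real_def)
  qed
  then show "\<exists>d>0. \<forall>y\<in>S. dist y x < d \<longrightarrow> dist (f y) (f x) < e" using d by blast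
qed

theorem theorem1p5:
  fixes \<Omega> :: "(real^'n) set" and Q u ubar u0 :: "real^'n \<Rightarrow> real"
    and \<Phi> :: "real \<times> real \<Rightarrow> real" and lam1 lam2 Q1 Q2 varpi :: real
  assumes "open \<Omega>" and "bounded \<Omega>"
    and "lam1 \<ge> 0" and "lam2 > 0"
    and "set_borel_measurable lebesgue \<Omega> Q"
    and "0 < Q1" and "\<And>x. x \<in> \<Omega> \<Longrightarrow> Q1 \<le> Q x \<and> Q x \<le> Q2"
    and "continuous_on ({0..} \<times> {0..}) \<Phi>"
    and "\<And>a b. a \<ge> 0 \<Longrightarrow> b \<ge> 0 \<Longrightarrow> \<Phi> (a, b) \<ge> 0"
    and "Ck_on 1 ({0<..} \<times> {0<..}) \<Phi>"
    and "\<And>a b. a > 0 \<Longrightarrow> b > 0 \<Longrightarrow> \<Phi> (a, b) > 0"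
    and "\<Phi> (0, 0) = 0"
    and "ubar \<in> W12 \<Omega>"
    and "is_minimizer \<Omega> ubar (J \<Phi> lam1 lam2 Q \<Omega>) u"
    and "0 \<in> \<Omega>" and "0 \<in> frontier (pos_set \<Omega> u)"
    and "blowup_limit \<Omega> u u0"
    and "continuous (at 0 within \<Omega>) Q"
    and "\<And>r. 0 < r \<Longrightarrow> r < lam2 * total_Q \<Omega> Q \<Longrightarrow>
           (Phi0 \<Phi> lam1 lam2 Q \<Omega>) differentiable (at r) \<and> deriv (Phi0 \<Phi> lam1 lam2 Q \<Omega>) r \<ge> 0"
    and "varpi > 0" and "measure lebesgue (pos_set \<Omega> u) \<ge> varpi"
  shows "\<forall>r>0. is_minimizer (ball 0 r) u0
           (J0 (lam2 * Q 0 * deriv (Phi0 \<Phi> lam1 lam2 Q \<Omega>) (M2 lam2 Q \<Omega> u)) r) u0"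
proof (intro allI impI)
  fix r :: real assume r: "r > 0"
  interpret bernoulli_minimizer \<Omega> Q u ubar \<Phi> lam1 lam2 Q1 Q2
    by (rule bernoulli_minimizer.intro) (fact assms)+
  obtain \<sigma> s where \<sigma>: "\<And>k. \<sigma> k > 0" "\<sigma> \<longlonglongrightarrow> 0" "strict_mono (s :: nat \<Rightarrow> nat)"
      and conv: "blowup_conv \<Omega> u (\<sigma> \<circ> s) u0" and u0: "continuous_on UNIV u0"
    using assms(17) unfolding blowup_limit_def by blast
  define \<rho> where "\<rho> = \<sigma> \<circ> s"
  have \<rho>: "\<And>k. \<rho> k > 0" "\<rho> \<longlonglongrightarrow> 0"
    using \<sigma>(1) LIMSEQ_subseq_LIMSEQ[OF \<sigma>(2,3)] by (auto simp: \<rho>_def)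
  have holder: "conv_Calpha_loc (1 / 2) (\<lambda>k. rescale (\<rho> k) u) u0"
    using conv unfolding blowup_conv_def \<rho>_def by simp
  have unif: "\<forall>\<^sub>F k in sequentially. \<forall>x\<in>cball 0 R. \<bar>rescale (\<rho> k) u x - u0 x\<bar> \<le> \<epsilon>"
    if "R > 0" "\<epsilon> > 0" for R \<epsilon>
  proof -
    have "\<forall>\<^sub>F k in sequentially. holder_bound (1 / 2) (cball 0 R) \<epsilon> (\<lambda>x. rescale (\<rho> k) u x - u0 x)"
      using holder that by (simp add: conv_Calpha_loc_def)
    then show ?thesis by eventually_elim (simp add: holder_bound_def)
  qed
  have contk: "\<forall>\<^sub>F k in sequentially. continuous_on (cball 0 R) (rescale (\<rho> k) u)" if "R > 0" for R
  proof -
    have "\<forall>\<^sub>F k in sequentially. holder_bound (1 / 2) (cball 0 R) 1 (\<lambda>x. rescale (\<rho> k) u x - u0 x)"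
      using holder that by (simp add: conv_Calpha_loc_def)
    then show ?thesis
    proof eventually_elim
      case (elim k)
      have "continuous_on (cball 0 R) (\<lambda>x. (rescale (\<rho> k) u x - u0 x) + u0 x)"
        by (intro continuous_on_add continuous_on_if_holder_bound[OF elim] continuous_on_subset[OF u0]) simp
      then show ?case by simp
    qed
  qed
  obtain k where k: "continuous_on (cball 0 1) (rescale (\<rho> k) u)"
    using contk[of 1] eventually_happens by force
  \<comment> \<open>The convergence hypothesis speaks of the rescalings; undoing the dilation of a
    single one that is continuous on the unit ball gives continuity of u itself near 0.\<close>
  have cont: "continuous_on (ball 0 (\<rho> k)) u"
  proof -
    have "continuous_on (ball 0 (\<rho> k)) (\<lambda>y. \<rho> k * rescale (\<rho> k) u (y /\<^sub>R \<rho> k))"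
      using \<rho>(1)[of k] by (intro continuous_intros continuous_on_compose2[OF k]) (auto simp: field_simps)
    then show ?thesis using \<rho>(1)[of k] by (simp add: rescale_def)
  qed
  \<comment> \<open>Positivity at 0 would persist in a neighbourhood and put 0 into the interior of
    the positivity set.\<close>
  have u_le: "u 0 \<le> 0"
  proof (rule ccontr)
    assume "\<not> u 0 \<le> 0"
    let ?U = "ball 0 (\<rho> k) \<inter> u -` {0<..} \<inter> \<Omega>"
    have "open ?U"
      by (rule open_Int[OF continuous_open_preimage[OF cont open_ball open_greaterThan] open_dom])
    moreover have "0 \<in> ?U" using \<open>\<not> u 0 \<le> 0\<close> \<rho>(1)[of k] assms(15) by simp
    moreover have "?U \<subseteq> pos_set \<Omega> u" by (auto simp: pos_set_def)
    ultimately have "0 \<in> interior (pos_set \<Omega> u)" by (meson interiorI)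
    then show False using assms(16) by (simp add: frontier_def)
  qed
  have M: "0 < M u" "M u < lam2 * total_Q \<Omega> Q"
    using M_pos assms(20,21) M_less[OF cont \<rho>(1) assms(15) u_le] by auto
  define D where "D = deriv \<Phi>0 (M u)"
  have D: "(\<Phi>0 has_real_derivative D) (at (M u))" "D \<ge> 0"
    using Phi0_deriv[OF M] DERIV_deriv_iff_real_differentiable by (auto simp: D_def)
  have w: "has_weak_gradient UNIV u0 (weak_gradient UNIV u0)"
    using conv weak_gradient_works unfolding blowup_conv_def by blast
  \<comment> \<open>The exponent 2 supplies square integrability of the gradient of u0 on balls, so
    that u0 is itself admissible.\<close>
  have "weak_conv_Lq_loc 2 (\<lambda>k. weak_gradient (scaled_domain ((\<sigma> \<circ> s) k) \<Omega>) (rescale ((\<sigma> \<circ> s) k) u)) (weak_gradient UNIV u0)"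
    using conv unfolding blowup_conv_def by simp
  then have L2: "in_Lq 2 (ball 0 r) (weak_gradient UNIV u0)"
    using r unfolding weak_conv_Lq_loc_def by blast
  have ind: "indicator_conv_L1_loc (\<lambda>k. pos_set (scaled_domain (\<rho> k) \<Omega>) (rescale (\<rho> k) u)) (pos_set UNIV u0)"
    using conv unfolding blowup_conv_def \<rho>_def by blast
  have "Q 0 \<ge> 0" using Q_bounds[OF assms(15)] Q1 by simp
  then have "lam2 * Q 0 * D \<ge> 0" using lam2 D(2) by simp
  then show "is_minimizer (ball 0 r) u0 (J0 (lam2 * Q 0 * deriv \<Phi>0 (M u)) r) u0"
    unfolding D_def[symmetric]
  proof (rule is_minimizer_if_variations_nonneg[OF r _ has_weak_gradient_mono[OF w subset_UNIV] L2 u0])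
    fix \<phi> :: "real^'n \<Rightarrow> real" and \<delta> :: real
    assume \<phi>: "test_function (ball 0 r) \<phi>" and \<delta>: "\<delta> > 0"
    show "0 \<le> - 2 * (LINT x|lebesgue. u0 x * laplacian \<phi> x) + (LINT x|lebesgue. (norm (gradient \<phi> x))\<^sup>2)
      + lam2 * Q 0 * D * (measure lebesgue {x \<in> ball 0 r. u0 x + \<phi> x > - \<delta>} - measure lebesgue (pos_set (ball 0 r) u0))"
      by (rule blowup_variation[OF \<rho> _ _ u0 ind assms(15,18) D r \<phi> \<delta>]) (erule (1) unif, erule contk)
  qed
qed

end
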